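(* Let $n\ge 4$ be an integer and let $\mathcal{T}$ be a cyclotomic substitution tiling of the complex plane (vertices in $\mathbb{Z}[\zeta_{2n}]$, $\zeta_{2n}=e^{2\pi\mathtt{i}/(2n)}$) with inflation multiplier $\eta\in\mathbb{Z}[\zeta_{2n}]$, such that: (i) all prototiles have areas of the form $R\sin(k\pi/n)$ with a fixed real $R>0$ and integers $0<k<n$; (ii) $\lambda=|\eta^2|=\sum_{k=1}^{\lfloor n/2\rfloor}c_k\,\mu_{n,k}$ with $c_k\in\mathbb{N}_0$, $\max_k c_k>0$, where $\mu_{n,k}=\sin(k\pi/n)/\sin(\pi/n)$; (iii) $\lambda\notin\mathbb{N}$; (iv) if $n$ is even and $n>4$, then $\min\bigl(\max_{k\text{ odd}}c_k,\ \max_{k\text{ even}}c_k\bigr)\ge 1$ (the maxima being over $1\le k\le\lfloor n/2\rfloor$); (v) after combining prototiles of equal area, the substitution matrix of $\mathcal{T}$ is the primitive matrix $M_n=\sum_{k=1}^{\lfloor n/2\rfloor}c_kM_{n,k}$. Suppose that at least one substitution rule contains a pair of copies of one prototile whose rotational orientations differ by an angle $\frac{k\pi}{n}$ for some integer $k$ with $0<k<n$. Then $\mathcal{T}$ is aperiodic.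
   Context: A tile is a nonempty compact subset of the plane that is the closure of its interior; a tiling is a countable set of tiles covering the plane with pairwise disjoint interiors; a patch is a finite subset of a tiling. A tiling is aperiodic if no nonzero translation maps the tiling to itself. A substitution is given by finitely many prototiles, an inflation multiplier $\eta$ with $|\eta|>1$, and, for every prototile, a substitution rule: a dissection of the prototile expanded by $z\mapsto\eta z$ into copies of prototiles in original size. The rules are applied to copies of prototiles accordingly and can be iterated. A substitution tiling for these rules is a tiling by copies of the prototiles each of whose patches occurs in some iterate of the substitution applied to a prototile. It is cyclotomic (a CAST) if the coordinates of all vertices of all tiles are in $\mathbb{Z}[\zeta_{2n}]$; CASTs have finite rotations, i.e. each prototile occurs in only finitely many orientations. The substitution matrix has as its $(i,j)$ entry the number of tiles of class $j$ in the dissection of an expanded tile of class $i$. All prototiles of equal area are combined into one class; since $\sin((n-k)\pi/n)=\sin(k\pi/n)$, the classes are indexed by $1\le k\le\lfloor n/2\rfloor$, class $k$ having area $R\sin(k\pi/n)$. A non-negative square matrix is primitive if some positive power has all entries strictly positive. Matrices $M_{n,h}$ ($1\le h\le\lfloor n/2\rfloor$): rows and columns are indexed by $1,\dots,\lfloor n/2\rfloor$. For $1\le h,k\le\lfloor n/2\rfloor$ consider the list of integers $|k-h|+1,|k-h|+3,\dots,k+h-1$. Replace each element $m>\lfloor n/2\rfloor$ by $n-m$. Then $(M_{n,h})_{k,j}$ is the number of times $j$ occurs in the resulting list; $M_{n,1}$ is the identity matrix. *)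

theory Defs
  imports "HOL-Analysis.Analysis" "HOL-Computational_Algebra.Polynomial"
begin

definition is_tile :: "complex set \<Rightarrow> bool" where
  "is_tile K \<longleftrightarrow> K \<noteq> {} \<and> compact K \<and> closure (interior K) = K"

definition is_tiling :: "complex set set \<Rightarrow> bool" where
  "is_tiling T \<longleftrightarrow> countable T \<and> (\<forall>t\<in>T. is_tile t) \<and> \<Union>T = UNIV \<and>
     (\<forall>s\<in>T. \<forall>t\<in>T. s \<noteq> t \<longrightarrow> interior s \<inter> interior t = {})"

definition is_patch :: "complex set set \<Rightarrow> complex set set \<Rightarrow> bool" where
  "is_patch F T \<longleftrightarrow> finite F \<and> F \<subseteq> T"

definition aperiodic :: "complex set set \<Rightarrow> bool" where
  "aperiodic T \<longleftrightarrow> (\<forall>v. v \<noteq> 0 \<longrightarrow> (\<lambda>t. (+) v ` t) ` T \<noteq> T)"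

text \<open>To speak of vertices, tiles have to be polygonal. Convexity, connectedness and
  simple connectedness are not required.\<close>
definition polygonal :: "complex set \<Rightarrow> bool" where
  "polygonal K \<longleftrightarrow>
     (\<exists>E. finite E \<and> frontier K \<subseteq> (\<Union>(a, b)\<in>E. closed_segment a b))"

text \<open>The vertices are the corners: the boundary points near which \<open>K\<close> does not
  coincide with a closed half-plane.\<close>
definition vertices :: "complex set \<Rightarrow> complex set" where
  "vertices K = {p \<in> frontier K.
     \<not> (\<exists>a e. a \<noteq> 0 \<and> e > 0 \<and> K \<inter> ball p e = {z. a \<bullet> (z - p) \<ge> 0} \<inter> ball p e)}"

definition area :: "complex set \<Rightarrow> real" where
  "area K = measure lebesgue K"

text \<open>A pair \<open>(q, g)\<close> stands for the copy \<open>g ` P q\<close> of the prototile \<open>P q\<close>. The isometry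
  is recorded because it determines, also for a symmetric prototile, how the
  substitution rule is to be applied to the copy. Reflected copies are allowed.\<close>
type_synonym 'p tile_copy = "'p \<times> (complex \<Rightarrow> complex)"

definition is_isometry :: "(complex \<Rightarrow> complex) \<Rightarrow> bool" where
  "is_isometry g \<longleftrightarrow> (\<forall>x y. dist (g x) (g y) = dist x y)"

definition support :: "('p \<Rightarrow> complex set) \<Rightarrow> 'p tile_copy \<Rightarrow> complex set" where
  "support P t = snd t ` P (fst t)"

text \<open>\<open>D p\<close> is the dissection of the expanded prototile \<open>\<eta> \<cdot> P p\<close>.\<close>
definition is_substitution ::
  "complex \<Rightarrow> ('p::finite \<Rightarrow> complex set) \<Rightarrow> ('p \<Rightarrow> 'p tile_copy set) \<Rightarrow> bool" where
  "is_substitution \<eta> P D \<longleftrightarrow> norm \<eta> > 1 \<and>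
     (\<forall>p. is_tile (P p) \<and> polygonal (P p) \<and>
          finite (D p) \<and> (\<forall>t\<in>D p. is_isometry (snd t)) \<and>
          (\<Union>t\<in>D p. support P t) = (*) \<eta> ` P p \<and>
          (\<forall>s\<in>D p. \<forall>t\<in>D p. s \<noteq> t \<longrightarrow> interior (support P s) \<inter> interior (support P t) = {}))"

text \<open>The map \<open>z \<mapsto> \<eta> \<cdot> g (z / \<eta>)\<close> is the isometry which carries the expanded prototile
  \<open>\<eta> \<cdot> P p\<close> to the expanded copy \<open>\<eta> \<cdot> g ` P p\<close>.\<close>
definition substitute ::
  "complex \<Rightarrow> ('p \<Rightarrow> 'p tile_copy set) \<Rightarrow> 'p tile_copy set \<Rightarrow> 'p tile_copy set" where
  "substitute \<eta> D X = (\<Union>(p, g)\<in>X. (\<lambda>(q, h). (q, \<lambda>z. \<eta> * g (h z / \<eta>))) ` D p)"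

definition iterate_substitution ::
  "complex \<Rightarrow> ('p \<Rightarrow> 'p tile_copy set) \<Rightarrow> nat \<Rightarrow> 'p \<Rightarrow> 'p tile_copy set" where
  "iterate_substitution \<eta> D m p = (substitute \<eta> D ^^ m) {(p, \<lambda>z. z)}"

text \<open>A patch occurs in an iterate if a congruent copy of it is contained in the iterate.\<close>
definition is_substitution_tiling ::
  "complex \<Rightarrow> ('p::finite \<Rightarrow> complex set) \<Rightarrow> ('p \<Rightarrow> 'p tile_copy set) \<Rightarrow> complex set set \<Rightarrow> bool"
  where
  "is_substitution_tiling \<eta> P D T \<longleftrightarrow> is_tiling T \<and>
     (\<forall>t\<in>T. \<exists>p g. is_isometry g \<and> t = support P (p, g)) \<and>
     (\<forall>F. is_patch F T \<longrightarrow>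
        (\<exists>p m f. is_isometry f \<and>
           (\<lambda>t. f ` t) ` F \<subseteq> support P ` iterate_substitution \<eta> D m p))"

text \<open>The linear parts of \<open>g\<close> and \<open>h\<close> differ by the rotation through the angle \<open>\<alpha>\<close>; in
  particular \<open>g\<close> and \<open>h\<close> are both direct or both reflected.\<close>
definition orientations_differ_by ::
  "real \<Rightarrow> (complex \<Rightarrow> complex) \<Rightarrow> (complex \<Rightarrow> complex) \<Rightarrow> bool" where
  "orientations_differ_by \<alpha> g h \<longleftrightarrow> (\<exists>b. \<forall>z. h z = cis \<alpha> * g z + b)"

definition zeta :: "nat \<Rightarrow> complex" where
  "zeta m = exp (2 * complex_of_real pi * \<i> / of_nat m)"

definition cyclotomic_ring :: "nat \<Rightarrow> complex set" where
  "cyclotomic_ring m = range (\<lambda>f :: int poly. poly (map_poly of_int f) (zeta m))"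

definition is_cyclotomic :: "nat \<Rightarrow> complex set set \<Rightarrow> bool" where
  "is_cyclotomic n T \<longleftrightarrow> (\<forall>t\<in>T. vertices t \<subseteq> cyclotomic_ring (2 * n))"

definition mu :: "nat \<Rightarrow> nat \<Rightarrow> real" where
  "mu n k = sin (real k * pi / real n) / sin (pi / real n)"

text \<open>Rows and columns are indexed by \<open>1, \<dots>, d\<close>; other arguments are irrelevant.\<close>
fun mat_power :: "nat \<Rightarrow> (nat \<Rightarrow> nat \<Rightarrow> nat) \<Rightarrow> nat \<Rightarrow> nat \<Rightarrow> nat \<Rightarrow> nat" where
  "mat_power d A 0 i j = (if i = j then 1 else 0)"
| "mat_power d A (Suc m) i j = (\<Sum>l=1..d. mat_power d A m i l * A l j)"

definition primitive_matrix :: "nat \<Rightarrow> (nat \<Rightarrow> nat \<Rightarrow> nat) \<Rightarrow> bool" where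
  "primitive_matrix d A \<longleftrightarrow> (\<exists>m>0. \<forall>i\<in>{1..d}. \<forall>j\<in>{1..d}. mat_power d A m i j > 0)"

text \<open>The list \<open>\<bar>k - h\<bar> + 1, \<bar>k - h\<bar> + 3, \<dots>, k + h - 1\<close> has \<open>min h k\<close> elements.\<close>
definition product_list :: "nat \<Rightarrow> nat \<Rightarrow> nat list" where
  "product_list h k = map (\<lambda>l. nat \<bar>int k - int h\<bar> + 1 + 2 * l) [0..<min h k]"

definition M_matrix :: "nat \<Rightarrow> nat \<Rightarrow> nat \<Rightarrow> nat \<Rightarrow> nat" where
  "M_matrix n h k j =
     count_list (map (\<lambda>m. if m > n div 2 then n - m else m) (product_list h k)) j"

definition M_combination :: "nat \<Rightarrow> (nat \<Rightarrow> nat) \<Rightarrow> nat \<Rightarrow> nat \<Rightarrow> nat" where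
  "M_combination n c k j = (\<Sum>h=1..n div 2. c h * M_matrix n h k j)"

text \<open>Class \<open>k\<close> consists of all prototiles of area \<open>R sin (k \<pi> / n)\<close>. For \<open>n \<ge> 2\<close> and
  \<open>1 \<le> k \<le> n div 2\<close> these areas are pairwise different.\<close>
definition in_class :: "nat \<Rightarrow> real \<Rightarrow> ('p \<Rightarrow> complex set) \<Rightarrow> 'p \<Rightarrow> nat \<Rightarrow> bool" where
  "in_class n R P p k \<longleftrightarrow> area (P p) = R * sin (real k * pi / real n)"

definition is_class_substitution_matrix ::
  "nat \<Rightarrow> real \<Rightarrow> ('p::finite \<Rightarrow> complex set) \<Rightarrow> ('p \<Rightarrow> 'p tile_copy set) \<Rightarrow>
   (nat \<Rightarrow> nat \<Rightarrow> nat) \<Rightarrow> bool" where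
  "is_class_substitution_matrix n R P D A \<longleftrightarrow>
     (\<forall>i\<in>{1..n div 2}. \<forall>j\<in>{1..n div 2}. \<forall>p. in_class n R P p i \<longrightarrow>
        card {t \<in> D p. in_class n R P (fst t) j} = A i j)"

end

theory Submission
  imports Defs
begin

text \<open>Suppose that \<open>T\<close> has a period \<open>v \<noteq> 0\<close>, and let \<open>S\<close> be a supertile of level \<open>k\<close> in \<open>T\<close>, that is, a
  union of tiles similar to a prototile with factor \<open>|\<eta>| ^ k\<close>. At an extreme point of \<open>S\<close> transversally
  to \<open>v\<close> two edges of \<open>S\<close> meet, and the \<open>v\<close>-translates of one of them cut the other one into pieces of
  equal length \<open>\<omega>\<close>. As the translates of \<open>S\<close> are unions of tiles, too, the tiles along the edge end at the
  cutting points. Hence \<open>|\<eta>| ^ k * l = N * \<omega> + \<delta>\<close>, where \<open>l\<close> is the length of an edge of a prototile and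
  \<open>\<omega>\<close>, \<open>\<delta>\<close> are sums of distances between vertices of a prototile. Only finitely many triples
  \<open>(l, \<omega>, \<delta>)\<close> occur, so infinitely many powers of \<open>lam\<close> lie in one arithmetic progression. For the dominant
  eigenvalue of a primitive integer matrix this forces the direction of the eigenvector to be rational.
  But the areas of the classes form an eigenvector, and the areas of classes 2 and 1 have the
  irrational ratio \<open>2 cos (\<pi> / n)\<close>.\<close>

section \<open>Similarities of the plane\<close>

text \<open>Tiles may be non-convex or disconnected, and the tiling need not be edge-to-edge, so a
  tile vertex on an edge of \<open>S\<close> says nothing about the tiles on the other side of that
  edge. The bookkeeping is therefore one-sided: lengths are measured between points where tiles on
  one fixed side end. Both the cutting points and the far end of the edge must be such points on the
  same side. A translate that crosses the edge works for either side; if the edge is parallel to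
  \<open>v\<close>, translates only touch it, from one side, and the corner is chosen extreme so
  that \<open>S\<close> lies on that side. Finiteness comes from scale: \<open>v\<close> is fixed
  while \<open>S\<close> grows, so the coordinates of \<open>v\<close> in the frame of two edges at
  the corner are of order \<open>|\<eta>| ^ (- k)\<close>. This keeps \<open>\<omega>\<close> and
  \<open>\<delta>\<close> bounded, and bounded sums of finitely many positive distances are finite
  in number. Irrationality is exploited without number fields: a rational-valued linear functional
  over the rationals, normalised on a difference of two powers in the progression, is applied to the
  eigenvector equation.\<close>

definition similarity :: "real \<Rightarrow> (complex \<Rightarrow> complex) \<Rightarrow> bool" where
  "similarity s f \<longleftrightarrow> s > 0 \<and> surj f \<and> (\<forall>x y. dist (f x) (f y) = s * dist x y)"

lemma similarity_pos: "similarity s f \<Longrightarrow> s > 0"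
  and similarity_surj: "similarity s f \<Longrightarrow> surj f"
  and similarity_dist: "similarity s f \<Longrightarrow> dist (f x) (f y) = s * dist x y"
  by (auto simp: similarity_def)

lemma similarity_inj:
  assumes "similarity s f" shows "inj f"
proof (rule injI)
  fix x y assume "f x = f y"
  then have "s * dist x y = 0" using similarity_dist[OF assms, of x y] by simp
  then show "x = y" using similarity_pos[OF assms] by simp
qed

lemma similarity_bij: "similarity s f \<Longrightarrow> bij f"
  by (simp add: bij_def similarity_inj similarity_surj)

lemma similarity_inv:
  assumes "similarity s f" shows "similarity (1 / s) (inv f)"
proof -
  have "dist (inv f x) (inv f y) = 1 / s * dist x y" for x y
  proof -
    have "dist x y = s * dist (inv f x) (inv f y)"
      using similarity_dist[OF assms, of "inv f x" "inv f y"] similarity_surj[OF assms]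
      by (simp add: surj_f_inv_f)
    then show ?thesis using similarity_pos[OF assms] by simp
  qed
  moreover have "surj (inv f)" using similarity_inj[OF assms] by (rule inj_imp_surj_inv)
  ultimately show ?thesis using similarity_pos[OF assms] by (simp add: similarity_def)
qed

lemma similarity_comp:
  assumes "similarity s f" "similarity r g" shows "similarity (s * r) (f \<circ> g)"
  using assms comp_surj[of g f] by (auto simp: similarity_def mult.assoc)

text \<open>Preservation of distances does not mention surjectivity. After subtracting
  \<open>g 0\<close> the map fixes the origin, so it is linear and orthogonal, and finite dimension
  makes it onto.\<close>

lemma similarity_isometry:
  assumes "is_isometry g" shows "similarity 1 g"
proof -
  let ?h = "\<lambda>z. g z - g 0"
  have "\<forall>x y. dist (?h x) (?h y) = dist x y"
    using assms by (simp add: is_isometry_def dist_norm)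
  then have "orthogonal_transformation ?h"
    by (simp add: orthogonal_transformation_isometry)
  then have sj: "surj ?h" by (rule orthogonal_transformation_surj)
  have "surj g"
  proof (rule surjI)
    fix y
    show "g (inv ?h (y - g 0)) = y" using surj_f_inv_f[OF sj, of "y - g 0"] by simp
  qed
  then show ?thesis using assms by (simp add: similarity_def is_isometry_def)
qed

lemma similarity_mult:
  assumes "c \<noteq> 0" shows "similarity (norm c) ((*) c)"
proof -
  have "surj ((*) c)"
    by (rule surjI[of _ "\<lambda>y. y / c"]) (use assms in simp)
  moreover have "dist (c * x) (c * y) = norm c * dist x y" for x y
    by (simp add: dist_norm norm_mult flip: right_diff_distrib)
  ultimately show ?thesis using assms by (simp add: similarity_def)
qed

lemma similarity_inner:
  assumes "similarity s f"
  shows "(f x - f y) \<bullet> (f z - f y) = s\<^sup>2 * ((x - y) \<bullet> (z - y))"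
proof -
  have d: "norm (f a - f b) = s * norm (a - b)" for a b
    using similarity_dist[OF assms] by (simp add: dist_norm)
  show ?thesis
    unfolding dot_norm_neg using d[of x y] d[of z y] d[of x z]
    by (simp add: power_mult_distrib field_simps)
qed

lemma similarity_ball:
  assumes "similarity s f" shows "f ` ball p e = ball (f p) (s * e)"
proof (intro equalityI subsetI)
  fix y assume "y \<in> ball (f p) (s * e)"
  moreover obtain x where "y = f x" using similarity_surj[OF assms] by blast
  ultimately show "y \<in> f ` ball p e"
    using similarity_pos[OF assms] by (auto simp: similarity_dist[OF assms])
qed (use similarity_pos[OF assms] in \<open>auto simp: similarity_dist[OF assms]\<close>)

lemma similarity_continuous: "similarity s f \<Longrightarrow> continuous_on UNIV f"
  by (rule lipschitz_on_continuous_on[of s]) (auto simp: lipschitz_on_def similarity_def)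

lemma similarity_open:
  assumes "similarity s f" "open U" shows "open (f ` U)"
proof -
  have "f ` U = inv f -` U"
    using similarity_bij[OF assms(1)]
    by (metis bij_vimage_eq_inv_image bij_imp_bij_inv inv_inv_eq)
  then show ?thesis
    using open_vimage[OF assms(2) similarity_continuous[OF similarity_inv[OF assms(1)]]] by simp
qed

lemma similarity_interior:
  assumes "similarity s f" shows "interior (f ` K) = f ` interior K"
proof
  show "f ` interior K \<subseteq> interior (f ` K)"
    by (intro interior_maximal image_mono interior_subset similarity_open[OF assms] open_interior)
  have "inv f ` interior (f ` K) \<subseteq> interior (inv f ` f ` K)"
    by (intro interior_maximal image_mono interior_subset
        similarity_open[OF similarity_inv[OF assms]] open_interior)
  also have "inv f ` f ` K = K"
    using similarity_inj[OF assms] by (simp add: image_inv_f_f)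
  finally have "f ` inv f ` interior (f ` K) \<subseteq> f ` interior K" by (rule image_mono)
  then show "interior (f ` K) \<subseteq> f ` interior K"
    using similarity_surj[OF assms] by (simp add: image_f_inv_f)
qed

lemma similarity_closure:
  assumes "similarity s f" shows "closure (f ` K) = f ` closure K"
  unfolding closure_interior
  by (simp add: bij_image_Compl_eq[OF similarity_bij[OF assms]] similarity_interior[OF assms, symmetric])

lemma similarity_frontier:
  assumes "similarity s f" shows "frontier (f ` K) = f ` frontier K"
  unfolding frontier_def similarity_interior[OF assms] similarity_closure[OF assms]
  by (simp add: image_set_diff[OF similarity_inj[OF assms]])

lemma similarity_is_tile:
  assumes "similarity s f" "is_tile K" shows "is_tile (f ` K)"
  using assms(2) compact_continuous_image[OF continuous_on_subset[OF similarity_continuous[OF assms(1)]], of K]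
  by (simp add: is_tile_def similarity_closure[OF assms(1)] similarity_interior[OF assms(1)])

section \<open>Flat boundary points and vertices under similarities\<close>

definition flat :: "complex set \<Rightarrow> complex \<Rightarrow> bool" where
  "flat K p \<longleftrightarrow> (\<exists>a e. a \<noteq> 0 \<and> e > 0 \<and> K \<inter> ball p e = {z. a \<bullet> (z - p) \<ge> 0} \<inter> ball p e)"

lemma vertices_flat: "vertices K = {p \<in> frontier K. \<not> flat K p}"
  by (simp add: vertices_def flat_def)

lemma similarity_flat:
  assumes f: "similarity s f" and "flat K p" shows "flat (f ` K) (f p)"
proof -
  obtain a e where a: "a \<noteq> 0" "e > 0" and K: "K \<inter> ball p e = {z. a \<bullet> (z - p) \<ge> 0} \<inter> ball p e"
    using assms(2) by (auto simp: flat_def)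
  \<comment> \<open>The new normal is a difference of two images, so no linear part of
    \<open>f\<close> has to be extracted; \<open>similarity_inner\<close> preserves the sign of
    inner products.\<close>
  define a' where "a' = f (p + a) - f p"
  have "a' \<noteq> 0" using inj_eq[OF similarity_inj[OF f], of "p + a" p] a by (simp add: a'_def)
  have inn: "a' \<bullet> (f z - f p) \<ge> 0 \<longleftrightarrow> a \<bullet> (z - p) \<ge> 0" for z
    using similarity_inner[OF f, of "p + a" p z] similarity_pos[OF f]
    by (simp add: a'_def zero_le_mult_iff)
  have "f ` K \<inter> ball (f p) (s * e) = f ` (K \<inter> ball p e)"
    by (simp add: similarity_ball[OF f, symmetric] image_Int[OF similarity_inj[OF f]])
  also have "\<dots> = f ` {z. a \<bullet> (z - p) \<ge> 0} \<inter> ball (f p) (s * e)"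
    by (simp add: K similarity_ball[OF f, symmetric] image_Int[OF similarity_inj[OF f]])
  also have "f ` {z. a \<bullet> (z - p) \<ge> 0} = {w. a' \<bullet> (w - f p) \<ge> 0}"
  proof (intro equalityI subsetI)
    fix w assume "w \<in> {w. a' \<bullet> (w - f p) \<ge> 0}"
    moreover obtain z where "w = f z" using similarity_surj[OF f] by blast
    ultimately show "w \<in> f ` {z. a \<bullet> (z - p) \<ge> 0}" using inn by auto
  qed (use inn in auto)
  finally show ?thesis
    unfolding flat_def using \<open>a' \<noteq> 0\<close> a similarity_pos[OF f] by (intro exI[of _ a'] exI[of _ "s * e"]) simp
qed

lemma similarity_flat_iff:
  assumes f: "similarity s f" shows "flat (f ` K) (f p) \<longleftrightarrow> flat K p"
  using similarity_flat[OF f, of K p] similarity_flat[OF similarity_inv[OF f], of "f ` K" "f p"]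
  by (simp add: image_inv_f_f[OF similarity_inj[OF f]] inv_f_f[OF similarity_inj[OF f]]) blast

lemma similarity_vertices:
  assumes "similarity s f" shows "vertices (f ` K) = f ` vertices K"
  unfolding vertices_flat by (auto simp: similarity_frontier[OF assms] similarity_flat_iff[OF assms])

section \<open>Vertices and edges of polygonal sets\<close>

lemma closed_halfplane_in_closed:
  fixes a p z :: complex
  assumes "closed K" "a \<noteq> 0" "{w. a \<bullet> (w - p) > 0} \<inter> ball p e \<subseteq> K"
    and "z \<in> ball p e" "a \<bullet> (z - p) \<ge> 0"
  shows "z \<in> K"
proof (rule ccontr)
  assume "z \<notin> K"
  then have "open (ball p e - K)" "z \<in> ball p e - K" using assms by auto
  then obtain r where r: "r > 0" "ball z r \<subseteq> ball p e - K" by (meson open_contains_ball)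
  define w where "w = z + (r / (2 * norm a)) *\<^sub>R a"
  have "dist z w < r" using r assms(2) by (simp add: w_def dist_norm)
  then have "w \<in> ball p e - K" using r by auto
  moreover have "a \<bullet> (w - p) > 0"
  proof -
    have "a \<bullet> (w - p) = a \<bullet> (z - p) + r / (2 * norm a) * (a \<bullet> a)"
      by (simp add: w_def inner_simps algebra_simps)
    moreover have "r / (2 * norm a) * (a \<bullet> a) > 0" using r assms(2) by simp
    ultimately show ?thesis using assms(5) by linarith
  qed
  ultimately show False using assms(3) by auto
qed

lemma open_not_subset_line:
  fixes a p :: complex
  assumes "open U" "U \<noteq> {}" "a \<noteq> 0"
  shows "\<exists>z\<in>U. a \<bullet> (z - p) \<noteq> 0"
proof (rule ccontr)
  assume "\<not> ?thesis"
  then have "U \<subseteq> {z. a \<bullet> z = a \<bullet> p}" by (auto simp: inner_diff_right)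
  then have "U \<subseteq> interior {z. a \<bullet> z = a \<bullet> p}" using assms(1) by (rule interior_maximal)
  then show False using interior_hyperplane[OF assms(3)] assms(2) by auto
qed

text \<open>Each open half-disc beside the line is connected and misses the frontier, so it lies
  inside \<open>K\<close> or outside. Both inside would make \<open>p\<close> interior, both outside
  would leave a piece of \<open>K\<close> on a line, against regular closedness. One of each is
  flatness.\<close>

lemma flat_if_frontier_in_line:
  assumes K: "closed K" "closure (interior K) = K" and p: "p \<in> frontier K"
    and a: "a \<noteq> 0" and e: "e > 0"
    and fr: "\<And>z. z \<in> frontier K \<Longrightarrow> z \<in> ball p e \<Longrightarrow> a \<bullet> (z - p) = 0"
  shows "flat K p"
proof -
  define H where "H b = {z. b \<bullet> (z - p) > 0} \<inter> ball p e" for b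
  have H_cases: "H b \<subseteq> K \<or> H b \<inter> K = {}" if b: "b = a \<or> b = - a" for b
  proof -
    have "{z. b \<bullet> (z - p) > 0} = {z. b \<bullet> z > b \<bullet> p}" by (simp add: inner_diff_right)
    then have "convex (H b)" unfolding H_def
      by (intro convex_Int convex_ball) (simp add: convex_halfspace_gt)
    then have "connected (H b)" by (rule convex_connected)
    moreover have "H b \<inter> frontier K = {}" using fr b by (fastforce simp: H_def)
    ultimately show ?thesis using connected_Int_frontier[of "H b" K] by blast
  qed
  have half: "flat K p" if b: "b = a \<or> b = - a" and "H b \<subseteq> K" "H (- b) \<inter> K = {}" for b
  proof -
    have b0: "b \<noteq> 0" using a b by auto
    have "K \<inter> ball p e = {z. b \<bullet> (z - p) \<ge> 0} \<inter> ball p e"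
    proof (intro equalityI subsetI)
      fix z assume "z \<in> K \<inter> ball p e"
      then have "\<not> b \<bullet> (z - p) < 0" "z \<in> ball p e" using that(3) by (auto simp: H_def disjoint_iff)
      then show "z \<in> {z. b \<bullet> (z - p) \<ge> 0} \<inter> ball p e" by simp
    next
      fix z assume "z \<in> {z. b \<bullet> (z - p) \<ge> 0} \<inter> ball p e"
      then show "z \<in> K \<inter> ball p e"
        using closed_halfplane_in_closed[OF K(1) b0, of p e z] that(2) by (auto simp: H_def)
    qed
    then show ?thesis unfolding flat_def using b0 e by blast
  qed
  have "\<not> (H a \<subseteq> K \<and> H (- a) \<subseteq> K)"
  proof
    assume both: "H a \<subseteq> K \<and> H (- a) \<subseteq> K"
    have "ball p e \<subseteq> K"
    proof
      fix z assume z: "z \<in> ball p e"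
      show "z \<in> K"
      proof (cases "a \<bullet> (z - p) \<ge> 0")
        case True then show ?thesis
          using closed_halfplane_in_closed[OF K(1) a, of p e z] both z by (auto simp: H_def)
      next
        case False then show ?thesis
          using both z by (auto simp: H_def)
      qed
    qed
    then have "p \<in> interior K" using e by (meson centre_in_ball interior_maximal open_ball subsetD)
    then show False using p by (simp add: frontier_def)
  qed
  moreover have "\<not> (H a \<inter> K = {} \<and> H (- a) \<inter> K = {})"
  proof
    assume none: "H a \<inter> K = {} \<and> H (- a) \<inter> K = {}"
    have "p \<in> closure (interior K)" using p K by (simp add: frontier_def)
    then have "ball p e \<inter> interior K \<noteq> {}"
      using e by (metis centre_in_ball closure_iff_nhds_not_empty inf.commute open_ball interior_open
          interior_subset)
    then obtain z where "z \<in> ball p e \<inter> interior K" "a \<bullet> (z - p) \<noteq> 0"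
      using open_not_subset_line[OF open_Int[OF open_ball open_interior] _ a, of p e K p] by blast
    moreover have "z \<in> K" using calculation interior_subset by auto
    ultimately show False
      using none by (cases "a \<bullet> (z - p) > 0") (auto simp: H_def disjoint_iff not_less order.order_iff_strict)
  qed
  ultimately show ?thesis using H_cases[of a] H_cases[of "- a"] half[of a] half[of "- a"] by auto
qed

section \<open>Oriented area and finiteness of the vertex set\<close>

definition cross :: "complex \<Rightarrow> complex \<Rightarrow> real" where
  "cross u z = Re u * Im z - Im u * Re z"

text \<open>\<open>\<i> * u\<close> is \<open>u\<close> turned by a right angle, so being parallel
  to \<open>u\<close> and being orthogonal to a normal become the same condition.\<close>

lemma cross_inner: "cross u z = (\<i> * u) \<bullet> z"
  by (simp add: cross_def inner_complex_def)

lemma cross_scale [simp]: "cross (s *\<^sub>R u) z = s * cross u z" "cross u (s *\<^sub>R z) = s * cross u z"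
  by (auto simp: cross_def algebra_simps)

lemma cross_add: "cross (u + w) z = cross u z + cross w z" "cross u (z + w) = cross u z + cross u w"
  and cross_diff: "cross (u - w) z = cross u z - cross w z" "cross u (z - w) = cross u z - cross u w"
  and cross_minus [simp]: "cross (- u) z = - cross u z" "cross u (- z) = - cross u z"
  and cross_self [simp]: "cross u u = 0" "cross 0 u = 0" "cross u 0 = 0"
  and cross_commute: "cross u z = - cross z u"
  by (auto simp: cross_def algebra_simps)

lemma cross_inner_norm: "(cross u z)\<^sup>2 + (u \<bullet> z)\<^sup>2 = (norm u)\<^sup>2 * (norm z)\<^sup>2"
  by (simp add: cross_def inner_complex_def cmod_def power2_eq_square algebra_simps)

lemma cross_le_norm: "\<bar>cross u z\<bar> \<le> norm u * norm z"
proof -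
  have "(cross u z)\<^sup>2 \<le> (norm u * norm z)\<^sup>2"
    using cross_inner_norm[of u z] zero_le_power2[of "u \<bullet> z"] unfolding power_mult_distrib by linarith
  then show ?thesis using abs_le_square_iff[of "cross u z" "norm u * norm z"] by simp
qed

lemma cross_zero_parallel:
  assumes "cross u z = 0" "u \<noteq> 0" shows "z = ((u \<bullet> z) / (u \<bullet> u)) *\<^sub>R u"
proof -
  have "(u \<bullet> u) *\<^sub>R z = (u \<bullet> z) *\<^sub>R u"
    using assms(1) by (simp add: complex_eq_iff inner_complex_def cross_def) algebra
  then have "(1 / (u \<bullet> u)) *\<^sub>R ((u \<bullet> u) *\<^sub>R z) = (1 / (u \<bullet> u)) *\<^sub>R ((u \<bullet> z) *\<^sub>R u)" by simp
  then show ?thesis using assms(2) by simp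
qed

lemma segment_diff:
  fixes a b x y :: complex
  assumes "x \<in> closed_segment a b" "y \<in> closed_segment a b"
  obtains t where "y - x = t *\<^sub>R (b - a)"
proof -
  obtain s t where xy: "x = a + s *\<^sub>R (b - a)" "y = a + t *\<^sub>R (b - a)"
    using assms by (auto simp: closed_segment_def algebra_simps)
  have "y - x = (t - s) *\<^sub>R (b - a)" unfolding xy by (simp add: algebra_simps)
  then show thesis by (rule that)
qed

text \<open>Only endpoints of the covering segments and crossings of non-parallel ones can be
  vertices: near any other frontier point the frontier lies in a single line.\<close>

lemma finite_vertices:
  assumes K: "closed K" "closure (interior K) = K" and "polygonal K"
  shows "finite (vertices K)"
proof -
  obtain E where E: "finite E" "frontier K \<subseteq> (\<Union>(a, b)\<in>E. closed_segment a b)"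
    using assms(3) by (auto simp: polygonal_def)
  define Y where "Y a b c d = {p. p \<in> closed_segment a b \<and> p \<in> closed_segment c d \<and> cross (b - a) (d - c) \<noteq> 0}"
    for a b c d :: complex
  define V where "V = fst ` E \<union> snd ` E \<union> (\<Union>(a, b)\<in>E. \<Union>(c, d)\<in>E. Y a b c d)"
  have "finite (Y a b c d)" for a b c d
  proof (cases "Y a b c d = {}")
    case False
    then obtain p where p: "p \<in> Y a b c d" by blast
    have "Y a b c d \<subseteq> {p}"
    proof
      fix q assume q: "q \<in> Y a b c d"
      obtain s where s: "q - p = s *\<^sub>R (b - a)"
        using p q segment_diff[of p a b q] by (auto simp: Y_def)
      obtain t where t: "q - p = t *\<^sub>R (d - c)"
        using p q segment_diff[of p c d q] by (auto simp: Y_def)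
      have "cross (q - p) (d - c) = 0" by (simp only: t cross_scale cross_self mult_zero_right)
      then have "s * cross (b - a) (d - c) = 0" by (simp only: s cross_scale)
      then have "s = 0" using p by (simp add: Y_def)
      then show "q \<in> {p}" using s by simp
    qed
    then show ?thesis by (rule finite_subset) simp
  qed simp
  then have "finite V" using E(1) by (auto simp: V_def)
  moreover have "vertices K \<subseteq> V"
  proof
    fix p assume p: "p \<in> vertices K"
    show "p \<in> V"
    proof (rule ccontr)
      assume pV: "p \<notin> V"
      have pf: "p \<in> frontier K" using p by (simp add: vertices_flat)
      then obtain a b where ab: "(a, b) \<in> E" "p \<in> closed_segment a b" using E(2) by auto
      have "p \<noteq> a" using pV ab(1) by (force simp: V_def)
      then have u: "b - a \<noteq> 0" using ab(2) by auto
      \<comment> \<open>Segments missing \<open>p\<close> stay at a positive distance from it. The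
        segments through \<open>p\<close> are all parallel to \<open>b - a\<close> because
        \<open>p\<close> is not in \<open>V\<close>.\<close>
      define far where "far = (\<Union>(c, d)\<in>{s \<in> E. p \<notin> closed_segment (fst s) (snd s)}. closed_segment c d)"
      have "closed far" unfolding far_def using E(1) by (intro closed_UN) auto
      moreover have "p \<notin> far" by (auto simp: far_def)
      ultimately obtain e where e: "e > 0" "ball p e \<subseteq> - far"
        by (meson ComplI open_Compl open_contains_ball)
      have "(\<i> * (b - a)) \<bullet> (z - p) = 0" if z: "z \<in> frontier K" "z \<in> ball p e" for z
      proof -
        obtain c d where cd: "(c, d) \<in> E" "z \<in> closed_segment c d" using E(2) z by auto
        have pcd: "p \<in> closed_segment c d"
        proof (rule ccontr)
          assume "p \<notin> closed_segment c d"
          then have "z \<in> far" using cd by (force simp: far_def)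
          then show False using e z by auto
        qed
        then have "cross (b - a) (d - c) = 0"
          using pV ab cd unfolding V_def Y_def by blast
        moreover obtain t where "z - p = t *\<^sub>R (d - c)" using segment_diff[OF pcd cd(2)] .
        ultimately show ?thesis by (metis cross_inner cross_scale(2) mult_zero_right)
      qed
      then have "flat K p"
        using flat_if_frontier_in_line[OF K pf _ e(1), of "\<i> * (b - a)"] u by auto
      then show False using p by (simp add: vertices_flat)
    qed
  qed
  ultimately show ?thesis by (rule finite_subset[rotated])
qed

section \<open>Local structure of the frontier and its edges\<close>

lemma halfplane_germ:
  assumes K: "K \<inter> ball x e = {z. a \<bullet> (z - x) \<ge> 0} \<inter> ball x e" and a: "a \<noteq> 0" and y: "y \<in> ball x e"
  shows "a \<bullet> (y - x) > 0 \<Longrightarrow> y \<in> interior K"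
    and "a \<bullet> (y - x) < 0 \<Longrightarrow> y \<notin> closure K"
    and "a \<bullet> (y - x) = 0 \<Longrightarrow> y \<in> frontier K \<and> flat K y"
proof -
  have op: "open {z. a \<bullet> (z - x) > 0}" "open {z. a \<bullet> (z - x) < 0}"
    by (simp_all add: inner_diff_right open_halfspace_gt open_halfspace_lt)
  show "y \<in> interior K" if "a \<bullet> (y - x) > 0"
  proof -
    have "{z. a \<bullet> (z - x) > 0} \<inter> ball x e \<subseteq> K"
    proof
      fix z assume "z \<in> {z. a \<bullet> (z - x) > 0} \<inter> ball x e"
      then have "z \<in> {z. a \<bullet> (z - x) \<ge> 0} \<inter> ball x e" by simp
      then show "z \<in> K" unfolding K[symmetric] by simp
    qed
    then have "{z. a \<bullet> (z - x) > 0} \<inter> ball x e \<subseteq> interior K"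
      by (rule interior_maximal) (intro open_Int op open_ball)
    then show ?thesis using that y by blast
  qed
  show "y \<notin> closure K" if "a \<bullet> (y - x) < 0"
  proof -
    have "z \<notin> K" if z: "z \<in> {z. a \<bullet> (z - x) < 0} \<inter> ball x e" for z
    proof
      assume "z \<in> K"
      then have "z \<in> {z. a \<bullet> (z - x) \<ge> 0} \<inter> ball x e" using z unfolding K[symmetric] by simp
      then show False using z by simp
    qed
    then have "({z. a \<bullet> (z - x) < 0} \<inter> ball x e) \<inter> K = {}" by blast
    moreover have "open ({z. a \<bullet> (z - x) < 0} \<inter> ball x e)" by (intro open_Int op open_ball)
    ultimately have "({z. a \<bullet> (z - x) < 0} \<inter> ball x e) \<inter> closure K = {}"
      by (simp add: open_Int_closure_eq_empty)
    then show ?thesis using that y by blast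
  qed
  show "y \<in> frontier K \<and> flat K y" if y0: "a \<bullet> (y - x) = 0"
  proof -
    obtain r where r: "r > 0" "ball y r \<subseteq> ball x e"
      using y by (meson open_ball open_contains_ball)
    have eq: "a \<bullet> (z - y) = a \<bullet> (z - x)" for z using y0 by (simp add: inner_diff_right)
    have "K \<inter> ball y r = {z. a \<bullet> (z - y) \<ge> 0} \<inter> ball y r"
      unfolding eq using K r(2) by blast
    then have "flat K y" unfolding flat_def using a r(1) by blast
    moreover have "y \<in> K"
    proof -
      have "y \<in> {z. a \<bullet> (z - x) \<ge> 0} \<inter> ball x e" using y y0 by simp
      then show ?thesis unfolding K[symmetric] by simp
    qed
    moreover have "y \<notin> interior K"
    proof
      assume "y \<in> interior K"
      then obtain q where q: "q > 0" "ball y q \<subseteq> K \<inter> ball x e"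
      proof -
        have "open (interior K \<inter> ball x e)" "y \<in> interior K \<inter> ball x e"
          using y \<open>y \<in> interior K\<close> by auto
        then obtain q where "q > 0" "ball y q \<subseteq> interior K \<inter> ball x e"
          by (meson open_contains_ball)
        then show thesis using that[of q] interior_subset[of K] by blast
      qed
      define w where "w = y - (q / (2 * norm a)) *\<^sub>R a"
      have "w \<in> ball y q" using q a by (simp add: w_def dist_norm)
      then have "w \<in> K \<inter> ball x e" using q by auto
      have "a \<bullet> (w - x) = a \<bullet> (y - x) - q / (2 * norm a) * (a \<bullet> a)"
        by (simp add: w_def inner_simps algebra_simps)
      then have neg: "a \<bullet> (w - x) < 0" using y0 q a by simp
      have "w \<in> {z. a \<bullet> (z - x) \<ge> 0} \<inter> ball x e"
        using \<open>w \<in> K \<inter> ball x e\<close> unfolding K .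
      then show False using neg by simp
    qed
    ultimately show ?thesis using closure_subset by (auto simp: frontier_def)
  qed
qed

text \<open>The segments in \<open>polygonal\<close> are an arbitrary cover, so edges are recovered
  from the set itself as maximal stretches of flat frontier points. Each edge occurs in both
  orientations.\<close>

definition edges :: "complex set \<Rightarrow> (complex \<times> complex) set" where
  "edges K = {(a, b). a \<in> vertices K \<and> b \<in> vertices K \<and> a \<noteq> b \<and>
     open_segment a b \<subseteq> frontier K - vertices K}"

text \<open>The walk along the boundary line must stop because the frontier is bounded. The stopping
  point is a frontier point; if it were flat, its boundary line would have direction
  \<open>d\<close> and the walk could continue past it.\<close>

lemma frontier_ray_to_vertex:
  assumes "compact K" and K: "K \<inter> ball x e = {z. a \<bullet> (z - x) \<ge> 0} \<inter> ball x e"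
    and a: "a \<noteq> 0" and e: "e > 0" and d: "d \<noteq> 0" "a \<bullet> d = 0"
  obtains s where "s > 0" "x + s *\<^sub>R d \<in> vertices K"
    "\<And>u. 0 \<le> u \<Longrightarrow> u < s \<Longrightarrow> x + u *\<^sub>R d \<in> frontier K - vertices K"
proof -
  define bad where "bad = {u. u \<ge> 0 \<and> x + u *\<^sub>R d \<notin> frontier K - vertices K}"
  have near: "x + u *\<^sub>R d \<in> frontier K - vertices K" if "\<bar>u\<bar> * norm d < e" for u
    using halfplane_germ(3)[OF K a, of "x + u *\<^sub>R d"] that d by (simp add: vertices_flat dist_norm)
  have "bounded (frontier K)" using assms(1) by (simp add: compact_imp_bounded compact_frontier)
  then obtain B where B: "\<And>z. z \<in> frontier K \<Longrightarrow> norm z \<le> B" by (auto simp: bounded_iff)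
  have "bad \<noteq> {}"
  proof
    assume none: "bad = {}"
    define u where "u = (\<bar>B\<bar> + norm x + 1) / norm d"
    have "u \<ge> 0" by (simp add: u_def)
    then have "norm (x + u *\<^sub>R d) \<le> B" using none B by (auto simp: bad_def)
    moreover have "norm (u *\<^sub>R d) = \<bar>B\<bar> + norm x + 1" using d by (simp add: u_def)
    moreover have "norm (u *\<^sub>R d) \<le> norm (x + u *\<^sub>R d) + norm x"
      using norm_triangle_ineq4[of "x + u *\<^sub>R d" x] by simp
    ultimately show False by linarith
  qed
  have bb: "bdd_below bad" by (rule bdd_belowI[of _ 0]) (simp add: bad_def)
  define s where "s = Inf bad"
  have good: "x + u *\<^sub>R d \<in> frontier K - vertices K" if "0 \<le> u" "u < s" for u
    using cInf_lower[OF _ bb, of u] that by (auto simp: s_def bad_def)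
  have "e / norm d \<le> s" unfolding s_def
  proof (rule cInf_greatest[OF \<open>bad \<noteq> {}\<close>])
    fix u assume "u \<in> bad"
    then have "\<not> \<bar>u\<bar> * norm d < e" "u \<ge> 0" using near by (auto simp: bad_def)
    then show "e / norm d \<le> u" using d by (simp add: field_simps)
  qed
  then have s0: "s > 0" using e d by (meson divide_pos_pos less_le_trans zero_less_norm_iff)
  define y where "y = x + s *\<^sub>R d"
  have yf: "y \<in> frontier K"
  proof (rule ccontr)
    assume "y \<notin> frontier K"
    then obtain r where r: "r > 0" "ball y r \<subseteq> - frontier K"
      by (meson ComplI frontier_closed open_Compl open_contains_ball)
    define u where "u = max 0 (s - r / (2 * norm d))"
    have "u < s" "0 \<le> u" using s0 r d by (auto simp: u_def)
    moreover have "dist y (x + u *\<^sub>R d) = (s - u) * norm d"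
    proof -
      have "y - (x + u *\<^sub>R d) = (s - u) *\<^sub>R d" by (simp add: y_def algebra_simps)
      then show ?thesis using \<open>u < s\<close> by (simp add: dist_norm)
    qed
    moreover have "s - u \<le> r / (2 * norm d)" by (simp add: u_def)
    then have "(s - u) * norm d \<le> r / 2" using d by (simp add: field_simps)
    ultimately show False using good[of u] r by (force simp: subset_iff)
  qed
  have "y \<in> vertices K"
  proof (rule ccontr)
    assume "y \<notin> vertices K"
    then obtain b r where b: "b \<noteq> 0" "r > 0" and Kb: "K \<inter> ball y r = {z. b \<bullet> (z - y) \<ge> 0} \<inter> ball y r"
      using yf by (auto simp: vertices_flat flat_def)
    \<comment> \<open>A good parameter shortly before \<open>s\<close>, close enough to lie in the
      germ at \<open>y\<close>. As a frontier point it must lie on the boundary line there, which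
      gives that line the direction \<open>d\<close>.\<close>
    define u where "u = max 0 (s - r / (2 * norm d))"
    have u: "u < s" "0 \<le> u" using s0 b d by (auto simp: u_def)
    have du: "x + u *\<^sub>R d - y = - ((s - u) *\<^sub>R d)" by (simp add: y_def algebra_simps)
    have "s - u \<le> r / (2 * norm d)" by (simp add: u_def)
    then have "(s - u) * norm d \<le> r / 2" using d by (simp add: field_simps)
    moreover have "dist (x + u *\<^sub>R d) y = (s - u) * norm d"
      unfolding dist_norm du using u by simp
    then have "dist y (x + u *\<^sub>R d) = (s - u) * norm d" by (simp add: dist_commute)
    ultimately have ub: "x + u *\<^sub>R d \<in> ball y r" using b by simp
    have "b \<bullet> (x + u *\<^sub>R d - y) = 0"
      using halfplane_germ(1,2)[OF Kb b(1) ub] good[OF u(2,1)]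
      unfolding frontier_def by (meson DiffD1 DiffD2 linorder_neqE_linordered_idom)
    then have bd: "b \<bullet> d = 0" using u by (simp add: du)
    have "s + r / norm d \<le> s"
    proof -
      have "s + r / norm d \<le> Inf bad"
      proof (rule cInf_greatest[OF \<open>bad \<noteq> {}\<close>])
        fix w assume w: "w \<in> bad"
        then have "s \<le> w" unfolding s_def using bb by (rule cInf_lower)
        have dw: "x + w *\<^sub>R d - y = (w - s) *\<^sub>R d" by (simp add: y_def algebra_simps)
        have "x + w *\<^sub>R d \<notin> ball y r"
          using halfplane_germ(3)[OF Kb b(1), of "x + w *\<^sub>R d"] w bd
          by (auto simp: dw bad_def vertices_flat)
        then have "norm (x + w *\<^sub>R d - y) \<ge> r" by (simp add: dist_norm norm_minus_commute)
        then have "(w - s) * norm d \<ge> r" unfolding dw using \<open>s \<le> w\<close> by simp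
        then show "s + r / norm d \<le> w" using d by (simp add: field_simps)
      qed
      then show ?thesis by (simp add: s_def)
    qed
    moreover have "r / norm d > 0" using b d by simp
    ultimately show False by linarith 
  qed
  then show thesis using that s0 good by (simp add: y_def)
qed

lemma frontier_edges:
  assumes "compact K" "x \<in> frontier K" "x \<notin> vertices K"
  obtains a b where "(a, b) \<in> edges K" "x \<in> open_segment a b"
proof -
  obtain n e where n: "n \<noteq> 0" "e > 0" and K: "K \<inter> ball x e = {z. n \<bullet> (z - x) \<ge> 0} \<inter> ball x e"
    using assms(2,3) by (auto simp: vertices_flat flat_def)
  define d where "d = \<i> * n"
  have d: "d \<noteq> 0" "n \<bullet> d = 0" "- d \<noteq> 0" "n \<bullet> (- d) = 0"
    using n by (auto simp: d_def inner_complex_def)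
  obtain s where s: "s > 0" "x + s *\<^sub>R d \<in> vertices K"
    "\<And>u. 0 \<le> u \<Longrightarrow> u < s \<Longrightarrow> x + u *\<^sub>R d \<in> frontier K - vertices K"
    using frontier_ray_to_vertex[OF assms(1) K n d(1,2)] by blast
  obtain t where t: "t > 0" "x + t *\<^sub>R (- d) \<in> vertices K"
    "\<And>u. 0 \<le> u \<Longrightarrow> u < t \<Longrightarrow> x + u *\<^sub>R (- d) \<in> frontier K - vertices K"
    using frontier_ray_to_vertex[OF assms(1) K n d(3,4)] by blast
  define a where "a = x - t *\<^sub>R d"
  define b where "b = x + s *\<^sub>R d"
  have "b - a = (s + t) *\<^sub>R d" by (simp add: a_def b_def algebra_simps)
  then have ne: "a \<noteq> b" using s(1) t(1) d by auto
  have "z \<in> frontier K - vertices K" if z: "z \<in> open_segment a b" for z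
  proof -
    obtain w where w: "0 < w" "w < 1" "z = (1 - w) *\<^sub>R a + w *\<^sub>R b"
      using z by (auto simp: in_segment)
    define u where "u = w * (s + t) - t"
    have zu: "z = x + u *\<^sub>R d" by (simp add: w(3) a_def b_def u_def algebra_simps)
    have "w * (s + t) < s + t" "w * (s + t) > 0" using w s(1) t(1) by auto
    then have "u < s" "- u < t" by (auto simp: u_def)
    then show ?thesis using s(3)[of u] t(3)[of "- u"] by (cases "u \<ge> 0") (auto simp: zu)
  qed
  then have "(a, b) \<in> edges K" using ne s(2) t(2) by (auto simp: edges_def a_def b_def)
  moreover have "x \<in> open_segment a b"
      unfolding in_segment
  proof (intro conjI exI[of _ "t / (s + t)"])
    have "(1 - w) *\<^sub>R a + w *\<^sub>R b = x + (w * (s + t) - t) *\<^sub>R d" for w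
      by (simp add: a_def b_def algebra_simps)
    from this[of "t / (s + t)"] show "x = (1 - t / (s + t)) *\<^sub>R a + (t / (s + t)) *\<^sub>R b" using s(1) t(1) by simp
  qed (use s(1) t(1) ne in auto)
  ultimately show thesis by (rule that)
qed

lemma edges_commute: "(a, b) \<in> edges K \<Longrightarrow> (b, a) \<in> edges K"
  by (auto simp: edges_def open_segment_commute)

lemma finite_edges: "finite (vertices K) \<Longrightarrow> finite (edges K)"
  by (rule finite_subset[of _ "vertices K \<times> vertices K"]) (auto simp: edges_def)

text \<open>The other vertices and the edges not ending at \<open>A\<close> form a closed set that
  avoids \<open>A\<close>, so a small disc sees only edges starting at \<open>A\<close>.\<close>

lemma frontier_near_vertex:
  assumes K: "compact K" and fin: "finite (vertices K)" and A: "A \<in> vertices K"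
  obtains r where "r > 0"
    "\<And>z. z \<in> frontier K \<Longrightarrow> z \<in> ball A r \<Longrightarrow> z = A \<or> (\<exists>q. (A, q) \<in> edges K \<and> z \<in> open_segment A q)"
proof -
  define far where "far = (vertices K - {A}) \<union>
    (\<Union>(p, q)\<in>{e \<in> edges K. fst e \<noteq> A \<and> snd e \<noteq> A}. closed_segment p q)"
  have "closed far" unfolding far_def using fin finite_edges[OF fin]
    by (intro closed_Un closed_UN finite_imp_closed) auto
  moreover have "A \<notin> far"
    using A by (auto simp: far_def edges_def open_segment_def)
  ultimately obtain r where r: "r > 0" "ball A r \<subseteq> - far"
    by (meson ComplI open_Compl open_contains_ball)
  have "z = A \<or> (\<exists>q. (A, q) \<in> edges K \<and> z \<in> open_segment A q)"
    if z: "z \<in> frontier K" "z \<in> ball A r" for z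
  proof (cases "z \<in> vertices K")
    case True
    then show ?thesis using r z by (auto simp: far_def)
  next
    case False
    then obtain p q where pq: "(p, q) \<in> edges K" "z \<in> open_segment p q"
      using frontier_edges[OF K z(1)] by blast
    then have "z \<in> closed_segment p q" using open_closed_segment by blast
    then have "p = A \<or> q = A" using pq r z by (force simp: far_def)
    then show ?thesis using pq edges_commute[of p q] by (auto simp: open_segment_commute)
  qed
  then show thesis using that r(1) by blast
qed

text \<open>\<open>A\<close> minimises \<open>cross v\<close> on \<open>K\<close> and, among the
  minimisers, the inner product with \<open>v\<close>. All of \<open>K\<close> then lies in a
  half-open half-plane of directions at \<open>A\<close>, which excludes flatness; a single edge
  direction would leave no room for interior points of \<open>K\<close> near
  \<open>A\<close>.\<close>

lemma corner:
  assumes K: "compact K" "K \<noteq> {}" "closure (interior K) = K" and fin: "finite (vertices K)" and v: "v \<noteq> 0"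
  obtains A p q \<alpha> \<beta> where "(A, p) \<in> edges K" "(A, q) \<in> edges K" "cross (p - A) (q - A) \<noteq> 0"
    "v = \<alpha> *\<^sub>R (p - A) + \<beta> *\<^sub>R (q - A)" "\<alpha> * \<beta> \<le> 0" "\<bar>\<alpha>\<bar> \<le> \<bar>\<beta>\<bar>" "\<beta> \<noteq> 0"
    "\<alpha> = 0 \<longrightarrow> (\<forall>z\<in>K. cross v (z - A) \<ge> 0) \<and> cross v (p - A) > 0"
proof -
  note intro = that
  \<comment> \<open>Directions that increase the pair (\<open>cross v\<close>,
    \<open>v \<bullet>\<close>) lexicographically; of \<open>d\<close> and \<open>- d\<close> at
    most one is positive.\<close>
  define pos where "pos d \<longleftrightarrow> cross v d > 0 \<or> cross v d = 0 \<and> v \<bullet> d > 0" for d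
  have pos_minus: "\<not> pos (- d)" if "pos d" for d using that by (auto simp: pos_def)
  have pos_scale: "pos (s *\<^sub>R d) \<longleftrightarrow> pos d" if "s > 0" for s d
    using that by (auto simp: pos_def zero_less_mult_iff)
  have "continuous_on K (cross v)"
    unfolding cross_inner by (intro continuous_intros)
  then obtain m where m: "m \<in> K" "\<And>z. z \<in> K \<Longrightarrow> cross v m \<le> cross v z"
    using continuous_attains_inf[OF K(1,2)] by blast
  define K0 where "K0 = K \<inter> {z. (\<i> * v) \<bullet> z = cross v m}"
  have "compact K0" unfolding K0_def by (intro compact_Int_closed K closed_hyperplane)
  moreover have "m \<in> K0" using m by (simp add: K0_def cross_inner)
  ultimately obtain A where A: "A \<in> K0" "\<And>z. z \<in> K0 \<Longrightarrow> v \<bullet> A \<le> v \<bullet> z"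
    using continuous_attains_inf[of K0 "\<lambda>z. v \<bullet> z"] by (force intro: continuous_intros)
  have AK: "A \<in> K" "cross v A = cross v m" using A(1) by (auto simp: K0_def cross_inner)
  have posK: "pos (z - A)" if z: "z \<in> K" "z \<noteq> A" for z
  proof (cases "cross v (z - A) = 0")
    case True
    then have "z \<in> K0" using z AK by (simp add: K0_def cross_diff flip: cross_inner)
    then have "v \<bullet> (z - A) \<ge> 0" using A(2) by (simp add: inner_diff_right)
    moreover have "v \<bullet> (z - A) \<noteq> 0"
      using cross_inner_norm[of v "z - A"] True v z(2) by auto
    ultimately show ?thesis using True by (simp add: pos_def)
  next
    case False
    then show ?thesis using m(2)[OF z(1)] AK(2) by (simp add: pos_def cross_diff)
  qed
  have notK: "A - s *\<^sub>R d \<notin> K" if "pos d" "s > 0" for s d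
  proof
    assume "A - s *\<^sub>R d \<in> K"
    moreover have "d \<noteq> 0" using that by (auto simp: pos_def)
    ultimately have "pos (- (s *\<^sub>R d))" using posK[of "A - s *\<^sub>R d"] that by simp
    then show False using pos_minus[of "s *\<^sub>R d"] that pos_scale by simp
  qed
  have posv: "pos v" using v by (simp add: pos_def)
  have Afr: "A \<in> frontier K"
  proof -
    have "A \<notin> interior K"
    proof
      assume "A \<in> interior K"
      then obtain r where r: "r > 0" "ball A r \<subseteq> K" by (meson mem_interior)
      have "A - (r / (2 * norm v)) *\<^sub>R v \<in> ball A r" using r v by (simp add: dist_norm)
      then have "A - (r / (2 * norm v)) *\<^sub>R v \<in> K" using r by blast
      then show False using notK[OF posv, of "r / (2 * norm v)"] r v by simp
    qed
    then show ?thesis using AK closure_subset by (auto simp: frontier_def)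
  qed
  have "\<not> flat K A"
  proof
    assume "flat K A"
    then obtain a e where a: "a \<noteq> 0" "e > 0" and Ka: "K \<inter> ball A e = {z. a \<bullet> (z - A) \<ge> 0} \<inter> ball A e"
      by (auto simp: flat_def)
    define d where "d = (e / (2 * norm a)) *\<^sub>R (\<i> * a)"
    have d: "norm d < e" "a \<bullet> d = 0" "d \<noteq> 0"
      using a by (auto simp: d_def norm_mult inner_complex_def)
    have "A + d \<in> {z. a \<bullet> (z - A) \<ge> 0} \<inter> ball A e" "A - d \<in> {z. a \<bullet> (z - A) \<ge> 0} \<inter> ball A e"
      using d by (auto simp: dist_norm)
    then have "A + d \<in> K" "A - d \<in> K" unfolding Ka[symmetric] by auto
    then have "pos d" "pos (- d)" using posK[of "A + d"] posK[of "A - d"] d by auto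
    then show False using pos_minus by blast
  qed
  then have Av: "A \<in> vertices K" using Afr by (simp add: vertices_flat)
  have posE: "pos (q - A)" if "(A, q) \<in> edges K" for q
  proof -
    have "q \<in> frontier K" "q \<noteq> A" using that by (auto simp: edges_def vertices_flat)
    then show ?thesis using posK compact_imp_closed[OF K(1)] frontier_subset_closed by blast
  qed
  have "\<exists>p q. (A, p) \<in> edges K \<and> (A, q) \<in> edges K \<and> cross (p - A) (q - A) \<noteq> 0"
  proof (rule ccontr)
    assume "\<not> ?thesis"
    then have par: "cross (p - A) (q - A) = 0" if "(A, p) \<in> edges K" "(A, q) \<in> edges K" for p q
      using that by blast
    \<comment> \<open>If no edge ends at \<open>A\<close>, any positive direction will do, and
      \<open>v\<close> is one.\<close>
    obtain d where d: "pos d" "\<And>q. (A, q) \<in> edges K \<Longrightarrow> cross d (q - A) = 0"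
    proof (cases "\<exists>p. (A, p) \<in> edges K")
      case True
      then obtain p where "(A, p) \<in> edges K" by blast
      then show thesis using that[of "p - A"] posE par by blast
    qed (use that posv in blast)
    have d0: "d \<noteq> 0" using d(1) by (auto simp: pos_def)
    define R where "R = {A + s *\<^sub>R d |s. s \<ge> 0}"
    obtain r where r: "r > 0" and
      near: "\<And>z. z \<in> frontier K \<Longrightarrow> z \<in> ball A r \<Longrightarrow> z = A \<or> (\<exists>q. (A, q) \<in> edges K \<and> z \<in> open_segment A q)"
      using frontier_near_vertex[OF K(1) fin Av] by blast
    have frR: "z \<in> R" if zf: "z \<in> frontier K" "z \<in> ball A r" for z
    proof (cases "z = A")
      case True
      then show ?thesis by (auto simp: R_def intro: exI[of _ 0])
    next
      case False
      then obtain q where q: "(A, q) \<in> edges K" "z \<in> open_segment A q" using near[OF zf] by blast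
      obtain t where t: "t > 0" "z = A + t *\<^sub>R (q - A)"
        using q(2) by (auto simp: in_segment algebra_simps)
      define c where "c = (d \<bullet> (q - A)) / (d \<bullet> d)"
      have c: "q - A = c *\<^sub>R d" using cross_zero_parallel[OF d(2)[OF q(1)] d0] by (simp add: c_def)
      have "c > 0"
      proof (rule ccontr)
        assume "\<not> c > 0"
        then have "c < 0" using posE[OF q(1)] by (cases "c = 0") (auto simp: c pos_def)
        then have "pos (- (q - A))" using pos_scale[of "- c" d] d(1) by (simp add: c)
        then show False using pos_minus posE[OF q(1)] by blast
      qed
      then show ?thesis using t by (auto simp: R_def c intro!: exI[of _ "t * c"])
    qed
    define \<rho> where "\<rho> = r / (2 * norm d)"
    have \<rho>: "\<rho> > 0" using r d0 by (simp add: \<rho>_def)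
    \<comment> \<open>The disc slit along the ray is star-shaped about \<open>C\<close> on the
      opposite ray, hence connected. It misses the frontier and contains \<open>C\<close> outside
      \<open>K\<close>, so near \<open>A\<close> all of \<open>K\<close> would lie on the ray, which
      has empty interior.\<close>
    define W where "W = ball A r - R"
    define C where "C = A - \<rho> *\<^sub>R d"
    have CK: "C \<notin> K" unfolding C_def by (rule notK[OF d(1) \<rho>])
    have Cball: "C \<in> ball A r" using r d0 by (simp add: C_def \<rho>_def dist_norm)
    have "C \<notin> R"
    proof
      assume "C \<in> R"
      then obtain s where "s \<ge> 0" "A - \<rho> *\<^sub>R d = A + s *\<^sub>R d" by (auto simp: R_def C_def)
      then have "(s + \<rho>) *\<^sub>R d = 0" by (simp add: algebra_simps)
      then show False using \<open>s \<ge> 0\<close> \<rho> d0 by simp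
    qed
    then have CW: "C \<in> W" using Cball by (simp add: W_def)
    have "closed_segment C z \<subseteq> W" if z: "z \<in> W" for z
    proof
      fix w assume w: "w \<in> closed_segment C z"
      have "w \<in> ball A r"
        using w z Cball closed_segment_subset[OF Cball _ convex_ball, of z] by (auto simp: W_def)
      moreover have "w \<notin> R"
      proof
        assume "w \<in> R"
        then obtain s where s: "s \<ge> 0" "w = A + s *\<^sub>R d" by (auto simp: R_def)
        obtain u where u: "0 \<le> u" "u \<le> 1" "w = (1 - u) *\<^sub>R C + u *\<^sub>R z"
          using w by (auto simp: in_segment)
        show False
        proof (cases "u = 0")
          case True then show False using u \<open>w \<in> R\<close> \<open>C \<notin> R\<close> by simp
        next
          case False
          have "u *\<^sub>R (z - A) = (s + (1 - u) * \<rho>) *\<^sub>R d"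
            using s(2) u(3) by (simp add: C_def algebra_simps)
          then have "(1 / u) *\<^sub>R (u *\<^sub>R (z - A)) = ((s + (1 - u) * \<rho>) / u) *\<^sub>R d" by simp
          then have "z = A + ((s + (1 - u) * \<rho>) / u) *\<^sub>R d" using False by (simp add: algebra_simps)
          moreover have "(s + (1 - u) * \<rho>) / u \<ge> 0" using s u \<rho> by simp
          ultimately have "z \<in> R" by (auto simp: R_def)
          then show False using z by (simp add: W_def)
        qed
      qed
      ultimately show "w \<in> W" by (simp add: W_def)
    qed
    then have "connected W" using CW by (intro starlike_imp_connected) (auto simp: starlike_def)
    moreover have "W \<inter> frontier K = {}" using frR by (auto simp: W_def)
    ultimately have WK: "W \<inter> K = {}" using connected_Int_frontier[of W K] CW CK by blast
    have "A \<in> closure (interior K)" using AK K(3) by simp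
    then have "ball A r \<inter> interior K \<noteq> {}"
      using open_Int_closure_eq_empty[OF open_ball, of A r "interior K"] centre_in_ball[of A r] r by blast
    moreover have "\<i> * d \<noteq> 0" using d0 by simp
    ultimately obtain z where z: "z \<in> ball A r \<inter> interior K" "(\<i> * d) \<bullet> (z - A) \<noteq> 0"
      using open_not_subset_line[OF open_Int[OF open_ball open_interior], of A r K "\<i> * d" A] by blast
    then have "z \<in> R" using WK interior_subset[of K] by (auto simp: W_def)
    then show False using z(2) by (auto simp: R_def simp flip: cross_inner)
  qed
  then obtain p q where pq: "(A, p) \<in> edges K" "(A, q) \<in> edges K" "cross (p - A) (q - A) \<noteq> 0" by blast
  have conclude: thesis
    if pq: "(A, p) \<in> edges K" "(A, q) \<in> edges K" "cross (p - A) (q - A) \<noteq> 0"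
      and veq: "v = \<alpha> *\<^sub>R (p - A) + \<beta> *\<^sub>R (q - A)" and "\<alpha> * \<beta> \<le> 0" and le: "\<bar>\<alpha>\<bar> \<le> \<bar>\<beta>\<bar>" for p q \<alpha> \<beta>
  proof (rule intro[OF pq veq \<open>\<alpha> * \<beta> \<le> 0\<close> le])
    show \<beta>: "\<beta> \<noteq> 0" using v veq le by auto
    show "\<alpha> = 0 \<longrightarrow> (\<forall>z\<in>K. cross v (z - A) \<ge> 0) \<and> cross v (p - A) > 0"
    proof
      assume "\<alpha> = 0"
      have "cross v (p - A) = \<beta> * cross (q - A) (p - A)" by (simp add: veq \<open>\<alpha> = 0\<close>)
      then have "cross v (p - A) \<noteq> 0" using \<beta> pq(3) cross_commute[of "q - A" "p - A"] by simp
      then have "cross v (p - A) > 0" using posE[OF pq(1)] by (auto simp: pos_def)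
      moreover have "cross v (z - A) \<ge> 0" if "z \<in> K" for z using m(2)[OF that] AK(2) by (simp add: cross_diff)
      ultimately show "(\<forall>z\<in>K. cross v (z - A) \<ge> 0) \<and> cross v (p - A) > 0" by blast
    qed
  qed
  define c where "c = cross (p - A) (q - A)"
  \<comment> \<open>Cramer's rule for \<open>v\<close> in the basis of the two edge vectors.\<close>
  define \<alpha> where "\<alpha> = cross v (q - A) / c"
  define \<beta> where "\<beta> = cross (p - A) v / c"
  have c0: "c \<noteq> 0" using pq by (simp add: c_def)
  have "c *\<^sub>R v = cross v (q - A) *\<^sub>R (p - A) + cross (p - A) v *\<^sub>R (q - A)"
    by (simp add: complex_eq_iff c_def cross_def algebra_simps)
  then have "(1 / c) *\<^sub>R (c *\<^sub>R v) = (1 / c) *\<^sub>R (cross v (q - A) *\<^sub>R (p - A) + cross (p - A) v *\<^sub>R (q - A))"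
    by simp
  then have veq: "v = \<alpha> *\<^sub>R (p - A) + \<beta> *\<^sub>R (q - A)"
    using c0 by (simp add: \<alpha>_def \<beta>_def scaleR_add_right)
  \<comment> \<open>Both edges point to the nonnegative side of \<open>v\<close>, while the two
    Cramer numerators are \<open>cross v (q - A)\<close> and \<open>- cross v (p - A)\<close>. So
    the coordinates never have the same strict sign; swapping \<open>p\<close> and \<open>q\<close>
    then arranges their sizes.\<close>
  have "cross v (p - A) \<ge> 0" "cross v (q - A) \<ge> 0" using posE pq by (force simp: pos_def)+
  then have "cross v (q - A) * cross (p - A) v \<le> 0"
    by (subst cross_commute[of "p - A"]) (simp add: mult_nonneg_nonneg)
  moreover have "\<alpha> * \<beta> = cross v (q - A) * cross (p - A) v / c\<^sup>2"
    by (simp add: \<alpha>_def \<beta>_def power2_eq_square)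
  ultimately have sgn: "\<alpha> * \<beta> \<le> 0" by (simp add: divide_nonpos_nonneg)
  show thesis
  proof (cases "\<bar>\<alpha>\<bar> \<le> \<bar>\<beta>\<bar>")
    case True
    then show thesis using conclude[OF pq veq sgn] by blast
  next
    case False
    have "cross (q - A) (p - A) \<noteq> 0" using pq(3) by (subst cross_commute) simp
    then show thesis using conclude[OF pq(2,1), of \<beta> \<alpha>] veq sgn False by (simp add: add.commute mult.commute)
  qed
qed

section \<open>Breaks along a segment of tile boundaries\<close>

lemma cross_zero_inner_zero:
  fixes n u a :: complex
  assumes "n \<bullet> u = 0" "a \<bullet> u = 0" "n \<noteq> 0" "u \<noteq> 0"
  obtains c where "a = c *\<^sub>R n"
proof -
  have "cross n a * (Re u)\<^sup>2 = 0" "cross n a * (Im u)\<^sup>2 = 0"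
    using assms(1,2) unfolding cross_def inner_complex_def by algebra+
  then have "cross n a = 0" using assms(4) by (auto simp: complex_eq_iff)
  then show thesis using cross_zero_parallel[OF _ assms(3)] that by blast
qed

lemma half_ball_nonempty:
  fixes n x :: complex
  assumes "n \<noteq> 0" "e > 0"
  obtains z where "z \<in> ball x e" "n \<bullet> (z - x) > 0"
proof (rule that[of "x + (e / (2 * norm n)) *\<^sub>R n"])
  show "n \<bullet> (x + (e / (2 * norm n)) *\<^sub>R n - x) > 0" using assms by simp
qed (use assms in \<open>simp add: dist_norm\<close>)

lemma open_half_ball: "open ({z. n \<bullet> (z - x) > 0} \<inter> ball x e)" for n x :: complex
  by (intro open_Int open_ball) (simp add: inner_diff_right open_halfspace_gt)

lemma in_open_segment_scaleR:
  fixes a d :: "'a::real_vector"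
  assumes "0 < s" "s < 1" "d \<noteq> 0" shows "a + s *\<^sub>R d \<in> open_segment a (a + d)"
  unfolding in_segment using assms by (auto intro!: exI[of _ s] simp: algebra_simps)

text \<open>The additive monoid generated by \<open>L\<close>: summands may repeat, and the empty
  list contributes \<open>0\<close>.\<close>

definition list_sums :: "real set \<Rightarrow> real set" where
  "list_sums L = {sum_list xs |xs. set xs \<subseteq> L}"

lemma list_sums_single: "x \<in> L \<Longrightarrow> x \<in> list_sums L"
  unfolding list_sums_def by (auto intro!: exI[of _ "[x]"])

lemma list_sums_add:
  assumes "x \<in> list_sums L" "y \<in> list_sums L" shows "x + y \<in> list_sums L"
proof -
  obtain xs ys where "x = sum_list xs" "set xs \<subseteq> L" "y = sum_list ys" "set ys \<subseteq> L"
    using assms by (auto simp: list_sums_def)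
  then have "x + y = sum_list (xs @ ys)" "set (xs @ ys) \<subseteq> L" by auto
  then show ?thesis unfolding list_sums_def by blast
qed

text \<open>Summands are at least \<open>Min L > 0\<close>, so a sum up to \<open>B\<close> has a
  bounded number of them.\<close>

lemma finite_bounded_list_sums:
  assumes "finite L" "\<And>x. x \<in> L \<Longrightarrow> x > 0"
  shows "finite {x \<in> list_sums L. x \<le> B}"
proof (cases "L = {}")
  case True
  then have "{x \<in> list_sums L. x \<le> B} \<subseteq> {0}" by (auto simp: list_sums_def)
  then show ?thesis by (rule finite_subset) simp
next
  case False
  define m where "m = Min L"
  have m: "m > 0" "\<And>x. x \<in> L \<Longrightarrow> m \<le> x" using assms False by (auto simp: m_def)
  have len: "real (length xs) * m \<le> sum_list xs" if "set xs \<subseteq> L" for xs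
    using that by (induction xs) (use m in \<open>auto simp: algebra_simps intro: add_mono\<close>)
  have "{x \<in> list_sums L. x \<le> B} \<subseteq> sum_list ` {xs. set xs \<subseteq> L \<and> length xs \<le> nat \<lceil>B / m\<rceil>}"
  proof
    fix x assume "x \<in> {x \<in> list_sums L. x \<le> B}"
    then obtain xs where xs: "x = sum_list xs" "set xs \<subseteq> L" "x \<le> B" by (auto simp: list_sums_def)
    have "real (length xs) * m \<le> B" using len[OF xs(2)] xs by simp
    then have "real (length xs) \<le> B / m" using m(1) by (simp add: field_simps)
    then have "length xs \<le> nat \<lceil>B / m\<rceil>" by linarith
    then show "x \<in> sum_list ` {xs. set xs \<subseteq> L \<and> length xs \<le> nat \<lceil>B / m\<rceil>}" using xs by blast
  qed
  then show ?thesis by (rule finite_subset) (simp add: finite_lists_length_le assms(1))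
qed

text \<open>The geometric argument sees a substitution tiling only through these properties;
  \<open>L\<close> stands for the finite set of distances between vertices of one prototile.\<close>

locale polygonal_tiling =
  fixes T :: "complex set set" and L :: "real set"
  assumes tiling: "is_tiling T"
    and locally_finite: "finite {t \<in> T. t \<inter> ball 0 r \<noteq> {}}"
    and finite_tile_vertices: "t \<in> T \<Longrightarrow> finite (vertices t)"
    and vertex_distance: "t \<in> T \<Longrightarrow> p \<in> vertices t \<Longrightarrow> q \<in> vertices t \<Longrightarrow> p \<noteq> q \<Longrightarrow> dist p q \<in> L"
begin

lemma tile: "t \<in> T \<Longrightarrow> compact t" "t \<in> T \<Longrightarrow> closure (interior t) = t" "t \<in> T \<Longrightarrow> closed t"
  using tiling by (auto simp: is_tiling_def is_tile_def compact_imp_closed)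

lemma covering: "\<exists>t\<in>T. z \<in> t"
  using tiling unfolding is_tiling_def by blast

lemma interiors_meet: "s \<in> T \<Longrightarrow> t \<in> T \<Longrightarrow> z \<in> interior s \<Longrightarrow> z \<in> interior t \<Longrightarrow> s = t"
  using tiling unfolding is_tiling_def by blast

lemma tile_meets_interior:
  assumes "s \<in> T" "t \<in> T" "z \<in> s" "z \<in> interior t" shows "s = t"
proof -
  have "interior t \<inter> closure (interior s) \<noteq> {}" using assms tile(2)[OF assms(1)] by blast
  then have "interior t \<inter> interior s \<noteq> {}" by (simp add: open_Int_closure_eq_empty)
  then show ?thesis using interiors_meet assms by blast
qed

text \<open>A break on the side \<open>n\<close> of a segment orthogonal to \<open>n\<close> is a point where, on that side, one
  tile ends along the segment and the next one begins.\<close>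
definition fills :: "complex \<Rightarrow> complex \<Rightarrow> complex set \<Rightarrow> bool" where
  "fills n x t \<longleftrightarrow> t \<in> T \<and> (\<exists>e>0. {z. n \<bullet> (z - x) > 0} \<inter> ball x e \<subseteq> t)"

definition is_break :: "complex \<Rightarrow> complex \<Rightarrow> bool" where
  "is_break n x \<longleftrightarrow> \<not> (\<exists>t. fills n x t)"

lemma fills_interior:
  assumes "fills n x t"
  obtains e where "e > 0" "{z. n \<bullet> (z - x) > 0} \<inter> ball x e \<subseteq> interior t"
proof -
  obtain e where e: "e > 0" "{z. n \<bullet> (z - x) > 0} \<inter> ball x e \<subseteq> t"
    using assms by (auto simp: fills_def)
  show thesis using that[OF e(1) interior_maximal[OF e(2) open_half_ball]] .
qed

lemma fills_unique:
  assumes "fills n x s" "fills n x t" "n \<noteq> 0" shows "s = t"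
proof -
  obtain e where e: "e > 0" "{z. n \<bullet> (z - x) > 0} \<inter> ball x e \<subseteq> interior s"
    using fills_interior[OF assms(1)] .
  obtain d where d: "d > 0" "{z. n \<bullet> (z - x) > 0} \<inter> ball x d \<subseteq> interior t"
    using fills_interior[OF assms(2)] .
  obtain z where "z \<in> ball x (min e d)" "n \<bullet> (z - x) > 0"
    using half_ball_nonempty[OF assms(3), of "min e d" x] e(1) d(1) by auto
  then have "z \<in> interior s" "z \<in> interior t" using e(2) d(2) by auto
  moreover have "s \<in> T" "t \<in> T" using assms(1,2) by (auto simp: fills_def)
  ultimately show ?thesis using interiors_meet by blast
qed

lemma fills_mem:
  assumes "fills n x t" "n \<noteq> 0" shows "x \<in> t"
proof -
  obtain e where e: "e > 0" "{z. n \<bullet> (z - x) > 0} \<inter> ball x e \<subseteq> t" "t \<in> T"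
    using assms by (auto simp: fills_def)
  show ?thesis using closed_halfplane_in_closed[OF tile(3)[OF e(3)] assms(2) e(2), of x] e(1) by simp
qed

lemma fills_near:
  assumes "fills n x t"
  obtains e where "e > 0" "\<And>y. y \<in> ball x e \<Longrightarrow> n \<bullet> (y - x) = 0 \<Longrightarrow> fills n y t"
proof -
  obtain e where e: "e > 0" "{z. n \<bullet> (z - x) > 0} \<inter> ball x e \<subseteq> t" "t \<in> T"
    using assms by (auto simp: fills_def)
  show thesis
  proof (rule that[OF e(1)])
    fix y assume y: "y \<in> ball x e" "n \<bullet> (y - x) = 0"
    obtain d where d: "d > 0" "ball y d \<subseteq> ball x e" using y(1) by (meson open_ball open_contains_ball)
    have "n \<bullet> (z - y) = n \<bullet> (z - x)" for z using y(2) by (simp add: inner_diff_right)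
    then have "{z. n \<bullet> (z - y) > 0} \<inter> ball y d \<subseteq> t" using e(2) d(2) by auto
    then show "fills n y t" unfolding fills_def using e(3) d(1) by blast
  qed
qed

text \<open>The source of breaks from periodicity: a translated boundary edge consists of points
  interior to no tile and comes arbitrarily close to \<open>x\<close> from the side
  \<open>n\<close>.\<close>

lemma break_if_near_uncovered:
  assumes "\<And>e. e > 0 \<Longrightarrow> \<exists>z\<in>ball x e. n \<bullet> (z - x) > 0 \<and> (\<forall>t\<in>T. z \<notin> interior t)"
  shows "is_break n x"
  unfolding is_break_def
proof
  assume "\<exists>t. fills n x t"
  then obtain t where t: "fills n x t" by blast
  then obtain e where "e > 0" "{z. n \<bullet> (z - x) > 0} \<inter> ball x e \<subseteq> interior t" by (rule fills_interior)
  moreover have "t \<in> T" using t by (simp add: fills_def)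
  ultimately show False using assms[of e] by blast
qed

text \<open>At a flat point the boundary line of \<open>t\<close> must run along the segment, since
  otherwise a small step along the segment, forwards or backwards, would enter the interior of
  \<open>t\<close>.\<close>

lemma flat_on_clean_segment:
  assumes t: "t \<in> T" and x: "x \<in> open_segment a b" "x \<in> t" "x \<notin> vertices t"
    and clean: "\<And>z. z \<in> open_segment a b \<Longrightarrow> z \<notin> interior t"
    and n: "n \<noteq> 0" "n \<bullet> (b - a) = 0"
  obtains c e where "c \<noteq> 0" "e > 0" "t \<inter> ball x e = {z. c * (n \<bullet> (z - x)) \<ge> 0} \<inter> ball x e"
proof -
  have ab: "a \<noteq> b" using x(1) by auto
  have "x \<in> frontier t" using x(1,2) clean closure_subset by (auto simp: frontier_def)
  then obtain m e where m: "m \<noteq> 0" "e > 0" and K: "t \<inter> ball x e = {z. m \<bullet> (z - x) \<ge> 0} \<inter> ball x e"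
    using x(3) by (auto simp: vertices_flat flat_def)
  obtain u where u: "0 < u" "u < 1" "x = a + u *\<^sub>R (b - a)"
    using x(1) by (auto simp: in_segment algebra_simps)
  \<comment> \<open>Both \<open>x + \<epsilon> *\<^sub>R (b - a)\<close> and its mirror image stay
    in the open segment and in the germ at \<open>x\<close>; halving makes the bounds
    strict.\<close>
  define \<epsilon> where "\<epsilon> = min (min u (1 - u)) (e / norm (b - a)) / 2"
  have \<epsilon>: "0 < \<epsilon>" "\<epsilon> < u" "\<epsilon> < 1 - u" "\<epsilon> * norm (b - a) < e"
  proof -
    define k where "k = min (min u (1 - u)) (e / norm (b - a))"
    have "k > 0" using u m ab by (simp add: k_def)
    moreover have "k \<le> u" "k \<le> 1 - u" and k: "k \<le> e / norm (b - a)" by (auto simp: k_def)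
    moreover have "\<epsilon> = k / 2" by (simp add: \<epsilon>_def k_def)
    ultimately show "0 < \<epsilon>" "\<epsilon> < u" "\<epsilon> < 1 - u" by auto
    have "\<epsilon> < e / norm (b - a)" using k \<open>k > 0\<close> \<open>\<epsilon> = k / 2\<close> by linarith
    then show "\<epsilon> * norm (b - a) < e" using ab by (simp add: field_simps)
  qed
  have "m \<bullet> (s *\<^sub>R (b - a)) \<le> 0" if s: "\<bar>s\<bar> = \<epsilon>" for s
  proof (rule ccontr)
    assume "\<not> ?thesis"
    moreover have "x + s *\<^sub>R (b - a) \<in> ball x e" using s \<epsilon> by (simp add: dist_norm)
    ultimately have "x + s *\<^sub>R (b - a) \<in> interior t"
      using halfplane_germ(1)[OF K m(1), of "x + s *\<^sub>R (b - a)"] by simp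
    moreover have "x + s *\<^sub>R (b - a) \<in> open_segment a b"
      using in_open_segment_scaleR[of "u + s" "b - a" a] s \<epsilon> ab by (auto simp: u(3) algebra_simps)
    ultimately show False using clean by blast
  qed
  from this[of \<epsilon>] this[of "- \<epsilon>"] have m0: "m \<bullet> (b - a) = 0" using \<epsilon>(1)
    by (simp add: mult_le_0_iff zero_le_mult_iff)
  have "b - a \<noteq> 0" using ab by simp
  then obtain c where c: "m = c *\<^sub>R n" using cross_zero_inner_zero[OF n(2) m0 n(1)] by blast
  show thesis using that[of c e] K m by (auto simp: c)
qed

text \<open>If \<open>x\<close> is no tile vertex, every tile at \<open>x\<close> is locally a
  half-plane bounded by the segment. By local finiteness one radius serves all of them, so a tile
  covering a nearby point on the side \<open>n\<close> fills that whole side.\<close>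

lemma break_is_tile_vertex:
  assumes x: "x \<in> open_segment a b" and n: "n \<noteq> 0" "n \<bullet> (b - a) = 0"
    and clean: "\<And>z t. z \<in> open_segment a b \<Longrightarrow> t \<in> T \<Longrightarrow> z \<notin> interior t"
    and "is_break n x"
  shows "\<exists>t\<in>T. x \<in> vertices t"
proof (rule ccontr)
  assume "\<not> ?thesis"
  then have nv: "x \<notin> vertices t" if "t \<in> T" for t using that by blast
  define N where "N = {t \<in> T. t \<inter> ball 0 (norm x + 1) \<noteq> {}}"
  have finN: "finite N" unfolding N_def by (rule locally_finite)
  define far where "far = \<Union>{t \<in> N. x \<notin> t}"
  have "finite {t \<in> N. x \<notin> t}" using finN by simp
  then have "closed far" unfolding far_def using tile(3) by (intro closed_Union) (auto simp: N_def)
  moreover have "x \<notin> far" by (auto simp: far_def)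
  ultimately obtain r where r: "r > 0" "ball x r \<subseteq> - far" by (meson ComplI open_Compl open_contains_ball)
  have "\<exists>c e. c \<noteq> 0 \<and> e > 0 \<and> t \<inter> ball x e = {z. c * (n \<bullet> (z - x)) \<ge> 0} \<inter> ball x e"
    if tx: "t \<in> N" "x \<in> t" for t
  proof -
    have tT: "t \<in> T" using tx(1) by (simp add: N_def)
    obtain c e where "c \<noteq> 0" "e > 0" "t \<inter> ball x e = {z. c * (n \<bullet> (z - x)) \<ge> 0} \<inter> ball x e"
      using flat_on_clean_segment[OF tT x tx(2) nv[OF tT] clean[OF _ tT] n] .
    then show ?thesis by blast
  qed
  then have "\<forall>t\<in>{t \<in> N. x \<in> t}. \<exists>c e. c \<noteq> 0 \<and> e > 0 \<and> t \<inter> ball x e = {z. c * (n \<bullet> (z - x)) \<ge> 0} \<inter> ball x e"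
    by blast
  from bchoice[OF this] obtain c where "\<forall>t\<in>{t \<in> N. x \<in> t}. \<exists>e. c t \<noteq> 0 \<and> e > 0 \<and>
      t \<inter> ball x e = {z. c t * (n \<bullet> (z - x)) \<ge> 0} \<inter> ball x e" by blast
  from bchoice[OF this] obtain e where ce: "\<And>t. t \<in> N \<Longrightarrow> x \<in> t \<Longrightarrow>
      c t \<noteq> 0 \<and> e t > 0 \<and> t \<inter> ball x (e t) = {z. c t * (n \<bullet> (z - x)) \<ge> 0} \<inter> ball x (e t)"
    by blast
  define d where "d = Min (insert (min 1 r) (e ` {t \<in> N. x \<in> t}))"
  have d: "d > 0" "d \<le> 1" "d \<le> r" "\<And>t. t \<in> N \<Longrightarrow> x \<in> t \<Longrightarrow> d \<le> e t"
  proof -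
    show "d > 0" unfolding d_def using finN ce r by (subst Min_gr_iff) auto
    have "d \<le> min 1 r" unfolding d_def using finN by (intro Min_le) auto
    then show "d \<le> 1" "d \<le> r" by auto
    show "d \<le> e t" if "t \<in> N" "x \<in> t" for t unfolding d_def using finN that by (intro Min_le) auto
  qed
  obtain w where w: "w \<in> ball x d" "n \<bullet> (w - x) > 0" using half_ball_nonempty[OF n(1) d(1)] .
  obtain t where t: "t \<in> T" "w \<in> t" using covering by blast
  have "norm w \<le> norm x + dist x w"
    using norm_triangle_sub[of w x] by (simp add: dist_norm norm_minus_commute)
  then have "w \<in> ball 0 (norm x + 1)" using w(1) d(2) by simp
  then have tN: "t \<in> N" using t by (auto simp: N_def)
  have xt: "x \<in> t"
  proof (rule ccontr)
    assume "x \<notin> t"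
    then have "w \<in> far" using t tN by (auto simp: far_def)
    moreover have "w \<in> ball x r" using w(1) d(3) by simp
    ultimately show False using r by blast
  qed
  have eq: "t \<inter> ball x (e t) = {z. c t * (n \<bullet> (z - x)) \<ge> 0} \<inter> ball x (e t)"
    and c0: "c t \<noteq> 0" "e t > 0" using ce[OF tN xt] by auto
  have "w \<in> t \<inter> ball x (e t)" using w(1) t d(4)[OF tN xt] by auto
  then have "c t * (n \<bullet> (w - x)) \<ge> 0" unfolding eq by simp
  then have c: "c t > 0" using w(2) c0 by (auto simp: zero_le_mult_iff)
  have "{z. n \<bullet> (z - x) > 0} \<inter> ball x (e t) \<subseteq> {z. c t * (n \<bullet> (z - x)) \<ge> 0} \<inter> ball x (e t)"
    using c by auto
  then have "{z. n \<bullet> (z - x) > 0} \<inter> ball x (e t) \<subseteq> t" unfolding eq[symmetric] by blast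
  then have "fills n x t" unfolding fills_def using t c0 by blast
  then show False using assms(5) by (auto simp: is_break_def)
qed

text \<open>The filling tile is unique and locally constant along the segment, and an open segment
  is connected.\<close>

lemma fills_constant:
  assumes n: "n \<noteq> 0" "n \<bullet> (b - a) = 0" and ab: "a \<noteq> b"
    and nb: "\<And>z. z \<in> open_segment a b \<Longrightarrow> \<not> is_break n z"
  obtains t where "\<And>z. z \<in> open_segment a b \<Longrightarrow> fills n z t"
proof -
  define f where "f z = (SOME t. fills n z t)" for z
  have f: "fills n z (f z)" if "z \<in> open_segment a b" for z
    unfolding f_def using nb[OF that] by (auto simp: is_break_def intro: someI)
  have perp: "n \<bullet> (z - y) = 0" if yz: "y \<in> open_segment a b" "z \<in> open_segment a b" for y z
  proof -
    obtain s where "z - y = s *\<^sub>R (b - a)"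
      using segment_diff[of y a b z] yz open_closed_segment by blast
    then show ?thesis using n(2) by simp
  qed
  have "eventually (\<lambda>z. f y = f z) (at y within open_segment a b)" if y: "y \<in> open_segment a b" for y
  proof -
    obtain e where e: "e > 0" "\<And>z. z \<in> ball y e \<Longrightarrow> n \<bullet> (z - y) = 0 \<Longrightarrow> fills n z (f y)"
      using fills_near[OF f[OF y]] by blast
    have "f y = f z" if "z \<in> open_segment a b" "dist z y < e" for z
      using fills_unique[OF e(2) f n(1), of z] that perp[OF y] by (auto simp: dist_commute)
    then show ?thesis unfolding eventually_at using e(1) by blast
  qed
  then have const: "f y = f z" if "y \<in> open_segment a b" "z \<in> open_segment a b" for y z
    using connected_local_const[OF convex_connected[OF convex_open_segment], of y a b z f] that by blast
  have "midpoint a b \<in> open_segment a b" using ab by simp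
  then show thesis using that[of "f (midpoint a b)"] f const by metis
qed

text \<open>If \<open>t\<close> were flat at \<open>a\<close>, its boundary line would contain
  nearby segment points and hence follow the segment. Then \<open>t\<close> would fill the side
  \<open>n\<close> at \<open>a\<close> as well, contradicting the break.\<close>

lemma vertex_at_end_of_filled_segment:
  assumes n: "n \<noteq> 0" "n \<bullet> (b - a) = 0" and ab: "a \<noteq> b"
    and fill: "\<And>z. z \<in> open_segment a b \<Longrightarrow> fills n z t"
    and clean: "\<And>z. z \<in> open_segment a b \<Longrightarrow> z \<notin> interior t"
    and brk: "is_break n a"
  shows "a \<in> vertices t"
proof (rule ccontr)
  assume nv: "a \<notin> vertices t"
  have "midpoint a b \<in> open_segment a b" using ab by simp
  then have tT: "t \<in> T" using fill[of "midpoint a b"] by (simp add: fills_def)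
  have fr: "z \<in> frontier t" if "z \<in> open_segment a b" for z
    using fills_mem[OF fill[OF that] n(1)] clean[OF that] closure_subset by (auto simp: frontier_def)
  have "closure (open_segment a b) \<subseteq> frontier t"
    by (rule closure_minimal) (use fr in auto)
  then have "a \<in> frontier t" using ab by auto
  then obtain m e where m: "m \<noteq> 0" "e > 0" and K: "t \<inter> ball a e = {z. m \<bullet> (z - a) \<ge> 0} \<inter> ball a e"
    using nv by (auto simp: vertices_flat flat_def)
  define s where "s = min 1 (e / norm (b - a)) / 2"
  have s: "0 < s" "s < 1" "s * norm (b - a) < e"
  proof -
    define k where "k = min 1 (e / norm (b - a))"
    have "k > 0" using m ab by (simp add: k_def)
    moreover have "k \<le> 1" and k: "k \<le> e / norm (b - a)" by (auto simp: k_def)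
    moreover have "s = k / 2" by (simp add: s_def k_def)
    ultimately show "0 < s" "s < 1" by auto
    have "s < e / norm (b - a)" using k \<open>k > 0\<close> \<open>s = k / 2\<close> by linarith
    then show "s * norm (b - a) < e" using ab by (simp add: field_simps)
  qed
  define y where "y = a + s *\<^sub>R (b - a)"
  have y: "y \<in> open_segment a b" using in_open_segment_scaleR[of s "b - a" a] s ab by (simp add: y_def)
  have yb: "y \<in> ball a e" using s by (simp add: y_def dist_norm)
  have "m \<bullet> (y - a) = 0"
    using halfplane_germ(1,2)[OF K m(1) yb] fr[OF y] unfolding frontier_def
    by (meson DiffD1 DiffD2 linorder_neqE_linordered_idom)
  then have m0: "m \<bullet> (b - a) = 0" using s by (simp add: y_def)
  have "b - a \<noteq> 0" using ab by simp
  then obtain c where c: "m = c *\<^sub>R n" using cross_zero_inner_zero[OF n(2) m0 n(1)] by blast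
  obtain d where d: "d > 0" "{z. n \<bullet> (z - y) > 0} \<inter> ball y d \<subseteq> t" using fill[OF y] by (auto simp: fills_def)
  obtain d' where d': "d' > 0" "ball y d' \<subseteq> ball a e" using yb by (meson open_ball open_contains_ball)
  obtain w where w: "w \<in> ball y (min d d')" "n \<bullet> (w - y) > 0"
    using half_ball_nonempty[OF n(1), of "min d d'" y] d(1) d'(1) by auto
  have "w \<in> t \<inter> ball a e" using w d d' by auto
  then have "m \<bullet> (w - a) \<ge> 0" unfolding K by simp
  moreover have "n \<bullet> (w - a) = n \<bullet> (w - y)" using n(2) by (simp add: y_def inner_diff_right inner_add_right)
  ultimately have "c > 0" using w(2) m(1) by (auto simp: c zero_le_mult_iff)
  then have "{z. n \<bullet> (z - a) > 0} \<inter> ball a e \<subseteq> {z. m \<bullet> (z - a) \<ge> 0} \<inter> ball a e" by (auto simp: c)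
  then have "{z. n \<bullet> (z - a) > 0} \<inter> ball a e \<subseteq> t" unfolding K[symmetric] by blast
  then have "fills n a t" unfolding fills_def using tT m(2) by blast
  then show False using brk by (auto simp: is_break_def)
qed

lemma finite_vertices_near: "finite (\<Union>t\<in>{t \<in> T. t \<inter> ball 0 r \<noteq> {}}. vertices t)"
  using locally_finite finite_tile_vertices by auto

text \<open>Breaks inside the segment are tile vertices, hence finite in number. Between consecutive
  breaks one tile fills the side, and both ends are vertices of that tile; induction on the number
  of inner breaks adds up these distances.\<close>

lemma distance_of_breaks:
  assumes n: "n \<noteq> 0" "n \<bullet> (b - a) = 0" and ab: "a \<noteq> b"
    and clean: "\<And>z t. z \<in> open_segment a b \<Longrightarrow> t \<in> T \<Longrightarrow> z \<notin> interior t"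
    and brk: "is_break n a" "is_break n b"
  shows "dist a b \<in> list_sums L"
proof -
  define B where "B a b = {z \<in> open_segment a b. is_break n z}" for a b
  obtain r where r: "open_segment a b \<subseteq> ball 0 r"
    using bounded_subset_ballD[OF bounded_open_segment, of a b 0] by auto
  have "finite (B a b)"
  proof (rule finite_subset[OF _ finite_vertices_near[of r]], rule subsetI)
    fix z assume z: "z \<in> B a b"
    then obtain t where t: "t \<in> T" "z \<in> vertices t"
      using break_is_tile_vertex[OF _ n clean] by (auto simp: B_def)
    then have "z \<in> t" using frontier_subset_closed[OF tile(3)[OF t(1)]] by (auto simp: vertices_flat)
    moreover have "z \<in> ball 0 r" using z r by (auto simp: B_def)
    ultimately show "z \<in> (\<Union>t\<in>{t \<in> T. t \<inter> ball 0 r \<noteq> {}}. vertices t)" using t by blast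
  qed
  then show ?thesis using n(2) ab clean brk
  proof (induction "card (B a b)" arbitrary: a b rule: less_induct)
    case less
    show ?case
    proof (cases "B a b = {}")
      case True
      then obtain t where t: "\<And>z. z \<in> open_segment a b \<Longrightarrow> fills n z t"
        using fills_constant[OF n(1) less.prems(2,3)] unfolding B_def by blast
      have "midpoint a b \<in> open_segment a b" using less.prems by simp
      then have tT: "t \<in> T" using t[of "midpoint a b"] by (simp add: fills_def)
      have "a \<in> vertices t"
        using vertex_at_end_of_filled_segment[OF n(1) less.prems(2,3) t] less.prems(4,5) tT by blast
      moreover have "b \<in> vertices t"
      proof (rule vertex_at_end_of_filled_segment[OF n(1)])
        show "n \<bullet> (a - b) = 0" using less.prems(2) by (simp add: inner_diff_right)
      qed (use t less.prems tT in \<open>auto simp: open_segment_commute\<close>)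
      ultimately show ?thesis using vertex_distance tT less.prems(3) list_sums_single by blast
    next
      case False
      then obtain c where c: "c \<in> B a b" by blast
      then have cs: "c \<in> open_segment a b" "is_break n c" by (auto simp: B_def)
      have sub: "open_segment a c \<subseteq> open_segment a b" "open_segment c b \<subseteq> open_segment a b"
        using cs(1) by (auto simp: subset_open_segment open_closed_segment)
      have dist: "dist a b = dist a c + dist c b"
        using cs(1) between_mem_segment[of a b c] by (simp add: between open_closed_segment)
      have perp: "n \<bullet> (c - a) = 0" "n \<bullet> (b - c) = 0"
      proof -
        have "c \<in> closed_segment a b" using cs(1) open_closed_segment by blast
        then obtain s where "c - a = s *\<^sub>R (b - a)" using segment_diff[of a a b c] by auto
        then show "n \<bullet> (c - a) = 0" using less.prems(2) by simp
        then show "n \<bullet> (b - c) = 0" using less.prems(2) by (simp add: inner_diff_right)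
      qed
      have "c \<notin> open_segment a c" "c \<notin> open_segment c b" by (auto simp: open_segment_def)
      then have ps: "B a c \<subset> B a b" "B c b \<subset> B a b" using sub c by (auto simp: B_def)
      have ne: "a \<noteq> c" "c \<noteq> b" using cs(1) by (auto simp: open_segment_def)
      have "dist a c \<in> list_sums L"
        using less.hyps[of a c] psubset_card_mono[OF less.prems(1) ps(1)] finite_subset[OF _ less.prems(1)]
          ps(1) sub(1) perp ne less.prems cs by blast
      moreover have "dist c b \<in> list_sums L"
        using less.hyps[of c b] psubset_card_mono[OF less.prems(1) ps(2)] finite_subset[OF _ less.prems(1)]
          ps(2) sub(2) perp ne less.prems cs by blast
      ultimately show ?thesis unfolding dist by (rule list_sums_add)
    qed
  qed
qed

end

section \<open>Finite unions of tiles and breaks at their vertices\<close>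

lemma regular_closed_meets_open:
  fixes n b :: complex
  assumes "closure (interior K) = K" "b \<in> K" "open U" "b \<in> U" "n \<noteq> 0"
  obtains z where "z \<in> K" "z \<in> U" "n \<bullet> (z - b) \<noteq> 0"
proof -
  have "U \<inter> interior K \<noteq> {}"
    using open_Int_closure_eq_empty[OF assms(3), of "interior K"] assms by blast
  then obtain z where "z \<in> U \<inter> interior K" "n \<bullet> (z - b) \<noteq> 0"
    using open_not_subset_line[OF open_Int[OF assms(3) open_interior] _ assms(5)] by blast
  then show thesis using that[of z] interior_subset by auto
qed

context polygonal_tiling
begin

lemma union_regular:
  assumes "finite F" "F \<subseteq> T"
  shows "compact (\<Union>F)" "closure (interior (\<Union>F)) = \<Union>F"
proof -
  show c: "compact (\<Union>F)" using assms tile(1) by (intro compact_Union) auto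
  show "closure (interior (\<Union>F)) = \<Union>F"
  proof
    show "closure (interior (\<Union>F)) \<subseteq> \<Union>F"
      by (intro closure_minimal interior_subset compact_imp_closed c)
    show "\<Union>F \<subseteq> closure (interior (\<Union>F))"
    proof
      fix z assume "z \<in> \<Union>F"
      then obtain t where t: "t \<in> F" "z \<in> t" by blast
      have "closure (interior t) \<subseteq> closure (interior (\<Union>F))"
        using t(1) by (intro closure_mono interior_mono) blast
      then show "z \<in> closure (interior (\<Union>F))" using tile(2) t assms(2) by blast
    qed
  qed
qed

lemma tile_disjoint_union:
  assumes "F \<subseteq> T" "t \<in> T" "t \<notin> F" "z \<in> \<Union>F" shows "z \<notin> interior t"
  using tile_meets_interior assms by blast

text \<open>Tiles of \<open>F\<close> have their interiors inside the interior of the union, and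
  other tiles have interiors disjoint from the union. Edges of a supertile are thus segments to
  which the break lemmas apply.\<close>

lemma union_frontier_not_interior:
  assumes F: "finite F" "F \<subseteq> T" and t: "t \<in> T" and z: "z \<in> frontier (\<Union>F)"
  shows "z \<notin> interior t"
proof (cases "t \<in> F")
  case True
  then have "interior t \<subseteq> interior (\<Union>F)" by (intro interior_mono) blast
  then show ?thesis using z by (auto simp: frontier_def)
next
  case False
  have "z \<in> \<Union>F"
    using z frontier_subset_closed[OF compact_imp_closed[OF union_regular(1)[OF F]]] by blast
  then show ?thesis using tile_disjoint_union[OF F(2) t False] by blast
qed

text \<open>Without a break, two tiles fill the two half-discs at \<open>b\<close>, and each belongs
  to \<open>F\<close> or not. Near \<open>b\<close> the union would be a full disc, a half-disc, or
  confined to a line, none of which is possible at a vertex of a regular closed set.\<close>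

lemma break_on_some_side:
  assumes F: "finite F" "F \<subseteq> T" and b: "b \<in> vertices (\<Union>F)" and n: "n \<noteq> 0"
  shows "is_break n b \<or> is_break (- n) b"
proof (rule ccontr)
  let ?S = "\<Union>F"
  assume "\<not> ?thesis"
  then obtain s t where st: "fills n b s" "fills (- n) b t" by (auto simp: is_break_def)
  have T: "s \<in> T" "t \<in> T" using st by (auto simp: fills_def)
  obtain d where d: "d > 0" "{z. n \<bullet> (z - b) > 0} \<inter> ball b d \<subseteq> interior s"
    using fills_interior[OF st(1)] .
  obtain e where e: "e > 0" "{z. - n \<bullet> (z - b) > 0} \<inter> ball b e \<subseteq> interior t"
    using fills_interior[OF st(2)] .
  have S: "closed ?S" "closure (interior ?S) = ?S"
    using union_regular[OF F] by (auto simp: compact_imp_closed)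
  have bf: "b \<in> frontier ?S" "\<not> flat ?S b" using b by (auto simp: vertices_flat)
  then have bS: "b \<in> ?S" using frontier_subset_closed[OF S(1)] by blast
  define r where "r = min d e"
  have r: "r > 0" using d e by (simp add: r_def)
  have half: "flat ?S b" if m: "m \<noteq> 0" and inn: "{z. m \<bullet> (z - b) > 0} \<inter> ball b r \<subseteq> ?S"
    and out: "\<And>z. m \<bullet> (z - b) < 0 \<Longrightarrow> z \<in> ball b r \<Longrightarrow> z \<notin> ?S" for m
  proof -
    have "?S \<inter> ball b r = {z. m \<bullet> (z - b) \<ge> 0} \<inter> ball b r"
      using out closed_halfplane_in_closed[OF S(1) m inn] by (force simp: not_less[symmetric])
    then show ?thesis unfolding flat_def using m r by blast
  qed
  have pos: "z \<in> interior s" if "n \<bullet> (z - b) > 0" "z \<in> ball b r" for z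
    using d that by (auto simp: r_def)
  have neg: "z \<in> interior t" if "n \<bullet> (z - b) < 0" "z \<in> ball b r" for z
    using e that by (auto simp: r_def)
  consider "s \<in> F" "t \<in> F" | "s \<in> F" "t \<notin> F" | "s \<notin> F" "t \<in> F" | "s \<notin> F" "t \<notin> F" by blast
  then show False
  proof cases
    case 1
    have inS: "z \<in> ?S" if "n \<bullet> (z - b) \<noteq> 0" "z \<in> ball b r" for z
    proof -
      have "z \<in> interior s \<or> z \<in> interior t" using that pos[of z] neg[of z] by linarith
      then show ?thesis using 1 interior_subset by blast
    qed
    have "z \<in> ?S" if z: "z \<in> ball b r" for z
    proof (cases "n \<bullet> (z - b) \<ge> 0")
      case True
      have "{z. n \<bullet> (z - b) > 0} \<inter> ball b r \<subseteq> ?S" using inS by auto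
      then show ?thesis using closed_halfplane_in_closed[OF S(1) n _ z True] by blast
    qed (use inS z in auto)
    then have "b \<in> interior ?S"
      using r by (meson centre_in_ball interior_maximal open_ball subsetD subsetI)
    then show False using bf by (simp add: frontier_def)
  next
    case 2
    have "flat ?S b"
      using half[OF n] pos neg 2 interior_subset tile_disjoint_union[OF F(2) T(2)] by blast
    then show False using bf by simp
  next
    case 3
    have "flat ?S b"
    proof (rule half)
      show "{z. - n \<bullet> (z - b) > 0} \<inter> ball b r \<subseteq> ?S"
      proof
        fix z assume "z \<in> {z. - n \<bullet> (z - b) > 0} \<inter> ball b r"
        then have "z \<in> interior t" using neg[of z] by simp
        then show "z \<in> ?S" using 3 interior_subset by blast
      qed
      show "z \<notin> ?S" if z: "- n \<bullet> (z - b) < 0" "z \<in> ball b r" for z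
      proof -
        have "z \<in> interior s" using pos[of z] z by simp
        then show ?thesis using 3 tile_disjoint_union[OF F(2) T(1)] by blast
      qed
    qed (use n in simp)
    then show False using bf by simp
  next
    case 4
    have "z \<notin> ?S" if z: "n \<bullet> (z - b) \<noteq> 0" "z \<in> ball b r" for z
    proof -
      have "z \<in> interior s \<or> z \<in> interior t" using z pos[of z] neg[of z] by linarith
      then show ?thesis
        using 4 tile_disjoint_union[OF F(2) T(1)] tile_disjoint_union[OF F(2) T(2)] by blast
    qed
    moreover have "b \<in> ball b r" using r by simp
    ultimately show False
      using regular_closed_meets_open[OF S(2) bS open_ball _ n, of b r] by blast
  qed
qed

text \<open>Needed when the side is prescribed. A tile filling the supporting side would make the
  union flat at \<open>b\<close> if it belongs to \<open>F\<close>; otherwise it would confine the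
  union near \<open>b\<close> to the supporting line.\<close>

lemma break_on_supporting_side:
  assumes F: "finite F" "F \<subseteq> T" and b: "b \<in> vertices (\<Union>F)" and n: "n \<noteq> 0"
    and supp: "\<And>z. z \<in> \<Union>F \<Longrightarrow> n \<bullet> (z - b) \<ge> 0"
  shows "is_break n b"
  unfolding is_break_def
proof
  let ?S = "\<Union>F"
  assume "\<exists>t. fills n b t"
  then obtain t where t: "fills n b t" by blast
  have tT: "t \<in> T" using t by (auto simp: fills_def)
  obtain r where r: "r > 0" "{z. n \<bullet> (z - b) > 0} \<inter> ball b r \<subseteq> interior t"
    using fills_interior[OF t] .
  have S: "closed ?S" "closure (interior ?S) = ?S"
    using union_regular[OF F] by (auto simp: compact_imp_closed)
  have bf: "b \<in> frontier ?S" "\<not> flat ?S b" using b by (auto simp: vertices_flat)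
  then have bS: "b \<in> ?S" using frontier_subset_closed[OF S(1)] by blast
  show False
  proof (cases "t \<in> F")
    case True
    have inn: "{z. n \<bullet> (z - b) > 0} \<inter> ball b r \<subseteq> ?S" using r True interior_subset by blast
    have "?S \<inter> ball b r = {z. n \<bullet> (z - b) \<ge> 0} \<inter> ball b r"
      using supp closed_halfplane_in_closed[OF S(1) n inn] by blast
    then have "flat ?S b" unfolding flat_def using n r by blast
    then show False using bf by simp
  next
    case False
    obtain z where z: "z \<in> ?S" "z \<in> ball b r" "n \<bullet> (z - b) \<noteq> 0"
      using regular_closed_meets_open[OF S(2) bS open_ball _ n, of b r] r(1) centre_in_ball by blast
    have "n \<bullet> (z - b) > 0" using supp[OF z(1)] z(3) by simp
    then have "z \<in> interior t" using z(2) r(2) by blast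
    then show False using tile_disjoint_union[OF F(2) tT False z(1)] by blast
  qed
qed

section \<open>Translates of an edge in a periodic tiling\<close>

lemma translate_tile:
  assumes per: "(\<lambda>t. (+) v ` t) ` T = T" and t: "t \<in> T"
  shows "(+) (of_nat k * v) ` t \<in> T" "(+) (- (of_nat k * v)) ` t \<in> T"
proof -
  have fwd: "(+) v ` s \<in> T" if "s \<in> T" for s using per that by blast
  have bwd: "(+) (- v) ` s \<in> T" if "s \<in> T" for s
  proof -
    have "s \<in> (\<lambda>t. (+) v ` t) ` T" unfolding per by (rule that)
    then obtain s' where s': "s' \<in> T" "s = (+) v ` s'" by blast
    have "(+) (- v) ` s = s'" unfolding s'(2) image_image by simp
    then show ?thesis using s'(1) by simp
  qed
  show "(+) (of_nat k * v) ` t \<in> T"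
  proof (induction k)
    case (Suc k)
    have "(+) (of_nat (Suc k) * v) ` t = (+) v ` (+) (of_nat k * v) ` t"
      unfolding image_image by (rule image_cong) (simp_all add: algebra_simps)
    then show ?case using fwd[OF Suc] by simp
  qed (use t in simp)
  show "(+) (- (of_nat k * v)) ` t \<in> T"
  proof (induction k)
    case (Suc k)
    have "(+) (- (of_nat (Suc k) * v)) ` t = (+) (- v) ` (+) (- (of_nat k * v)) ` t"
      unfolding image_image by (rule image_cong) (simp_all add: algebra_simps)
    then show ?case using bwd[OF Suc] by simp
  qed (use t in simp)
qed

lemma translated_frontier_not_interior:
  assumes per: "(\<lambda>t. (+) v ` t) ` T = T" and F: "finite F" "F \<subseteq> T" and t: "t \<in> T"
    and z: "z \<in> frontier (\<Union>F)" and \<sigma>: "\<sigma> = 1 \<or> \<sigma> = -1"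
  shows "z + (\<sigma> * real k) *\<^sub>R v \<notin> interior t"
proof
  define w where "w = (\<sigma> * real k) *\<^sub>R v"
  assume "z + (\<sigma> * real k) *\<^sub>R v \<in> interior t"
  then have "z + w \<in> interior t" by (simp add: w_def)
  then have "- w + (z + w) \<in> (+) (- w) ` interior t" by (rule imageI)
  then have "z \<in> interior ((+) (- w) ` t)"
    unfolding interior_translation[of "- w" t] by simp
  moreover have "- w = of_nat k * v \<or> - w = - (of_nat k * v)"
    using \<sigma> by (auto simp: w_def scaleR_conv_of_real)
  then have "(+) (- w) ` t \<in> T" using translate_tile[OF per t, of k] by (elim disjE) (simp_all only:)
  ultimately show False using union_frontier_not_interior[OF F] z by blast
qed

text \<open>Since \<open>T\<close> is periodic, the translates of the edge \<open>A p\<close> cut the edge \<open>A q\<close> into pieces of equal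
  length, the period measured along \<open>A q\<close>. The remainder at \<open>q\<close> is again a sum of vertex distances,
  provided that one looks at the side of the edge on which tiles end at \<open>q\<close>.\<close>
lemma edge_length_decomposition:
  assumes per: "(\<lambda>t. (+) v ` t) ` T = T" and F: "finite F" "F \<subseteq> T" and S: "S = \<Union>F"
    and Ap: "(A, p) \<in> edges S" and Aq: "(A, q) \<in> edges S"
    and cross0: "cross (p - A) (q - A) \<noteq> 0"
    and v: "v = \<alpha> *\<^sub>R (p - A) + \<beta> *\<^sub>R (q - A)" and ab: "\<alpha> * \<beta> \<le> 0" "\<bar>\<alpha>\<bar> \<le> \<bar>\<beta>\<bar>" "\<beta> \<noteq> 0"
    and vert: "\<alpha> = 0 \<Longrightarrow> (\<forall>z\<in>S. cross v (z - A) \<ge> 0) \<and> cross v (p - A) > 0"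
    and small: "2 * \<bar>\<beta>\<bar> < 1"
  obtains N :: nat and \<omega> \<delta> where "\<omega> = \<bar>\<beta>\<bar> * dist A q" "\<omega> > 0" "\<omega> \<in> list_sums L" "\<delta> \<in> list_sums L" "\<delta> \<le> \<omega>"
    "dist A q = real N * \<omega> + \<delta>"
proof -
  define d where "d = q - A"
  \<comment> \<open>The sign makes the translates by \<open>(\<sigma> * real j) *\<^sub>R v\<close>
    advance from \<open>A\<close> towards \<open>q\<close>. Since \<open>\<alpha>\<close> and
    \<open>\<beta>\<close> have no common sign, they simultaneously move back along the direction of
    \<open>p\<close>.\<close>
  define \<sigma> :: real where "\<sigma> = sgn \<beta>"
  have \<sigma>: "\<sigma> = 1 \<or> \<sigma> = -1" "\<sigma> * \<beta> = \<bar>\<beta>\<bar>" "\<sigma> * \<alpha> = - \<bar>\<alpha>\<bar>"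
    using ab(1,3) by (auto simp: \<sigma>_def sgn_if abs_if mult_le_0_iff)
  have Aqne: "A \<noteq> q" "A \<noteq> p" "q \<in> vertices S" using Ap Aq by (auto simp: edges_def)
  have d0: "d \<noteq> 0" "norm d = dist A q" "dist A q > 0"
    using Aqne by (auto simp: d_def dist_norm norm_minus_commute)
  have frS: "open_segment A p \<subseteq> frontier S" "open_segment A q \<subseteq> frontier S"
    using Ap Aq by (auto simp: edges_def)
  define n0 where "n0 = \<i> * d"
  have n0: "n0 \<noteq> 0" "n0 \<bullet> d = 0" "n0 \<bullet> (p - A) \<noteq> 0"
    using d0 cross0 cross_commute[of d "p - A"] by (auto simp: n0_def d_def simp flip: cross_inner)
  \<comment> \<open>Choice of the side. For \<open>\<alpha> = 0\<close> the translates of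
    \<open>A p\<close> merely start on \<open>A q\<close>, so the side of \<open>p\<close> is forced
    and the supporting line yields the break at \<open>q\<close>. Otherwise they cross
    \<open>A q\<close>, so whichever side has a break at \<open>q\<close> may be taken.\<close>
  obtain n where n: "n \<noteq> 0" "n \<bullet> d = 0" "n \<bullet> (p - A) \<noteq> 0" "is_break n q"
    and nvert: "\<alpha> = 0 \<Longrightarrow> n \<bullet> (p - A) > 0"
  proof (cases "\<alpha> = 0")
    case True
    have vd: "v = \<beta> *\<^sub>R d" using v True by (simp add: d_def)
    show thesis
    proof (rule that[of "\<i> * v"])
      show "\<i> * v \<noteq> 0" using vd d0 ab by simp
      show "(\<i> * v) \<bullet> d = 0" by (simp add: vd flip: cross_inner)
      show "(\<i> * v) \<bullet> (p - A) \<noteq> 0" "(\<i> * v) \<bullet> (p - A) > 0" using vert[OF True] by (simp_all flip: cross_inner)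
      show "is_break (\<i> * v) q"
      proof (rule break_on_supporting_side[OF F])
        show "q \<in> vertices (\<Union>F)" using Aqne by (simp add: S)
        show "\<i> * v \<noteq> 0" using vd d0 ab by simp
        fix z assume "z \<in> \<Union>F"
        then have "z \<in> S" by (simp add: S)
        then have "cross v (z - A) \<ge> 0" using vert[OF True] by blast
        moreover have "cross v (z - q) = cross v (z - A) - cross v d" by (simp add: d_def cross_diff)
        moreover have "cross v d = 0" by (simp add: vd)
        ultimately show "(\<i> * v) \<bullet> (z - q) \<ge> 0" by (simp flip: cross_inner)
      qed
    qed
  next
    case False
    have "is_break n0 q \<or> is_break (- n0) q"
      using break_on_some_side[OF F _ n0(1), of q] Aqne S by simp
    then show thesis using that[of n0] that[of "- n0"] n0 False by auto
  qed
  define x where "x j = A + (real j * \<bar>\<beta>\<bar>) *\<^sub>R d" for j :: nat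
  have brk: "is_break n (x j)" if j: "j \<ge> 1" "real j * \<bar>\<beta>\<bar> < 1" for j
  proof (rule break_if_near_uncovered)
    fix e :: real assume e: "e > 0"
    define s where "s = real j * \<bar>\<alpha>\<bar>"
    define \<tau> where "\<tau> = sgn (n \<bullet> (p - A))"
    have s: "s \<ge> 0" "s < 1"
    proof -
      have "s \<le> real j * \<bar>\<beta>\<bar>" using ab(2) by (simp add: s_def mult_left_mono)
      then show "s < 1" using j by simp
    qed (simp add: s_def)
    \<comment> \<open>The edge parameter \<open>s \<plusminus> \<epsilon>\<close> must stay strictly
      between 0 and 1. For \<open>\<alpha> = 0\<close> one has \<open>s = 0\<close>, but only the
      plus sign occurs, so the lower constraint is replaced by the harmless value 1.\<close>
    define m where "m = min (if \<alpha> = 0 then 1 else s) (min (1 - s) (e / dist A p))"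
    have m: "m > 0" "\<alpha> \<noteq> 0 \<Longrightarrow> m \<le> s" "m \<le> 1 - s" "m \<le> e / dist A p"
      using s e Aqne j(1) by (auto simp: s_def m_def)
    define \<epsilon> where "\<epsilon> = m / 2"
    have "\<epsilon> > 0" "\<epsilon> < m" using m(1) by (auto simp: \<epsilon>_def)
    then have \<epsilon>: "\<epsilon> > 0" "\<alpha> \<noteq> 0 \<Longrightarrow> \<epsilon> < s" "\<epsilon> < 1 - s" "\<epsilon> < e / dist A p"
      using m by linarith+
    have \<tau>: "\<bar>\<tau>\<bar> = 1" "\<tau> * (n \<bullet> (p - A)) > 0" "\<alpha> = 0 \<Longrightarrow> \<tau> = 1"
      using n(3) nvert by (auto simp: \<tau>_def sgn_if)
    define z where "z = x j + (\<epsilon> * \<tau>) *\<^sub>R (p - A)"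
    have "dist (x j) z = \<epsilon> * dist A p"
      using \<epsilon>(1) \<tau>(1) by (simp add: z_def dist_norm abs_mult norm_minus_commute)
    then have "z \<in> ball (x j) e" using \<epsilon>(4) Aqne by (simp add: field_simps)
    moreover have "n \<bullet> (z - x j) > 0" using \<epsilon>(1) \<tau>(2) by (simp add: z_def mult.assoc)
    moreover have "z \<notin> interior t" if "t \<in> T" for t
    proof -
      \<comment> \<open>The point of the original edge \<open>A p\<close> whose translate is
        \<open>z\<close>.\<close>
      define y where "y = A + (s + \<epsilon> * \<tau>) *\<^sub>R (p - A)"
      have "0 < s + \<epsilon> * \<tau>" "s + \<epsilon> * \<tau> < 1"
        using \<epsilon> \<tau>(1,3) s by (cases "\<alpha> = 0"; auto simp: abs_if split: if_splits)+
      then have "y \<in> open_segment A (A + (p - A))"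
        unfolding y_def by (rule in_open_segment_scaleR) (use Aqne in simp)
      then have "y \<in> frontier (\<Union>F)" using frS(1) by (auto simp: S)
      moreover have "z = y + (\<sigma> * real j) *\<^sub>R v"
      proof -
        have "(\<sigma> * real j) *\<^sub>R v = (real j * (\<sigma> * \<alpha>)) *\<^sub>R (p - A) + (real j * (\<sigma> * \<beta>)) *\<^sub>R d"
          by (simp add: v d_def scaleR_add_right mult_ac)
        also have "\<dots> = (- s) *\<^sub>R (p - A) + (real j * \<bar>\<beta>\<bar>) *\<^sub>R d"
          by (simp only: \<sigma>(2,3) s_def) simp
        finally show ?thesis by (simp add: z_def y_def x_def scaleR_add_left)
      qed
      ultimately show ?thesis using translated_frontier_not_interior[OF per F that _ \<sigma>(1)] by simp
    qed
    ultimately show "\<exists>z\<in>ball (x j) e. n \<bullet> (z - x j) > 0 \<and> (\<forall>t\<in>T. z \<notin> interior t)" by blast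
  qed
  have xs: "x j \<in> open_segment A q" if "j \<ge> 1" "real j * \<bar>\<beta>\<bar> < 1" for j
    using in_open_segment_scaleR[of "real j * \<bar>\<beta>\<bar>" d A] that ab d0 by (simp add: x_def d_def)
  have clean: "z \<notin> interior t" if "z \<in> open_segment A q" "t \<in> T" for z t
    using union_frontier_not_interior[OF F that(2)] frS(2) that(1) S by blast
  have sub: "open_segment y z \<subseteq> open_segment A q"
    if "y \<in> closed_segment A q" "z \<in> closed_segment A q" for y z
    using that by (simp add: subset_open_segment)
  \<comment> \<open>The ceiling minus one, not the floor: the last cutting point must lie strictly
    before \<open>q\<close>, also when \<open>1 / \<bar>\<beta>\<bar>\<close> is an integer, so that
    the remainder \<open>\<delta>\<close> is positive.\<close>
  define N where "N = nat (\<lceil>1 / \<bar>\<beta>\<bar>\<rceil> - 1)"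
  have b0: "\<bar>\<beta>\<bar> > 0" using ab by simp
  have "1 / \<bar>\<beta>\<bar> > 2" using small b0 by (simp add: field_simps)
  then have Nr: "real N = real_of_int \<lceil>1 / \<bar>\<beta>\<bar>\<rceil> - 1" and N2: "N \<ge> 2" unfolding N_def by linarith+
  have "real N < 1 / \<bar>\<beta>\<bar>" "1 / \<bar>\<beta>\<bar> \<le> real N + 1" unfolding Nr by linarith+
  then have N: "real N * \<bar>\<beta>\<bar> < 1" "1 \<le> (real N + 1) * \<bar>\<beta>\<bar>" using b0 by (auto simp: field_simps)
  define \<omega> where "\<omega> = \<bar>\<beta>\<bar> * dist A q"
  define \<delta> where "\<delta> = (1 - real N * \<bar>\<beta>\<bar>) * dist A q"
  \<comment> \<open>The length \<open>\<omega>\<close> is measured between the first two cutting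
    points rather than from \<open>A\<close>, because \<open>A\<close> is not known to be a break on
    the side \<open>n\<close>. This is why \<open>2 * \<bar>\<beta>\<bar> < 1\<close> is
    required.\<close>
  have x12: "x 1 \<in> closed_segment A q" "x 2 \<in> closed_segment A q"
    using xs[of 1] xs[of 2] small by (auto intro: open_closed_segment)
  have \<omega>: "\<omega> > 0" using b0 d0 by (simp add: \<omega>_def)
  have x21: "x 2 - x 1 = \<bar>\<beta>\<bar> *\<^sub>R d" by (simp add: x_def flip: scaleR_diff_left)
  have "dist (x 2) (x 1) = \<omega>" unfolding dist_norm x21 using d0 by (simp add: \<omega>_def)
  then have "dist (x 1) (x 2) = \<omega>" by (simp add: dist_commute)
  moreover have "dist (x 1) (x 2) \<in> list_sums L"
  proof (rule distance_of_breaks[OF n(1)])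
    show "n \<bullet> (x 2 - x 1) = 0" unfolding x21 using n(2) by simp
    show "x 1 \<noteq> x 2" using \<omega> calculation by auto
    show "z \<notin> interior t" if "z \<in> open_segment (x 1) (x 2)" "t \<in> T" for z t
      using clean sub[OF x12] that by blast
  qed (use brk small in auto)
  ultimately have "\<omega> \<in> list_sums L" by simp
  have xN: "x N \<in> closed_segment A q" using xs[of N] N N2 by (auto intro: open_closed_segment)
  have qx: "q - x N = (1 - real N * \<bar>\<beta>\<bar>) *\<^sub>R d" by (simp add: x_def d_def algebra_simps)
  have "dist q (x N) = \<delta>" unfolding dist_norm qx using d0 N by (simp add: \<delta>_def)
  then have "dist (x N) q = \<delta>" by (simp add: dist_commute)
  moreover have "\<delta> > 0" using N d0 by (simp add: \<delta>_def)
  moreover have "dist (x N) q \<in> list_sums L"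
  proof (rule distance_of_breaks[OF n(1)])
    show "n \<bullet> (q - x N) = 0" using n(2) by (simp add: qx)
    show "x N \<noteq> q" using calculation by auto
    show "z \<notin> interior t" if "z \<in> open_segment (x N) q" "t \<in> T" for z t
      using clean sub[OF xN] that by auto
  qed (use brk N N2 n in auto)
  ultimately have "\<delta> \<in> list_sums L" by simp
  moreover have "\<delta> \<le> \<omega>"
    unfolding \<delta>_def \<omega>_def using N(2) by (intro mult_right_mono) (auto simp: algebra_simps)
  moreover have "dist A q = real N * \<omega> + \<delta>" by (simp add: \<omega>_def \<delta>_def algebra_simps)
  ultimately show thesis using that[of \<omega> \<delta> N] \<omega> \<open>\<omega> \<in> list_sums L\<close> \<omega>_def by blast
qed

end

section \<open>Supertiles in substitution tilings\<close>

definition patch_union :: "('p \<Rightarrow> complex set) \<Rightarrow> 'p tile_copy set \<Rightarrow> complex set" where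
  "patch_union P X = (\<Union>t\<in>X. support P t)"

definition packing :: "('p \<Rightarrow> complex set) \<Rightarrow> 'p tile_copy set \<Rightarrow> bool" where
  "packing P X \<longleftrightarrow> (\<forall>t\<in>X. is_isometry (snd t)) \<and>
     (\<forall>s\<in>X. \<forall>t\<in>X. s \<noteq> t \<longrightarrow> interior (support P s) \<inter> interior (support P t) = {})"

definition inflate_copy :: "complex \<Rightarrow> (complex \<Rightarrow> complex) \<Rightarrow> complex \<Rightarrow> complex" where
  "inflate_copy \<eta> g w = \<eta> * g (w / \<eta>)"

lemma is_isometry_inflate:
  assumes "\<eta> \<noteq> 0" "is_isometry g" shows "is_isometry (inflate_copy \<eta> g)"
  unfolding is_isometry_def
proof (intro allI)
  fix x y
  have "dist (inflate_copy \<eta> g x) (inflate_copy \<eta> g y) = norm \<eta> * dist (g (x / \<eta>)) (g (y / \<eta>))"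
    by (simp add: inflate_copy_def dist_norm norm_mult flip: right_diff_distrib)
  also have "\<dots> = norm \<eta> * dist (x / \<eta>) (y / \<eta>)" using assms(2) by (simp add: is_isometry_def)
  also have "\<dots> = dist x y"
    using assms(1) by (simp add: dist_norm norm_divide flip: diff_divide_distrib)
  finally show "dist (inflate_copy \<eta> g x) (inflate_copy \<eta> g y) = dist x y" .
qed

lemma is_isometry_comp: "is_isometry g \<Longrightarrow> is_isometry h \<Longrightarrow> is_isometry (g \<circ> h)"
  by (simp add: is_isometry_def)

lemma substitute_iff:
  "t \<in> substitute \<eta> D X \<longleftrightarrow>
    (\<exists>s\<in>X. \<exists>u\<in>D (fst s). t = (fst u, inflate_copy \<eta> (snd s) \<circ> snd u))"
  by (force simp: substitute_def inflate_copy_def comp_def split: prod.splits)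

lemma substitute_UN: "substitute \<eta> D (\<Union>x\<in>X. Y x) = (\<Union>x\<in>X. substitute \<eta> D (Y x))"
  by (simp add: substitute_def)

lemma support_comp: "support P (q, g \<circ> h) = g ` support P (q, h)"
  by (simp add: support_def image_comp)

lemma inflate_copy_image:
  "\<eta> \<noteq> 0 \<Longrightarrow> inflate_copy \<eta> (snd s) ` (*) \<eta> ` P (fst s) = (*) \<eta> ` support P s"
  by (simp add: image_image inflate_copy_def support_def)

locale substitution =
  fixes \<eta> :: complex and P :: "'p::finite \<Rightarrow> complex set" and D :: "'p \<Rightarrow> 'p tile_copy set"
  assumes subst: "is_substitution \<eta> P D"
begin

lemma eta: "norm \<eta> > 1" "\<eta> \<noteq> 0"
  using subst by (auto simp: is_substitution_def)

lemma prototile: "is_tile (P p)" "polygonal (P p)"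
  using subst by (auto simp: is_substitution_def)

lemma prototile_closed: "compact (P p)" "closed (P p)" "closure (interior (P p)) = P p" "P p \<noteq> {}"
  using prototile(1)[of p] by (auto simp: is_tile_def compact_imp_closed)

lemma dissection: "finite (D p)" "patch_union P (D p) = (*) \<eta> ` P p" "packing P (D p)"
  using subst by (auto simp: is_substitution_def patch_union_def packing_def)

lemma finite_prototile_vertices: "finite (vertices (P p))"
  using finite_vertices[OF prototile_closed(2,3) prototile(2)] .

lemma patch_union_substitute: "patch_union P (substitute \<eta> D X) = (*) \<eta> ` patch_union P X"
proof -
  have "patch_union P (substitute \<eta> D X) =
      (\<Union>s\<in>X. \<Union>u\<in>D (fst s). support P (fst u, inflate_copy \<eta> (snd s) \<circ> snd u))"
    unfolding patch_union_def set_eq_iff UN_iff Bex_def substitute_iff by blast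
  also have "\<dots> = (\<Union>s\<in>X. inflate_copy \<eta> (snd s) ` patch_union P (D (fst s)))"
    by (simp add: support_comp patch_union_def image_UN)
  also have "\<dots> = (\<Union>s\<in>X. (*) \<eta> ` support P s)"
    unfolding dissection(2) inflate_copy_image[OF eta(2)] ..
  finally show ?thesis by (simp add: patch_union_def image_UN)
qed

text \<open>Tiles from the same expanded copy are separated by the dissection, tiles from different
  copies by the disjoint interiors of the expanded copies.\<close>

lemma packing_substitute:
  assumes X: "packing P X" shows "packing P (substitute \<eta> D X)"
  unfolding packing_def
proof (intro conjI ballI impI)
  fix t assume "t \<in> substitute \<eta> D X"
  then obtain s u where su: "s \<in> X" "u \<in> D (fst s)" "t = (fst u, inflate_copy \<eta> (snd s) \<circ> snd u)"
    by (auto simp: substitute_iff)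
  have "is_isometry (snd s)" "is_isometry (snd u)"
    using X dissection(3)[of "fst s"] su by (auto simp: packing_def)
  then show "is_isometry (snd t)" by (simp add: su is_isometry_comp is_isometry_inflate[OF eta(2)])
next
  fix t t' assume tt: "t \<in> substitute \<eta> D X" "t' \<in> substitute \<eta> D X" "t \<noteq> t'"
  obtain s u where su: "s \<in> X" "u \<in> D (fst s)" "t = (fst u, inflate_copy \<eta> (snd s) \<circ> snd u)"
    using tt(1) by (auto simp: substitute_iff)
  obtain s' u' where su': "s' \<in> X" "u' \<in> D (fst s')" "t' = (fst u', inflate_copy \<eta> (snd s') \<circ> snd u')"
    using tt(2) by (auto simp: substitute_iff)
  have sim: "similarity 1 (inflate_copy \<eta> (snd s))" if "s \<in> X" for s
    using X that by (intro similarity_isometry is_isometry_inflate eta(2)) (simp add: packing_def)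
  have sup: "support P t = inflate_copy \<eta> (snd s) ` support P u"
    "support P t' = inflate_copy \<eta> (snd s') ` support P u'"
    using su(3) su'(3) by (simp_all add: support_comp)
  show "interior (support P t) \<inter> interior (support P t') = {}"
  proof (cases "s = s'")
    case True
    then have "u \<noteq> u'" using tt(3) su su' by auto
    then have "interior (support P u) \<inter> interior (support P u') = {}"
      using dissection(3)[of "fst s"] su su' True by (auto simp: packing_def)
    then show ?thesis
      unfolding sup True[symmetric] similarity_interior[OF sim[OF su(1)]]
      by (simp add: image_Int[OF similarity_inj[OF sim[OF su(1)]], symmetric])
  next
    case False
    have sub: "support P t \<subseteq> (*) \<eta> ` support P s"
      if "s \<in> X" "u \<in> D (fst s)" "support P t = inflate_copy \<eta> (snd s) ` support P u" for s u t
    proof -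
      have "support P u \<subseteq> (*) \<eta> ` P (fst s)" using dissection(2)[of "fst s"] that by (auto simp: patch_union_def)
      then show ?thesis unfolding that(3) inflate_copy_image[OF eta(2), of s P, symmetric] by (rule image_mono)
    qed
    have "interior (support P s) \<inter> interior (support P s') = {}" using X False su su' by (auto simp: packing_def)
    then have "interior ((*) \<eta> ` support P s) \<inter> interior ((*) \<eta> ` support P s') = {}"
      using similarity_mult[OF eta(2)]
      by (simp add: similarity_interior image_Int[OF similarity_inj, symmetric])
    then show ?thesis
      using interior_mono[OF sub[OF su(1,2) sup(1)]] interior_mono[OF sub[OF su'(1,2) sup(2)]] by blast
  qed
qed

lemma iterate:
  assumes "packing P X"
  shows "packing P ((substitute \<eta> D ^^ m) X)"
    "patch_union P ((substitute \<eta> D ^^ m) X) = (*) (\<eta> ^ m) ` patch_union P X"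
proof (induction m)
  case (Suc m)
  show "packing P ((substitute \<eta> D ^^ Suc m) X)" using packing_substitute[OF Suc(1)] by simp
  show "patch_union P ((substitute \<eta> D ^^ Suc m) X) = (*) (\<eta> ^ Suc m) ` patch_union P X"
    by (simp add: patch_union_substitute Suc(2) image_image mult.assoc)
qed (use assms in auto)

text \<open>Substitution acts copy by copy, so an iterate splits into the supertiles of its
  individual copies.\<close>

lemma iterate_singletons: "(substitute \<eta> D ^^ m) X = (\<Union>x\<in>X. (substitute \<eta> D ^^ m) {x})"
proof (induction m)
  case (Suc m)
  have "(substitute \<eta> D ^^ Suc m) X = substitute \<eta> D (\<Union>x\<in>X. (substitute \<eta> D ^^ m) {x})"
    using Suc by simp
  also have "\<dots> = (\<Union>x\<in>X. substitute \<eta> D ((substitute \<eta> D ^^ m) {x}))"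
    by (rule substitute_UN)
  finally show ?case by simp
qed simp

lemma packing_singleton: "is_isometry (snd x) \<Longrightarrow> packing P {x}"
  by (simp add: packing_def)

lemma diameter_bound:
  obtains \<Delta> where "\<Delta> > 0" "\<And>p x y. x \<in> P p \<Longrightarrow> y \<in> P p \<Longrightarrow> dist x y \<le> \<Delta>"
proof -
  define \<Delta> where "\<Delta> = (\<Sum>p\<in>UNIV. diameter (P p)) + 1"
  have b: "bounded (P p)" for p using prototile_closed(1) by (rule compact_imp_bounded)
  have le: "diameter (P p) \<le> (\<Sum>p\<in>UNIV. diameter (P p))" for p
    by (rule member_le_sum) (auto intro: diameter_ge_0 b)
  show thesis
  proof (rule that[of \<Delta>])
    show "\<Delta> > 0" unfolding \<Delta>_def by (intro add_nonneg_pos sum_nonneg diameter_ge_0 b) simp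
    show "dist x y \<le> \<Delta>" if "x \<in> P p" "y \<in> P p" for p x y
      using diameter_bounded_bound[OF b that] le[of p] by (simp add: \<Delta>_def)
  qed
qed

text \<open>Finitely many prototiles share an inradius \<open>\<rho>\<close> and a diameter bound
  \<open>\<Delta>\<close>. Centres of inscribed discs of different tiles are
  \<open>\<rho>\<close>-separated, and those of tiles meeting a disc are bounded, so there are
  finitely many.\<close>

lemma locally_finite_copies:
  assumes T: "is_tiling T" and copies: "\<forall>t\<in>T. \<exists>p g. is_isometry g \<and> t = support P (p, g)"
  shows "finite {t \<in> T. t \<inter> ball 0 r \<noteq> {}}"
proof -
  obtain \<Delta> where \<Delta>: "\<Delta> > 0" "\<And>p x y. x \<in> P p \<Longrightarrow> y \<in> P p \<Longrightarrow> dist x y \<le> \<Delta>"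
    using diameter_bound by blast
  have "\<exists>c e. e > 0 \<and> ball c e \<subseteq> P p" for p
  proof -
    have "interior (P p) \<noteq> {}" using prototile_closed(3,4)[of p] by auto
    then show ?thesis by (meson all_not_in_conv mem_interior)
  qed
  then obtain c e where ce: "\<And>p. e p > 0 \<and> ball (c p) (e p) \<subseteq> P p" by metis
  define \<rho> where "\<rho> = Min (range e)"
  have \<rho>: "\<rho> > 0" "\<And>p. \<rho> \<le> e p" using ce by (auto simp: \<rho>_def)
  let ?N = "{t \<in> T. t \<inter> ball 0 r \<noteq> {}}"
  have "\<exists>z. ball z \<rho> \<subseteq> t \<and> (\<forall>x\<in>t. dist x z \<le> \<Delta>)" if "t \<in> T" for t
  proof -
    obtain p g where "is_isometry g" "t = support P (p, g)" using copies \<open>t \<in> T\<close> by blast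
    then have g: "is_isometry g" "t = g ` P p" by (simp_all add: support_def)
    have "ball (c p) \<rho> \<subseteq> ball (c p) (e p)" using \<rho>(2)[of p] by auto
    then have "ball (c p) \<rho> \<subseteq> P p" using ce[of p] by blast
    then have "g ` ball (c p) \<rho> \<subseteq> t" unfolding g(2) by (rule image_mono)
    then have "ball (g (c p)) \<rho> \<subseteq> t" using similarity_ball[OF similarity_isometry[OF g(1)]] by simp
    moreover have "c p \<in> P p" using ce[of p] by auto
    then have "\<forall>x\<in>t. dist x (g (c p)) \<le> \<Delta>" using g \<Delta>(2) by (auto simp: is_isometry_def)
    ultimately show ?thesis by blast
  qed
  then obtain C where C: "\<And>t. t \<in> T \<Longrightarrow> ball (C t) \<rho> \<subseteq> t" "\<And>t x. t \<in> T \<Longrightarrow> x \<in> t \<Longrightarrow> dist x (C t) \<le> \<Delta>"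
    by metis
  have sep: "dist (C s) (C t) \<ge> \<rho>" if st: "s \<in> T" "t \<in> T" "s \<noteq> t" for s t
  proof (rule ccontr)
    assume "\<not> ?thesis"
    then have "C t \<in> ball (C s) \<rho>" by simp
    then have "C t \<in> interior s" using C(1)[OF st(1)] interior_maximal[OF _ open_ball] by blast
    moreover have "C t \<in> interior t"
      using C(1)[OF st(2)] interior_maximal[OF _ open_ball] \<rho>(1) centre_in_ball by blast
    ultimately show False using T st unfolding is_tiling_def by blast
  qed
  have "uniform_discrete (C ` ?N)"
    unfolding uniform_discrete_def
  proof (intro exI[of _ \<rho>] conjI ballI impI \<rho>(1))
    fix x y assume xy: "x \<in> C ` ?N" "y \<in> C ` ?N" "dist x y < \<rho>"
    then obtain s t where st: "s \<in> ?N" "t \<in> ?N" "x = C s" "y = C t" by blast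
    then have "s = t" using sep[of s t] xy(3) by force
    then show "x = y" using st by simp
  qed
  moreover have "bounded (C ` ?N)"
  proof (rule bounded_subset[OF bounded_ball], rule subsetI)
    fix x assume "x \<in> C ` ?N"
    then obtain t where "t \<in> ?N" "x = C t" by blast
    then obtain z where t: "t \<in> T" "z \<in> t" "norm z < r" "x = C t" by auto
    have "norm x \<le> norm z + dist z x" using norm_triangle_sub[of x z] by (simp add: dist_norm norm_minus_commute)
    then show "x \<in> ball 0 (r + \<Delta>)" using t C(2)[OF t(1,2)] by simp
  qed
  ultimately have "finite (C ` ?N)" using uniform_discrete_finite_iff by blast
  moreover have "inj_on C ?N"
  proof (rule inj_onI)
    fix s t assume "s \<in> ?N" "t \<in> ?N" "C s = C t"
    then show "s = t" using sep[of s t] \<rho>(1) by force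
  qed
  ultimately show ?thesis by (rule finite_imageD)
qed

text \<open>The patch of all tiles meeting a large disc is found in some iterate. The
  level-\<open>k\<close> supertile of the iterate around the image of the centre fits into the image
  disc, so it consists of images of tiles of \<open>T\<close> and can be pulled back.\<close>

lemma supertile_in_tiling:
  assumes "is_substitution_tiling \<eta> P D T"
  obtains F p f where "finite F" "F \<subseteq> T" "similarity (norm \<eta> ^ k) f" "\<Union>F = f ` P p"
proof -
  note intro = that
  have T: "is_tiling T" and copies: "\<forall>t\<in>T. \<exists>p g. is_isometry g \<and> t = support P (p, g)"
    and patches: "\<And>F. is_patch F T \<Longrightarrow> \<exists>p m f. is_isometry f \<and>
      (\<lambda>t. f ` t) ` F \<subseteq> support P ` iterate_substitution \<eta> D m p"
    using assms by (auto simp: is_substitution_tiling_def)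
  obtain \<Delta> where \<Delta>: "\<Delta> > 0" "\<And>p x y. x \<in> P p \<Longrightarrow> y \<in> P p \<Longrightarrow> dist x y \<le> \<Delta>"
    using diameter_bound by blast
  define \<theta> where "\<theta> = norm \<eta>"
  have \<theta>: "\<theta> > 1" using eta by (simp add: \<theta>_def)
  \<comment> \<open>Larger than the diameter of every level-\<open>k\<close> supertile.\<close>
  define \<rho> where "\<rho> = \<theta> ^ k * \<Delta> + 1"
  have \<rho>: "\<rho> > 0" using \<theta> \<Delta> by (simp add: \<rho>_def add_nonneg_pos)
  define F0 where "F0 = {t \<in> T. t \<inter> ball 0 \<rho> \<noteq> {}}"
  have F0: "finite F0" "F0 \<subseteq> T" unfolding F0_def using locally_finite_copies[OF T copies] by auto
  obtain p m f where f: "is_isometry f"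
    and fF: "(\<lambda>t. f ` t) ` F0 \<subseteq> support P ` iterate_substitution \<eta> D m p"
    using patches[of F0] F0 by (auto simp: is_patch_def)
  have fs: "similarity 1 f" using f by (rule similarity_isometry)
  define x0 :: "'p tile_copy" where "x0 = (p, \<lambda>z. z)"
  define X where "X = (substitute \<eta> D ^^ m) {x0}"
  have fX: "(\<lambda>t. f ` t) ` F0 \<subseteq> support P ` X" using fF by (simp add: iterate_substitution_def X_def x0_def)
  have pk0: "packing P {x0}" by (rule packing_singleton) (simp add: x0_def is_isometry_def)
  have X: "packing P X" "patch_union P X = (*) (\<eta> ^ m) ` P p"
    using iterate[OF pk0] by (auto simp: X_def patch_union_def support_def x0_def)
  have "ball 0 \<rho> \<subseteq> \<Union>F0"
  proof
    fix z :: complex assume z: "z \<in> ball 0 \<rho>"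
    have "z \<in> \<Union>T" using T by (simp add: is_tiling_def)
    then obtain t where "t \<in> T" "z \<in> t" by blast
    then have "t \<in> F0" unfolding F0_def using z by blast
    then show "z \<in> \<Union>F0" using \<open>z \<in> t\<close> by blast
  qed
  then have "f ` ball 0 \<rho> \<subseteq> f ` \<Union>F0" by (rule image_mono)
  then have ballF: "ball (f 0) \<rho> \<subseteq> \<Union>((\<lambda>t. f ` t) ` F0)"
    by (simp add: similarity_ball[OF fs] image_Union)
  note ballF
  also have "\<Union>((\<lambda>t. f ` t) ` F0) \<subseteq> \<Union>(support P ` X)" using fX by (rule Union_mono)
  finally have ballX: "ball (f 0) \<rho> \<subseteq> patch_union P X" unfolding patch_union_def .
  have "k \<le> m"
  proof (rule ccontr)
    assume "\<not> k \<le> m"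
    \<comment> \<open>A distance realised inside the disc of radius \<open>\<rho>\<close> but
      exceeding the diameter of any iterate of level below \<open>k\<close>.\<close>
    define c where "c = \<theta> ^ k * \<Delta> + 1 / 2"
    define y where "y = f 0 + of_real c"
    have "c > 0" using \<theta> \<Delta> by (simp add: c_def add_nonneg_pos)
    then have "dist (f 0) y = c" by (simp add: y_def dist_norm)
    then have d: "dist (f 0) y = \<theta> ^ k * \<Delta> + 1 / 2" by (simp add: c_def)
    then have "y \<in> patch_union P X" "f 0 \<in> patch_union P X" using ballX \<rho> by (auto simp: \<rho>_def)
    then obtain a b where ab: "a \<in> P p" "b \<in> P p" "f 0 = \<eta> ^ m * a" "y = \<eta> ^ m * b" by (auto simp: X)
    have "dist (f 0) y = \<theta> ^ m * dist a b"
      by (simp add: ab dist_norm \<theta>_def norm_mult norm_power flip: right_diff_distrib)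
    also have "\<dots> \<le> \<theta> ^ m * \<Delta>" using \<Delta>(2)[OF ab(1,2)] \<theta> by (simp add: mult_left_mono)
    also have "\<dots> \<le> \<theta> ^ k * \<Delta>"
      using \<theta> \<Delta> \<open>\<not> k \<le> m\<close> by (intro mult_right_mono power_increasing) auto
    finally show False by (simp add: d)
  qed
  define Y where "Y = (substitute \<eta> D ^^ (m - k)) {x0}"
  have dec: "(substitute \<eta> D ^^ m) {x0} = (substitute \<eta> D ^^ k) Y"
    using \<open>k \<le> m\<close> funpow_add[of k "m - k" "substitute \<eta> D"] by (simp add: Y_def)
  have XY: "X = (\<Union>y\<in>Y. (substitute \<eta> D ^^ k) {y})" unfolding X_def dec by (rule iterate_singletons)
  have Y: "packing P Y" using iterate(1)[OF pk0] by (simp add: Y_def)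
  have "f 0 \<in> patch_union P X" using ballX \<rho> by auto
  then obtain y where y: "y \<in> Y" "f 0 \<in> patch_union P ((substitute \<eta> D ^^ k) {y})"
    by (auto simp: XY patch_union_def)
  define B where "B = (substitute \<eta> D ^^ k) {y}"
  have BX: "B \<subseteq> X" using y by (auto simp: XY B_def)
  have isoy: "is_isometry (snd y)" using Y y by (simp add: packing_def)
  define g where "g = (*) (\<eta> ^ k) \<circ> snd y"
  have "similarity (norm (\<eta> ^ k) * 1) g"
    unfolding g_def by (intro similarity_comp similarity_mult similarity_isometry isoy) (simp add: eta)
  then have g: "similarity (\<theta> ^ k) g" by (simp add: \<theta>_def norm_power)
  have Bu: "patch_union P B = g ` P (fst y)"
    using iterate(2)[OF packing_singleton[OF isoy], of k]
    by (simp add: B_def g_def patch_union_def support_def image_comp)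
  have Bball: "patch_union P B \<subseteq> ball (f 0) \<rho>"
  proof
    fix w assume "w \<in> patch_union P B"
    then obtain a b where ab: "a \<in> P (fst y)" "b \<in> P (fst y)" "w = g a" "f 0 = g b"
      using y(2) Bu by (auto simp: B_def)
    have "dist (f 0) w \<le> \<theta> ^ k * \<Delta>"
      using \<Delta>(2)[OF ab(2,1)] \<theta> by (simp add: ab similarity_dist[OF g] mult_left_mono)
    then show "w \<in> ball (f 0) \<rho>" by (simp add: \<rho>_def)
  qed
  have tileX: "is_tile (support P \<tau>)" if "\<tau> \<in> X" for \<tau>
    using similarity_is_tile[OF similarity_isometry prototile(1)] X(1) that
    by (auto simp: support_def packing_def)
  \<comment> \<open>An interior point of the supertile's tile \<open>\<tau>\<close> is covered by
    the image of some tile of \<open>T\<close>. That image is also a tile of the iterate, and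
    disjointness of interiors identifies it with \<open>\<tau>\<close>.\<close>
  have inF: "support P \<tau> \<in> (\<lambda>t. f ` t) ` F0" if \<tau>: "\<tau> \<in> B" for \<tau>
  proof -
    have \<tau>X: "\<tau> \<in> X" using \<tau> BX by blast
    have "interior (support P \<tau>) \<noteq> {}" using tileX[OF \<tau>X] by (auto simp: is_tile_def)
    then obtain z where z: "z \<in> interior (support P \<tau>)" by blast
    then have "z \<in> patch_union P B" using \<tau> interior_subset by (force simp: patch_union_def)
    then obtain t where t: "t \<in> F0" "z \<in> f ` t" using Bball ballF by blast
    obtain \<tau>' where \<tau>': "\<tau>' \<in> X" "f ` t = support P \<tau>'" using fX t(1) by blast
    have "\<tau>' = \<tau>"
    proof (rule ccontr)
      assume "\<tau>' \<noteq> \<tau>"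
      then have "interior (support P \<tau>) \<inter> interior (support P \<tau>') = {}"
        using X(1) \<tau>X \<tau>'(1) unfolding packing_def by blast
      then have "interior (support P \<tau>) \<inter> closure (interior (support P \<tau>')) = {}"
        by (simp add: open_Int_closure_eq_empty)
      moreover have "closure (interior (support P \<tau>')) = support P \<tau>'"
        using tileX[OF \<tau>'(1)] by (simp add: is_tile_def)
      ultimately show False using z t(2) \<tau>'(2) by blast
    qed
    then show ?thesis using t(1) \<tau>'(2) by blast
  qed
  define F where "F = {t \<in> F0. f ` t \<in> support P ` B}"
  have "f ` \<Union>F = patch_union P B"
  proof -
    have "(\<lambda>t. f ` t) ` F = support P ` B"
    proof
      show "support P ` B \<subseteq> (\<lambda>t. f ` t) ` F"
      proof
        fix u assume "u \<in> support P ` B"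
        moreover from this obtain t where "t \<in> F0" "u = f ` t" using inF by blast
        ultimately show "u \<in> (\<lambda>t. f ` t) ` F" by (auto simp: F_def)
      qed
    qed (auto simp: F_def)
    then show ?thesis unfolding patch_union_def image_Union by simp
  qed
  then have "inv f ` f ` \<Union>F = inv f ` g ` P (fst y)" by (simp add: Bu)
  moreover have "inv f ` f ` \<Union>F = \<Union>F" by (rule image_inv_f_f[OF similarity_inj[OF fs]])
  ultimately have "\<Union>F = (inv f \<circ> g) ` P (fst y)" by (simp only: image_comp)
  moreover have "similarity (norm \<eta> ^ k) (inv f \<circ> g)"
    using similarity_comp[OF similarity_inv[OF fs] g] by (simp add: \<theta>_def)
  moreover have "finite F" "F \<subseteq> T" using F0 by (auto simp: F_def)
  ultimately show thesis using intro by blast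
qed

end

section \<open>Area\<close>

lemma ex_2: "(\<exists>i::2. Q i) \<longleftrightarrow> Q 1 \<or> Q 2"
  by (metis exhaust_2)

text \<open>The bridge to \<open>real ^ 2\<close>, where orthogonal maps are known to preserve
  measure.\<close>

definition complex_of_vec :: "real ^ 2 \<Rightarrow> complex" where
  "complex_of_vec x = Complex (x $ 1) (x $ 2)"

lemma complex_of_vec:
  shows "linear complex_of_vec" "bij complex_of_vec" "norm (complex_of_vec x) = norm x"
    and "dist (complex_of_vec x) (complex_of_vec y) = dist x y"
    and "K \<in> sets borel \<Longrightarrow> measure lebesgue (complex_of_vec -` K) = measure lebesgue K"
proof -
  let ?\<phi> = complex_of_vec
  note \<phi>_def = complex_of_vec_def
  show lin: "linear ?\<phi>" by (rule linearI) (auto simp: \<phi>_def complex_eq_iff)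
  show "bij ?\<phi>"
    by (rule o_bij[of "\<lambda>z. vector [Re z, Im z]"])
      (auto simp: \<phi>_def fun_eq_iff vec_eq_iff forall_2 vector_2)
  show n: "norm (?\<phi> x) = norm x" for x
    by (simp add: \<phi>_def norm_vec_def L2_set_def sum_2 cmod_def)
  show "dist (?\<phi> x) (?\<phi> y) = dist x y" using n[of "x - y"] linear_diff[OF lin] by (simp add: dist_norm)
  have m: "?\<phi> \<in> borel_measurable borel"
    using linear_continuous_on[OF linear_linear[THEN iffD2, OF lin]] by (rule borel_measurable_continuous_onI)
  \<comment> \<open>Lebesgue measure is determined by its values on boxes, and boxes correspond to
    boxes under the identification.\<close>
  have eq: "(lborel :: complex measure) = distr lborel borel ?\<phi>"
  proof (rule lborel_eqI)
    fix l u :: complex assume "\<And>b. b \<in> Basis \<Longrightarrow> l \<bullet> b \<le> u \<bullet> b"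
    from this[of 1] this[of \<i>] have lu: "Re l \<le> Re u" "Im l \<le> Im u"
      by (auto simp: Basis_complex_def inner_complex_def)
    have "?\<phi> -` box l u = box (vector [Re l, Im l]) (vector [Re u, Im u])"
      by (auto simp: \<phi>_def box_def Basis_complex_def Basis_vec_def inner_axis ex_2 forall_2 vector_2)
    then have "emeasure (distr lborel borel ?\<phi>) (box l u)
        = emeasure lborel (box (vector [Re l, Im l]) (vector [Re u, Im u]) :: (real^2) set)"
      using m by (simp add: emeasure_distr)
    also have "\<dots> = ennreal (\<Prod>b\<in>Basis. (vector [Re u, Im u] - vector [Re l, Im l] :: real^2) \<bullet> b)"
      by (rule emeasure_lborel_box) (use lu in \<open>auto simp: Basis_vec_def inner_axis ex_2 vector_2\<close>)
    also have "(\<Prod>b\<in>Basis. (vector [Re u, Im u] - vector [Re l, Im l] :: real^2) \<bullet> b)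
        = (\<Prod>i\<in>UNIV. (vector [Re u, Im u] - vector [Re l, Im l] :: real^2) $ i)"
      by (subst prod.reindex_cong[of "\<lambda>i. axis i 1" UNIV])
        (auto simp: Basis_vec_def inj_on_def axis_eq_axis inner_axis)
    also have "\<dots> = (\<Prod>b\<in>Basis. (u - l) \<bullet> b)"
      by (simp add: UNIV_2 vector_2 Basis_complex_def)
    finally show "emeasure (distr lborel borel ?\<phi>) (box l u) = ennreal (\<Prod>b\<in>Basis. (u - l) \<bullet> b)" .
  qed simp
  assume K: "K \<in> sets borel"
  have "measure lebesgue K = measure (distr lborel borel ?\<phi>) K"
    using K by (simp add: measure_completion flip: eq)
  also have "\<dots> = measure lborel (?\<phi> -` K)" using K m by (simp add: measure_distr)
  also have "\<dots> = measure lebesgue (?\<phi> -` K)"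
    using measurable_sets[OF m K] by (simp add: measure_completion)
  finally show "measure lebesgue (?\<phi> -` K) = measure lebesgue K" ..
qed

lemma area_isometry:
  assumes "is_isometry g" "compact K" shows "area (g ` K) = area K"
proof -
  let ?\<phi> = complex_of_vec
  note \<phi> = complex_of_vec
  define h where "h z = g z - g 0" for z
  define f where "f = inv ?\<phi> \<circ> h \<circ> ?\<phi>"
  have inv: "?\<phi> (inv ?\<phi> z) = z" "inv ?\<phi> (?\<phi> x) = x" for z x
    using \<phi>(2) by (auto simp: bij_def surj_f_inv_f)
  have dinv: "dist (inv ?\<phi> z) (inv ?\<phi> w) = dist z w" for z w using \<phi>(4)[of "inv ?\<phi> z" "inv ?\<phi> w"] by (simp add: inv)
  have "f 0 = 0"
  proof -
    have "?\<phi> 0 = 0" by (rule linear_0[OF \<phi>(1)])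
    then show ?thesis using inv(2)[of 0] by (simp add: f_def h_def)
  qed
  moreover have "dist (f x) (f y) = dist x y" for x y
    using assms(1) \<phi>(4) by (simp add: f_def dinv) (simp add: h_def dist_norm is_isometry_def)
  ultimately have f: "orthogonal_transformation f" by (simp add: orthogonal_transformation_isometry)
  have cont: "continuous_on UNIV h"
    using similarity_continuous[OF similarity_isometry[OF assms(1)]]
    unfolding h_def by (intro continuous_intros) 
  have hK: "compact (h ` K)" by (rule compact_continuous_image[OF continuous_on_subset[OF cont] assms(2)]) simp
  have vim: "?\<phi> -` S = inv ?\<phi> ` S" for S using \<phi>(2) by (rule bij_vimage_eq_inv_image)
  have "continuous_on UNIV (inv ?\<phi>)"
    by (rule lipschitz_on_continuous_on[of 1]) (simp add: lipschitz_on_def dinv)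
  then have "compact (inv ?\<phi> ` K)" using compact_continuous_image[OF continuous_on_subset assms(2)] by blast
  then have lm: "inv ?\<phi> ` K \<in> lmeasurable" by (rule lmeasurable_compact)
  have "area (g ` K) = measure lebesgue ((+) (g 0) ` h ` K)"
    by (simp add: area_def image_image h_def)
  also have "\<dots> = measure lebesgue (h ` K)" by (rule measure_translation)
  also have "\<dots> = measure lebesgue (inv ?\<phi> ` h ` K)"
    using \<phi>(5)[of "h ` K"] hK by (simp add: vim borel_compact)
  also have "inv ?\<phi> ` h ` K = f ` inv ?\<phi> ` K" by (simp add: f_def image_image inv)
  also have "measure lebesgue (f ` inv ?\<phi> ` K) = measure lebesgue (inv ?\<phi> ` K)"
    by (rule measure_orthogonal_image[OF f lm])
  also have "\<dots> = area K" using \<phi>(5)[of K] assms(2) by (simp add: vim borel_compact area_def)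
  finally show ?thesis .
qed

lemma area_mult:
  assumes "\<eta> \<noteq> 0" "compact K" shows "area ((*) \<eta> ` K) = (norm \<eta>)\<^sup>2 * area K"
proof -
  define u where "u = \<eta> / of_real (norm \<eta>)"
  have "norm u = 1" using assms by (simp add: u_def norm_divide)
  then have iso: "is_isometry ((*) u)"
    by (simp add: is_isometry_def dist_norm norm_mult flip: right_diff_distrib)
  have "\<eta> * z = norm \<eta> *\<^sub>R (u * z)" for z using assms by (simp add: u_def scaleR_conv_of_real)
  then have "(*) \<eta> ` K = (\<lambda>x. norm \<eta> *\<^sub>R x + 0) ` (*) u ` K" by (simp add: image_image)
  then have "area ((*) \<eta> ` K) = \<bar>norm \<eta>\<bar> ^ DIM(complex) * area ((*) u ` K)"
    unfolding area_def using measure_lebesgue_affine[of "norm \<eta>" 0 "(*) u ` K"] by simp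
  then show ?thesis by (simp add: area_isometry[OF iso assms(2)])
qed

lemma negligible_polygonal_frontier:
  assumes "polygonal K" shows "negligible (frontier K)"
proof -
  obtain E where E: "finite E" "frontier K \<subseteq> (\<Union>(a, b)\<in>E. closed_segment a b)"
    using assms by (auto simp: polygonal_def)
  have "negligible (closed_segment a b)" for a b :: complex
  proof (cases "a = b")
    case False
    have "closed_segment a b \<subseteq> {z. (\<i> * (b - a)) \<bullet> z = (\<i> * (b - a)) \<bullet> a}"
    proof
      fix z assume "z \<in> closed_segment a b"
      then obtain s where "z - a = s *\<^sub>R (b - a)" using segment_diff[of a a b z] by auto
      then have "cross (b - a) (z - a) = 0" by (metis cross_scale(2) cross_self(1) mult_zero_right)
      then show "z \<in> {z. (\<i> * (b - a)) \<bullet> z = (\<i> * (b - a)) \<bullet> a}"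
        by (simp add: cross_inner inner_diff_right)
    qed
    moreover have "\<i> * (b - a) \<noteq> 0" using False by simp
    ultimately show ?thesis using negligible_hyperplane negligible_subset by metis
  qed simp
  then have "negligible (\<Union>(a, b)\<in>E. closed_segment a b)" using E(1) by (intro negligible_Union) auto
  then show ?thesis using E(2) negligible_subset by blast
qed

section \<open>The class matrix and its eigenvector\<close>

context substitution
begin

lemma support_compact:
  assumes "t \<in> D p" shows "compact (support P t)"
proof -
  have "similarity 1 (snd t)" using dissection(3)[of p] assms by (simp add: packing_def similarity_isometry)
  then show ?thesis using similarity_is_tile[OF _ prototile(1)] by (simp add: support_def is_tile_def)
qed

lemma negligible_support_frontier:
  assumes "t \<in> D p" shows "negligible (frontier (support P t))"
proof -
  let ?g = "snd t"
  have iso: "is_isometry ?g" using dissection(3)[of p] assms by (simp add: packing_def)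
  have fr: "compact (frontier (P (fst t)))" using prototile_closed(1) by (rule compact_frontier)
  have "measure lebesgue (frontier (P (fst t))) = 0"
    using negligible_polygonal_frontier[OF prototile(2)] by (rule negligible_imp_measure0)
  then have "measure lebesgue (?g ` frontier (P (fst t))) = 0"
    using area_isometry[OF iso fr] by (simp add: area_def)
  moreover have "frontier (support P t) = ?g ` frontier (P (fst t))"
    by (simp add: support_def similarity_frontier[OF similarity_isometry[OF iso]])
  moreover have "frontier (support P t) \<in> lmeasurable"
    using support_compact[OF assms] by (intro lmeasurable_compact compact_frontier)
  ultimately show ?thesis by (simp add: negligible_iff_measure0)
qed

text \<open>Tiles with disjoint interiors overlap only in their frontiers, which are null sets
  because they lie in finitely many segments. So areas are additive over the dissection.\<close>

lemma area_dissection: "(norm \<eta>)\<^sup>2 * area (P p) = (\<Sum>t\<in>D p. area (P (fst t)))"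
proof -
  have "(norm \<eta>)\<^sup>2 * area (P p) = measure lebesgue (\<Union>(support P ` D p))"
    using area_mult[OF eta(2) prototile_closed(1), of p] dissection(2)[of p]
    by (simp add: patch_union_def area_def)
  also have "\<dots> = (\<Sum>t\<in>D p. measure lebesgue (support P t))"
  proof (rule measure_negligible_finite_Union_image)
    show "pairwise (\<lambda>s t. negligible (support P s \<inter> support P t)) (D p)"
    proof (rule pairwiseI)
      fix s t assume st: "s \<in> D p" "t \<in> D p" "s \<noteq> t"
      have "interior (support P s) \<inter> interior (support P t) = {}"
        using dissection(3)[of p] st by (simp add: packing_def)
      then have "support P s \<inter> support P t \<subseteq> frontier (support P s) \<union> frontier (support P t)"
        using closure_subset by (fastforce simp: frontier_def)
      then show "negligible (support P s \<inter> support P t)"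
        by (rule negligible_subset[OF negligible_Un[OF negligible_support_frontier[OF st(1)]
          negligible_support_frontier[OF st(2)]]])
    qed
  qed (use dissection(1) support_compact in \<open>auto intro: lmeasurable_compact\<close>)
  also have "\<dots> = (\<Sum>t\<in>D p. area (P (fst t)))"
  proof (rule sum.cong)
    fix t assume "t \<in> D p"
    then have "is_isometry (snd t)" using dissection(3)[of p] by (simp add: packing_def)
    then show "measure lebesgue (support P t) = area (P (fst t))"
      using area_isometry[OF _ prototile_closed(1)] by (simp add: support_def area_def)
  qed simp
  finally show ?thesis .
qed

end

text \<open>The bound \<open>n div 2\<close> keeps the angles in the range up to
  \<open>pi / 2\<close>, where the sine is injective; hence every prototile has exactly one
  class.\<close>

lemma sin_index_inj:
  assumes "n > 0" "i \<in> {1..n div 2}" "j \<in> {1..n div 2}" "sin (real i * pi / real n) = sin (real j * pi / real n)"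
  shows "i = j"
proof -
  have le: "2 * real k \<le> real n" if "k \<in> {1..n div 2}" for k
    using that by (auto simp flip: of_nat_mult of_nat_le_iff)
  have bnd: "- (pi / 2) \<le> real k * pi / real n \<and> real k * pi / real n \<le> pi / 2" if "k \<in> {1..n div 2}" for k
  proof
    have "real k * pi / real n \<ge> 0" by simp
    then show "- (pi / 2) \<le> real k * pi / real n" using pi_gt_zero by linarith
    have "2 * real k * pi \<le> real n * pi" using le[OF that] by (intro mult_right_mono) auto
    then show "real k * pi / real n \<le> pi / 2" using assms(1) by (simp add: field_simps)
  qed
  have "real i * pi / real n = real j * pi / real n"
    using sin_inj_pi[of "real i * pi / real n" "real j * pi / real n"] bnd assms by blast
  then show ?thesis using assms(1) by simp
qed

lemma sin_index_pos: "k \<in> {1..n div 2} \<Longrightarrow> sin (real k * pi / real n) > 0"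
  by (rule sin_gt_zero) (auto simp: field_simps)

lemma class_exists:
  assumes "0 < k" "k < n"
  shows "\<exists>j\<in>{1..n div 2}. sin (real j * pi / real n) = sin (real k * pi / real n)"
proof (cases "k \<le> n div 2")
  case False
  have "real (n - k) * pi / real n = pi - real k * pi / real n"
    using assms by (simp add: of_nat_diff field_simps)
  then have "sin (real (n - k) * pi / real n) = sin (real k * pi / real n)" by simp
  moreover have "n - k \<in> {1..n div 2}" using assms False by auto
  ultimately show ?thesis by blast
qed (use assms in auto)

lemma mat_power_mult_vec:
  assumes "\<And>i. i \<in> {1..d} \<Longrightarrow> (\<Sum>j=1..d. real (A i j) * s j) = lam * s i" and "i \<in> {1..d}"
  shows "(\<Sum>j=1..d. real (mat_power d A m i j) * s j) = lam ^ m * s i"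
proof (induction m)
  case 0
  have "(\<Sum>j=1..d. real (mat_power d A 0 i j) * s j) = (\<Sum>j=1..d. if i = j then s j else 0)"
    by (rule sum.cong) auto
  then show ?case using assms(2) by simp
next
  case (Suc m)
  have "(\<Sum>j=1..d. real (mat_power d A (Suc m) i j) * s j)
      = (\<Sum>j=1..d. \<Sum>l=1..d. real (mat_power d A m i l) * (real (A l j) * s j))"
    by (simp add: sum_distrib_right mult.assoc)
  also have "\<dots> = (\<Sum>l=1..d. real (mat_power d A m i l) * (\<Sum>j=1..d. real (A l j) * s j))"
    by (subst sum.swap) (simp add: sum_distrib_left)
  also have "\<dots> = (\<Sum>l=1..d. real (mat_power d A m i l) * (lam * s l))"
    using assms(1) by (intro sum.cong) auto
  also have "\<dots> = lam * (\<Sum>l=1..d. real (mat_power d A m i l) * s l)"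
    by (simp add: sum_distrib_left mult.left_commute)
  finally have eq: "(\<Sum>j=1..d. real (mat_power d A (Suc m) i j) * s j)
      = lam * (\<Sum>l=1..d. real (mat_power d A m i l) * s l)" .
  show ?case unfolding eq Suc by simp
qed

text \<open>Comparing areas in one dissection, grouped by class, gives one row of the equation. The
  matrix condition is vacuous for an empty class, so \<open>reach\<close> first shows that every
  class is inhabited: a positive entry of a matrix power means that the class turns up among
  descendants of an existing prototile.\<close>

lemma (in substitution) class_areas_eigenvector:
  assumes n: "n \<ge> 2" and R: "R > 0"
    and areas: "\<forall>p. \<exists>k. 0 < k \<and> k < n \<and> area (P p) = R * sin (real k * pi / real n)"
    and mat: "is_class_substitution_matrix n R P D A"
    and prim: "primitive_matrix (n div 2) A" and i: "i \<in> {1..n div 2}"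
  shows "(\<Sum>j=1..n div 2. real (A i j) * mu n j) = (norm \<eta>)\<^sup>2 * mu n i"
proof -
  let ?d = "n div 2" and ?s = "\<lambda>j. sin (real j * pi / real n)"
  have "\<exists>k\<in>{1..?d}. in_class n R P p k" for p
    using areas class_exists unfolding in_class_def by metis
  then obtain cl where cl: "\<And>p. cl p \<in> {1..?d}" "\<And>p. in_class n R P p (cl p)" by metis
  have cl_iff: "in_class n R P p j \<longleftrightarrow> cl p = j" if "j \<in> {1..?d}" for p j
    using cl[of p] that sin_index_inj[of n "cl p" j] n R by (auto simp: in_class_def)
  have card: "card {t \<in> D p. cl (fst t) = j} = A (cl p) j" if "j \<in> {1..?d}" for p j
  proof -
    have "card {t \<in> D p. in_class n R P (fst t) j} = A (cl p) j"
      using mat cl[of p] that unfolding is_class_substitution_matrix_def by blast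
    then show ?thesis by (simp add: cl_iff[OF that])
  qed
  have reach: "\<exists>p. cl p = j" if "mat_power ?d A m l j > 0" "\<exists>p. cl p = l" "j \<in> {1..?d}" for m l j
    using that(1,3)
  proof (induction m arbitrary: j)
    case 0
    then show ?case using that(2) by (auto split: if_splits)
  next
    case (Suc m)
    have "(\<Sum>l'=1..?d. mat_power ?d A m l l' * A l' j) \<noteq> 0"
      using Suc.prems(1) unfolding mat_power.simps by linarith
    then obtain l' where l': "l' \<in> {1..?d}" "mat_power ?d A m l l' * A l' j \<noteq> 0"
      by (meson sum.neutral)
    then obtain p where p: "cl p = l'" using Suc.IH[of l'] by auto
    have "card {t \<in> D p. cl (fst t) = j} > 0" using card[OF Suc.prems(2), of p] l' p by simp
    then show ?case by (auto simp: card_gt_0_iff)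
  qed
  obtain m where m: "\<And>i j. i \<in> {1..?d} \<Longrightarrow> j \<in> {1..?d} \<Longrightarrow> mat_power ?d A m i j > 0"
    using prim unfolding primitive_matrix_def by blast
  obtain p where p: "cl p = i" using reach[OF m[OF cl(1) i]] i by blast
  have ar: "area (P q) = R * ?s (cl q)" for q using cl(2)[of q] by (simp add: in_class_def)
  have "(norm \<eta>)\<^sup>2 * (R * ?s i) = (\<Sum>t\<in>D p. R * ?s (cl (fst t)))"
    using area_dissection[of p] by (simp add: ar p)
  also have "\<dots> = (\<Sum>j=1..?d. \<Sum>t\<in>{t \<in> D p. cl (fst t) = j}. R * ?s (cl (fst t)))"
    by (rule sum.group[symmetric]) (use dissection(1) cl(1) in auto)
  also have "\<dots> = (\<Sum>j=1..?d. real (A i j) * (R * ?s j))"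
  proof (rule sum.cong)
    fix j assume "j \<in> {1..?d}"
    have "(\<Sum>t\<in>{t \<in> D p. cl (fst t) = j}. R * ?s (cl (fst t))) = (\<Sum>t\<in>{t \<in> D p. cl (fst t) = j}. R * ?s j)"
      by (rule sum.cong) auto
    then show "(\<Sum>t\<in>{t \<in> D p. cl (fst t) = j}. R * ?s (cl (fst t))) = real (A i j) * (R * ?s j)"
      using card[OF \<open>j \<in> {1..?d}\<close>, of p] p by simp
  qed simp
  also have "\<dots> = R * (\<Sum>j=1..?d. real (A i j) * ?s j)"
    by (simp add: sum_distrib_left mult.left_commute)
  finally have "(norm \<eta>)\<^sup>2 * ?s i = (\<Sum>j=1..?d. real (A i j) * ?s j)" using R by simp
  then show ?thesis unfolding mu_def by (simp add: sum_divide_distrib[symmetric])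
qed

text \<open>Extend \<open>{g}\<close> to a basis of the reals over the rationals and prescribe the
  value 1 at \<open>g\<close>; the rational values are read as reals.\<close>

lemma rational_functional:
  fixes g :: real assumes "g \<noteq> 0"
  obtains f :: "real \<Rightarrow> real" where "\<And>x y. f (x + y) = f x + f y" "\<And>q x. f (of_rat q * x) = of_rat q * f x"
    "f g = 1" "\<And>x. f x \<in> \<rat>"
proof -
  interpret V: vector_space_pair "\<lambda>(q::rat) (x::real). of_rat q * x" "\<lambda>(q::rat) (x::rat). q * x"
    by unfold_locales (auto simp: algebra_simps of_rat_add of_rat_mult)
  have "V.vs1.independent {g}" using assms by simp
  from V.linear_independent_extend[OF this, of "\<lambda>_. 1"] obtain h where
    h: "Vector_Spaces.linear (\<lambda>(q::rat) (x::real). of_rat q * x) (\<lambda>(q::rat) (x::rat). q * x) h" "h g = 1"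
    by auto
  show thesis
  proof (rule that[of "\<lambda>x. of_rat (h x)"])
    show "of_rat (h (x + y)) = (of_rat (h x) + of_rat (h y) :: real)" for x y
      using V.linear_add[OF h(1)] by (simp add: of_rat_add)
    show "of_rat (h (of_rat q * x)) = (of_rat q * of_rat (h x) :: real)" for q x
      using V.linear_scale[OF h(1), of q x] by (simp add: of_rat_mult)
  qed (use h in auto)
qed

text \<open>The first average puts weight at least \<open>\<epsilon>\<close> on the minimum, so it
  stays below the maximum by \<open>\<epsilon>\<close> times the spread, while the second average is
  at least the minimum.\<close>

lemma weighted_averages_contract:
  fixes x :: "'a \<Rightarrow> real"
  assumes J: "finite J" "J \<noteq> {}" and p: "\<And>j. j \<in> J \<Longrightarrow> p j \<ge> \<epsilon>" "sum p J = 1"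
    and q: "\<And>j. j \<in> J \<Longrightarrow> q j \<ge> 0" "sum q J = 1" and \<epsilon>: "0 \<le> \<epsilon>" "\<epsilon> \<le> 1"
    and C: "\<And>i j. i \<in> J \<Longrightarrow> j \<in> J \<Longrightarrow> x i - x j \<le> C"
  shows "(\<Sum>j\<in>J. p j * x j) - (\<Sum>j\<in>J. q j * x j) \<le> (1 - \<epsilon>) * C"
proof -
  obtain a where a: "a \<in> J" "\<And>j. j \<in> J \<Longrightarrow> x a \<le> x j"
    using arg_min_if_finite[OF J, of x] by (meson not_le)
  obtain b where b: "b \<in> J" "\<And>j. j \<in> J \<Longrightarrow> x j \<le> x b"
    using arg_min_if_finite[OF J, of "\<lambda>j. - x j"] by (meson neg_less_iff_less not_le)
  have "\<epsilon> * (x b - x a) \<le> p a * (x b - x a)" using p(1)[OF a(1)] b a by (intro mult_right_mono) auto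
  also have "\<dots> \<le> (\<Sum>j\<in>J. p j * (x b - x j))"
    using J a(1) p(1) \<epsilon>(1) b by (intro member_le_sum[of a J "\<lambda>j. p j * (x b - x j)"]) (auto intro!: mult_nonneg_nonneg intro: order_trans)
  also have "\<dots> = x b - (\<Sum>j\<in>J. p j * x j)"
    using p(2) by (simp add: right_diff_distrib sum_subtractf flip: sum_distrib_right)
  finally have 1: "(\<Sum>j\<in>J. p j * x j) \<le> x b - \<epsilon> * (x b - x a)" by simp
  have "x a = (\<Sum>j\<in>J. q j * x a)" using q(2) by (simp flip: sum_distrib_right)
  also have "\<dots> \<le> (\<Sum>j\<in>J. q j * x j)" using q(1) a by (intro sum_mono mult_left_mono) auto
  finally have "(\<Sum>j\<in>J. p j * x j) - (\<Sum>j\<in>J. q j * x j) \<le> (1 - \<epsilon>) * (x b - x a)"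
    using 1 by (simp add: algebra_simps)
  also have "\<dots> \<le> (1 - \<epsilon>) * C" using C[OF b(1) a(1)] \<epsilon> by (intro mult_left_mono) auto
  finally show ?thesis .
qed

section \<open>Arithmetic of the eigenvalue\<close>

text \<open>A rational-root argument for the recursion of
  \<open>2 * cos (real k * \<alpha>)\<close>. At \<open>k = n\<close> the value is
  \<open>-2\<close>, which forces the denominator to be 1; but for \<open>n \<ge> 4\<close> the
  angle is below \<open>pi / 3\<close>, so \<open>2 * cos \<alpha>\<close> lies strictly between 1
  and 2.\<close>

lemma irrational_two_cos:
  assumes "n \<ge> 4" shows "2 * cos (pi / real n) \<notin> \<rat>"
proof
  define \<alpha> where "\<alpha> = pi / real n"
  assume "2 * cos (pi / real n) \<in> \<rat>"
  then have "2 * cos \<alpha> \<in> \<rat>" by (simp add: \<alpha>_def)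
  then obtain p q :: int where q: "q > 0" and pq: "coprime p q" "2 * cos \<alpha> = of_int p / of_int q"
    by (rule Rats_cases')
  have x: "real_of_int q * (2 * cos \<alpha>) = of_int p" using pq q by simp
  have rec: "2 * cos (real (k + 2) * \<alpha>) = (2 * cos \<alpha>) * (2 * cos (real (k + 1) * \<alpha>)) - 2 * cos (real k * \<alpha>)" for k
  proof -
    have "real (k + 2) * \<alpha> = real (k + 1) * \<alpha> + \<alpha>" "real k * \<alpha> = real (k + 1) * \<alpha> - \<alpha>"
      by (simp_all add: algebra_simps)
    then show ?thesis by (simp only: cos_add cos_diff) (simp add: algebra_simps)
  qed
  \<comment> \<open>After clearing denominators, the \<open>(k + 1)\<close>-st term is congruent to
    \<open>p ^ (k + 1)\<close> modulo \<open>q\<close>.\<close>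
  have step: "\<exists>c::int. real_of_int q ^ (k + 1) * (2 * cos (real (k + 1) * \<alpha>)) = of_int (p ^ (k + 1) + q * c)" for k
  proof (induction k rule: less_induct)
    case (less k)
    consider "k = 0" | "k = 1" | j where "k = j + 2" by (metis One_nat_def Suc_1 add_2_eq_Suc' not0_implies_Suc)
    then show ?case
    proof cases
      case 1
      then show ?thesis using x by (intro exI[of _ 0]) simp
    next
      case 2
      have r2: "2 * cos (real 2 * \<alpha>) = (2 * cos \<alpha>) * (2 * cos \<alpha>) - 2" using rec[of 0] by simp
      have "real_of_int q ^ 2 * (2 * cos (real 2 * \<alpha>)) = (of_int q * (2 * cos \<alpha>))\<^sup>2 - 2 * (of_int q)\<^sup>2"
        unfolding r2 by (simp add: power2_eq_square algebra_simps)
      also have "\<dots> = of_int (p ^ 2 + q * (- 2 * q))" by (simp add: x power2_eq_square)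
      finally show ?thesis using 2 by (intro exI[of _ "- 2 * q"]) (simp add: numeral_2_eq_2)
    next
      case 3
      obtain c where c: "real_of_int q ^ (j + 1) * (2 * cos (real (j + 1) * \<alpha>)) = of_int (p ^ (j + 1) + q * c)"
        using less[of j] 3 by auto
      obtain d where d: "real_of_int q ^ (j + 2) * (2 * cos (real (j + 2) * \<alpha>)) = of_int (p ^ (j + 2) + q * d)"
        using less[of "j + 1"] 3 by (auto simp: numeral_2_eq_2)
      have "real_of_int q ^ (j + 3) * (2 * cos (real (j + 3) * \<alpha>))
          = (of_int q * (2 * cos \<alpha>)) * (real_of_int q ^ (j + 2) * (2 * cos (real (j + 2) * \<alpha>)))
            - (of_int q)\<^sup>2 * (real_of_int q ^ (j + 1) * (2 * cos (real (j + 1) * \<alpha>)))"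
      proof -
        have r: "2 * cos (real (j + 3) * \<alpha>) = (2 * cos \<alpha>) * (2 * cos (real (j + 2) * \<alpha>)) - 2 * cos (real (j + 1) * \<alpha>)"
          using rec[of "j + 1"] by (simp add: numeral_3_eq_3 numeral_2_eq_2)
        have pw: "real_of_int q ^ (j + 3) = of_int q * real_of_int q ^ (j + 2)"
          "real_of_int q ^ (j + 3) = (of_int q)\<^sup>2 * real_of_int q ^ (j + 1)"
          by (simp_all add: power2_eq_square power_add numeral_3_eq_3)
        have "real_of_int q ^ (j + 3) * (2 * cos (real (j + 3) * \<alpha>))
          = real_of_int q ^ (j + 3) * ((2 * cos \<alpha>) * (2 * cos (real (j + 2) * \<alpha>)))
            - real_of_int q ^ (j + 3) * (2 * cos (real (j + 1) * \<alpha>))"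
          unfolding r by (rule right_diff_distrib)
        also have "real_of_int q ^ (j + 3) * ((2 * cos \<alpha>) * (2 * cos (real (j + 2) * \<alpha>)))
          = (of_int q * (2 * cos \<alpha>)) * (real_of_int q ^ (j + 2) * (2 * cos (real (j + 2) * \<alpha>)))"
          unfolding pw(1) by (simp only: mult_ac)
        also have "real_of_int q ^ (j + 3) * (2 * cos (real (j + 1) * \<alpha>))
          = (of_int q)\<^sup>2 * (real_of_int q ^ (j + 1) * (2 * cos (real (j + 1) * \<alpha>)))"
          unfolding pw(2) by (simp only: mult_ac)
        finally show ?thesis .
      qed
      also have "\<dots> = of_int (p * (p ^ (j + 2) + q * d) - q\<^sup>2 * (p ^ (j + 1) + q * c))"
        unfolding x c d by simp
      also have "p * (p ^ (j + 2) + q * d) - q\<^sup>2 * (p ^ (j + 1) + q * c)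
          = p ^ (j + 3) + q * (p * d - q * (p ^ (j + 1) + q * c))"
        by (simp add: algebra_simps power2_eq_square power3_eq_cube power_add)
      finally show ?thesis
        using 3 by (intro exI[of _ "p * d - q * (p ^ (j + 1) + q * c)"]) (simp add: numeral_3_eq_3)
    qed
  qed
  obtain c where c: "real_of_int q ^ n * (2 * cos (real n * \<alpha>)) = of_int (p ^ n + q * c)"
    using step[of "n - 1"] assms by auto
  have "real n * \<alpha> = pi" using assms by (simp add: \<alpha>_def)
  then have "real_of_int (- 2 * q ^ n) = of_int (p ^ n + q * c)" using c by simp
  then have "- 2 * q ^ n = p ^ n + q * c" by (simp only: of_int_eq_iff)
  moreover have "q ^ n = q * q ^ (n - 1)" using assms by (cases n) auto
  ultimately have "p ^ n = q * (- 2 * q ^ (n - 1) - c)" by (simp add: algebra_simps)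
  then have "q dvd p ^ n" by simp
  moreover have "coprime (p ^ n) q" using pq(1) by simp
  ultimately have "is_unit q" using coprime_common_divisor dvd_refl by blast
  then have "q = 1" using q by simp
  then have xi: "2 * cos \<alpha> = of_int p" using pq by simp
  have a: "0 < \<alpha>" "\<alpha> < pi / 3" using assms by (auto simp: \<alpha>_def field_simps)
  have "cos (pi / 3) < cos \<alpha>" using a by (intro cos_monotone_0_pi) auto
  then have "2 * cos \<alpha> > 1" by (simp add: cos_60)
  moreover have "cos \<alpha> < cos 0" using a pi_gt_zero by (intro cos_monotone_0_pi) auto
  then have "2 * cos \<alpha> < 2" by simp
  ultimately have "1 < p" "p < 2" unfolding xi by simp_all
  then show False by simp
qed

lemma mu_1:
  assumes "n \<ge> 2" shows "mu n 1 = 1"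
proof -
  have "1 \<le> n div 2" using assms by presburger
  then show ?thesis using sin_index_pos[of 1 n] by (simp add: mu_def)
qed

lemma mu_pos:
  assumes "k \<in> {1..n div 2}" shows "mu n k > 0"
proof -
  have "1 \<in> {1..n div 2}" using assms by auto
  then show ?thesis using sin_index_pos[OF assms] sin_index_pos[of 1 n] by (simp add: mu_def)
qed

lemma mu_2_irrational:
  assumes "n \<ge> 4" shows "mu n 2 \<notin> \<rat>"
proof -
  have "1 \<le> n div 2" using assms by presburger
  then have "sin (pi / real n) \<noteq> 0" using sin_index_pos[of 1 n] by simp
  moreover have "real 2 * pi / real n = 2 * (pi / real n)" by simp
  ultimately have "mu n 2 = 2 * cos (pi / real n)" unfolding mu_def by (simp only: sin_double) simp
  then show ?thesis using irrational_two_cos[OF assms] by simp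
qed

text \<open>For a rational functional \<open>f\<close>, the vectors \<open>f (lam ^ m * s i)\<close> are iterates of the matrix, so by
  contraction they align with \<open>s\<close>. A relation \<open>lam ^ m = N m * a + b\<close> with natural \<open>N m\<close> makes them, up to
  a fixed vector, rational multiples of the rational vector \<open>f (g * s i)\<close>, which is thus itself
  proportional to \<open>s\<close>.\<close>
lemma eigenvalue_powers_not_arithmetic:
  fixes s :: "nat \<Rightarrow> real" and N :: "nat \<Rightarrow> nat"
  assumes prim: "primitive_matrix d A"
    and eig: "\<And>i. i \<in> {1..d} \<Longrightarrow> (\<Sum>j=1..d. real (A i j) * s j) = lam * s i"
    and s: "\<And>i. i \<in> {1..d} \<Longrightarrow> s i > 0" "s 1 = 1" and i0: "i0 \<in> {1..d}" "s i0 \<notin> \<rat>"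
    and lam: "lam > 1" and I: "infinite I" and a: "a > 0"
    and prog: "\<And>m. m \<in> I \<Longrightarrow> lam ^ m = real (N m) * a + b"
  shows False
proof -
  let ?J = "{1..d}"
  have one: "1 \<in> ?J" using i0 by auto
  obtain m0 where m0: "m0 \<in> I" using infinite_imp_nonempty[OF I] by blast
  obtain m1 where m1: "m1 \<in> I" "m1 > m0" using I by (meson infinite_nat_iff_unbounded)
  \<comment> \<open>A difference of two powers in the progression eliminates \<open>b\<close>; all
    such differences are rational multiples of \<open>g\<close>, on which \<open>f\<close> is
    normalised.\<close>
  define g where "g = lam ^ m1 - lam ^ m0"
  have "lam ^ m0 < lam ^ m1" using lam m1 by (intro power_strict_increasing)
  then have g0: "g > 0" by (simp add: g_def)
  have gN: "g = (real (N m1) - real (N m0)) * a" using prog m0 m1 by (simp add: g_def algebra_simps)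
  have N01: "real (N m1) - real (N m0) > 0" using g0 a unfolding gN by (simp add: zero_less_mult_iff)
  obtain f :: "real \<Rightarrow> real" where f: "\<And>x y. f (x + y) = f x + f y"
    "\<And>q x. f (of_rat q * x) = of_rat q * f x" "f g = 1" "\<And>x. f x \<in> \<rat>"
    using rational_functional[of g] g0 by blast
  have f_rat: "f (q * x) = q * f x" if "q \<in> \<rat>" for q x
    using that f(2) by (auto elim!: Rats_cases)
  have f0: "f 0 = 0" using f(1)[of 0 0] by simp
  have f_sum: "f (\<Sum>j\<in>?J. real (c j) * x j) = (\<Sum>j\<in>?J. real (c j) * f (x j))" for c :: "nat \<Rightarrow> nat" and x
  proof -
    have "f (\<Sum>j\<in>K. real (c j) * x j) = (\<Sum>j\<in>K. real (c j) * f (x j))" if "finite K" for K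
      using that by (induction K rule: finite_induct) (simp_all add: f(1) f0 f_rat)
    then show ?thesis by simp
  qed
  \<comment> \<open>Alignment of the vectors with \<open>s\<close> means that this ratio becomes
    independent of \<open>i\<close>.\<close>
  define u where "u m i = f (lam ^ m * s i) / (lam ^ m * s i)" for m i
  \<comment> \<open>The \<open>t\<close>-th power rescaled by the eigenvector: its rows sum to 1, so
    passing from \<open>u m\<close> to \<open>u (m + t)\<close> is averaging.\<close>
  define p where "p t i j = real (mat_power d A t i j) * s j / (lam ^ t * s i)" for t i j
  have nz: "lam ^ m * s i > 0" if "i \<in> ?J" for m i using lam s(1)[OF that] by simp
  have p_sum: "sum (p t i) ?J = 1" if "i \<in> ?J" for t i
    using mat_power_mult_vec[OF eig that, of t] lam s(1)[OF that]
    unfolding p_def by (simp flip: sum_divide_distrib)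
  have p_nonneg: "p t i j \<ge> 0" if "i \<in> ?J" "j \<in> ?J" for t i j
    using nz[OF that(1), of t] s(1)[OF that(2)] by (simp add: p_def)
  have u_step: "u (m + t) i = (\<Sum>j\<in>?J. p t i j * u m j)" if i: "i \<in> ?J" for m t i
  proof -
    have "lam ^ (m + t) * s i = lam ^ m * (\<Sum>j\<in>?J. real (mat_power d A t i j) * s j)"
      using mat_power_mult_vec[OF eig i, of t] by (simp add: power_add)
    also have "\<dots> = (\<Sum>j\<in>?J. real (mat_power d A t i j) * (lam ^ m * s j))"
      by (simp add: sum_distrib_left mult.left_commute)
    finally have "f (lam ^ (m + t) * s i) = (\<Sum>j\<in>?J. real (mat_power d A t i j) * f (lam ^ m * s j))"
      by (simp only: f_sum)
    then have "u (m + t) i = (\<Sum>j\<in>?J. real (mat_power d A t i j) * f (lam ^ m * s j) / (lam ^ (m + t) * s i))"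
      by (simp add: u_def sum_divide_distrib)
    also have "\<dots> = (\<Sum>j\<in>?J. p t i j * u m j)"
    proof (rule sum.cong)
      fix j assume "j \<in> ?J"
      then have "s j > 0" using s(1) by blast
      then show "real (mat_power d A t i j) * f (lam ^ m * s j) / (lam ^ (m + t) * s i) = p t i j * u m j"
        using lam s(1)[OF i] by (simp add: p_def u_def power_add field_simps)
    qed simp
    finally show ?thesis .
  qed
  obtain t where t: "t > 0" "\<And>i j. i \<in> ?J \<Longrightarrow> j \<in> ?J \<Longrightarrow> mat_power d A t i j > 0"
    using prim unfolding primitive_matrix_def by blast
  \<comment> \<open>Primitivity provides an exponent \<open>t\<close> for which all averaging
    weights are positive; every \<open>t\<close> steps the spread of \<open>u\<close> shrinks by the
    factor \<open>1 - \<epsilon>\<close>.\<close>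
  define \<epsilon> where "\<epsilon> = Min ((\<lambda>(i, j). p t i j) ` (?J \<times> ?J))"
  have fin: "finite ((\<lambda>(i, j). p t i j) ` (?J \<times> ?J))" "(\<lambda>(i, j). p t i j) ` (?J \<times> ?J) \<noteq> {}" using one by auto
  have \<epsilon>_le: "\<epsilon> \<le> p t i j" if "i \<in> ?J" "j \<in> ?J" for i j
    unfolding \<epsilon>_def by (rule Min_le[OF fin(1)]) (use that in force)
  have "p t i j > 0" if "i \<in> ?J" "j \<in> ?J" for i j
    using t(2)[OF that] s(1)[OF that(2)] nz[OF that(1), of t] by (simp add: p_def)
  then have \<epsilon>: "\<epsilon> > 0" unfolding \<epsilon>_def using Min_gr_iff[OF fin] by auto
  have "p t 1 1 \<le> sum (p t 1) ?J" using one p_nonneg by (intro member_le_sum) auto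
  then have \<epsilon>1: "\<epsilon> \<le> 1" using \<epsilon>_le[OF one one] p_sum[OF one, of t] by simp
  have "\<exists>C. \<forall>i\<in>?J. \<forall>j\<in>?J. u r i - u r j \<le> C" for r
  proof (intro exI ballI)
    fix i j assume ij: "i \<in> ?J" "j \<in> ?J"
    have "\<bar>u r k\<bar> \<le> (\<Sum>k\<in>?J. \<bar>u r k\<bar>)" if "k \<in> ?J" for k using that by (intro member_le_sum) auto
    from this[OF ij(1)] this[OF ij(2)] show "u r i - u r j \<le> 2 * (\<Sum>k\<in>?J. \<bar>u r k\<bar>)" by linarith
  qed
  then obtain C where C: "\<And>r i j. i \<in> ?J \<Longrightarrow> j \<in> ?J \<Longrightarrow> u r i - u r j \<le> C r" by metis
  have osc: "u (r + q * t) i - u (r + q * t) j \<le> (1 - \<epsilon>) ^ q * C r" if "i \<in> ?J" "j \<in> ?J" for q r i j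
    using that
  proof (induction q arbitrary: i j)
    case (Suc q)
    have "r + Suc q * t = (r + q * t) + t" by simp
    then have "u (r + Suc q * t) i - u (r + Suc q * t) j
        = (\<Sum>l\<in>?J. p t i l * u (r + q * t) l) - (\<Sum>l\<in>?J. p t j l * u (r + q * t) l)"
      using u_step Suc.prems by metis
    also have "\<dots> \<le> (1 - \<epsilon>) * ((1 - \<epsilon>) ^ q * C r)"
      by (rule weighted_averages_contract)
        (use one \<epsilon>_le p_sum p_nonneg Suc \<epsilon> \<epsilon>1 in \<open>auto simp del: One_nat_def\<close>)
    finally show ?case by (simp add: mult.assoc)
  qed (use C in simp)
  \<comment> \<open>The contraction proceeds in steps of \<open>t\<close>, so initial spreads are
    bounded over all residues modulo \<open>t\<close>.\<close>
  define B where "B = Max (insert 0 (C ` {..<t}))"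
  have B: "u m i - u m j \<le> (1 - \<epsilon>) ^ (m div t) * B" if "i \<in> ?J" "j \<in> ?J" for m i j
  proof -
    have "u m i - u m j \<le> (1 - \<epsilon>) ^ (m div t) * C (m mod t)"
      using osc[OF that, of "m mod t" "m div t"] by (simp add: mod_mult_div_eq mult.commute)
    also have "\<dots> \<le> (1 - \<epsilon>) ^ (m div t) * B"
      using t(1) \<epsilon>1 by (intro mult_left_mono) (auto simp: B_def)
    finally show ?thesis .
  qed
  obtain \<sigma> :: "nat \<Rightarrow> nat" where \<sigma>: "strict_mono \<sigma>" "\<And>k. \<sigma> k \<in> I" using infinite_enumerate[OF I] by blast
  have \<sigma>top: "filterlim \<sigma> at_top at_top" using \<sigma>(1) by (rule filterlim_subseq)
  have divtop: "filterlim (\<lambda>k. \<sigma> k div t) at_top at_top"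
    unfolding filterlim_at_top
  proof
    fix Z :: nat
    have "eventually (\<lambda>k. \<sigma> k \<ge> Z * t) at_top" using \<sigma>top by (simp add: filterlim_at_top)
    then show "eventually (\<lambda>k. Z \<le> \<sigma> k div t) at_top"
      by eventually_elim (use t(1) in \<open>simp add: less_eq_div_iff_mult_less_eq\<close>)
  qed
  have "(\<lambda>k. (1 - \<epsilon>) ^ k) \<longlonglongrightarrow> 0" using \<epsilon> \<epsilon>1 by (intro LIMSEQ_realpow_zero) auto
  then have "(\<lambda>k. (1 - \<epsilon>) ^ (\<sigma> k div t)) \<longlonglongrightarrow> 0" by (rule filterlim_compose[OF _ divtop])
  then have Blim: "(\<lambda>k. (1 - \<epsilon>) ^ (\<sigma> k div t) * B) \<longlonglongrightarrow> 0" by (rule tendsto_mult_left_zero)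
  have "(\<lambda>k. (1 / lam) ^ k) \<longlonglongrightarrow> 0" using lam by (intro LIMSEQ_realpow_zero) auto
  then have inv0: "(\<lambda>k. (1 / lam) ^ \<sigma> k) \<longlonglongrightarrow> 0" by (rule filterlim_compose[OF _ \<sigma>top])
  have ulim: "(\<lambda>k. u (\<sigma> k) i) \<longlonglongrightarrow> f (g * s i) / (g * s i)" if i: "i \<in> ?J" for i
  proof -
    have eq: "u (\<sigma> k) i = (1 / lam) ^ \<sigma> k * (f (lam ^ m0 * s i) / s i)
        + (1 - (1 / lam) ^ \<sigma> k * lam ^ m0) * (f (g * s i) / (g * s i))" for k
    proof -
      \<comment> \<open>A quotient of differences of natural numbers, hence rational:
        \<open>f\<close> commutes with multiplication by \<open>r\<close> in
        \<open>lam ^ \<sigma> k = lam ^ m0 + r * g\<close>. The fixed summand vanishes in the limit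
        after division by \<open>lam ^ \<sigma> k\<close>.\<close>
      define r where "r = (real (N (\<sigma> k)) - real (N m0)) / (real (N m1) - real (N m0))"
      have rg: "r * g = lam ^ \<sigma> k - lam ^ m0"
      proof -
        have "r * g = (real (N (\<sigma> k)) - real (N m0)) * a" using N01 by (simp add: r_def gN)
        then show ?thesis unfolding prog[OF \<sigma>(2)[of k]] prog[OF m0] by (simp add: left_diff_distrib)
      qed
      have "r \<in> \<rat>" by (simp add: r_def)
      have "lam ^ \<sigma> k = lam ^ m0 + r * g" using rg by simp
      then have "lam ^ \<sigma> k * s i = lam ^ m0 * s i + r * (g * s i)"
        by (simp add: distrib_right mult.assoc)
      then have "f (lam ^ \<sigma> k * s i) = f (lam ^ m0 * s i) + r * f (g * s i)"
        using f(1) f_rat[OF \<open>r \<in> \<rat>\<close>] by simp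
      moreover have "r = (lam ^ \<sigma> k - lam ^ m0) / g" using rg g0 by (simp add: field_simps)
      ultimately have fe: "f (lam ^ \<sigma> k * s i) = f (lam ^ m0 * s i) + (lam ^ \<sigma> k - lam ^ m0) / g * f (g * s i)"
        by simp
      have "(x + (X - L) / g * y) / (X * z) = 1 / X * (x / z) + (1 - 1 / X * L) * (y / (g * z))"
        if "X > 0" "z > 0" for x y z X L
        using that g0 by (simp add: field_simps)
      from this[of "lam ^ \<sigma> k" "s i"] show ?thesis
        unfolding u_def fe power_divide power_one using lam s(1)[OF i] by simp
    qed
    have "(\<lambda>k. (1 / lam) ^ \<sigma> k * (f (lam ^ m0 * s i) / s i)
        + (1 - (1 / lam) ^ \<sigma> k * lam ^ m0) * (f (g * s i) / (g * s i)))
      \<longlonglongrightarrow> 0 * (f (lam ^ m0 * s i) / s i) + (1 - 0 * lam ^ m0) * (f (g * s i) / (g * s i))"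
      by (intro tendsto_intros inv0)
    then show ?thesis unfolding eq by simp
  qed
  have le: "f (g * s i) / (g * s i) - f (g * s j) / (g * s j) \<le> 0" if "i \<in> ?J" "j \<in> ?J" for i j
    by (rule LIMSEQ_le[OF tendsto_diff[OF ulim[OF that(1)] ulim[OF that(2)]] Blim]) (use B that in blast)
  have "f (g * s i0) / (g * s i0) = f (g * s 1) / (g * s 1)"
    using le[OF i0(1) one] le[OF one i0(1)] by simp
  \<comment> \<open>The common limit at index 1 is \<open>1 / g\<close>, since
    \<open>s 1 = 1\<close> and \<open>f g = 1\<close>. So the irrational \<open>s i0\<close> would
    be a value of \<open>f\<close>.\<close>
  then have "f (g * s i0) = s i0" using s f(3) g0 s(1)[OF i0(1)] by (simp add: field_simps)
  then show False using f(4)[of "g * s i0"] i0(2) by simp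
qed

section \<open>Aperiodicity\<close>

text \<open>Norms and inner products determine the area up to sign; the absolute value remains
  because \<open>f\<close> may reverse orientation.\<close>

lemma similarity_cross:
  assumes "similarity s f"
  shows "\<bar>cross (f x - f a) (f y - f a)\<bar> = s\<^sup>2 * \<bar>cross (x - a) (y - a)\<bar>"
proof -
  have "norm (f z - f a) = s * norm (z - a)" for z
    using similarity_dist[OF assms, of z a] by (simp add: dist_norm)
  then have 1: "(cross (f x - f a) (f y - f a))\<^sup>2
      = (s * norm (x - a))\<^sup>2 * (s * norm (y - a))\<^sup>2 - (s\<^sup>2 * ((x - a) \<bullet> (y - a)))\<^sup>2"
    using cross_inner_norm[of "f x - f a" "f y - f a"] similarity_inner[OF assms, of x a y] by simp
  have 2: "(cross (x - a) (y - a))\<^sup>2 = (norm (x - a))\<^sup>2 * (norm (y - a))\<^sup>2 - ((x - a) \<bullet> (y - a))\<^sup>2"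
    using cross_inner_norm[of "x - a" "y - a"] by simp
  have "(cross (f x - f a) (f y - f a))\<^sup>2 = (s\<^sup>2 * cross (x - a) (y - a))\<^sup>2"
    unfolding 1 power_mult_distrib 2 by (simp add: algebra_simps power2_eq_square)
  then have "\<bar>cross (f x - f a) (f y - f a)\<bar> = \<bar>s\<^sup>2 * cross (x - a) (y - a)\<bar>" by (simp only: power2_eq_iff abs_eq_iff)
  then show ?thesis by (simp add: abs_mult)
qed

context substitution
begin

definition vertex_distances :: "real set" where
  "vertex_distances = {dist x y |x y p. x \<in> vertices (P p) \<and> y \<in> vertices (P p) \<and> x \<noteq> y}"

lemma finite_vertex_distances: "finite vertex_distances"
proof (rule finite_subset)
  show "vertex_distances \<subseteq> (\<Union>p. (\<lambda>(x, y). dist x y) ` (vertices (P p) \<times> vertices (P p)))"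
    by (force simp: vertex_distances_def)
qed (use finite_prototile_vertices in auto)

lemma vertex_distances_pos: "x \<in> vertex_distances \<Longrightarrow> x > 0"
  by (auto simp: vertex_distances_def)

lemma copies_polygonal_tiling:
  assumes "is_substitution_tiling \<eta> P D T"
  shows "polygonal_tiling T vertex_distances"
proof
  have T: "is_tiling T" and copies: "\<forall>t\<in>T. \<exists>p g. is_isometry g \<and> t = support P (p, g)"
    using assms by (auto simp: is_substitution_tiling_def)
  show "is_tiling T" by (rule T)
  show "finite {t \<in> T. t \<inter> ball 0 r \<noteq> {}}" for r by (rule locally_finite_copies[OF T copies])
  have vert: "\<exists>p g. similarity 1 g \<and> vertices t = g ` vertices (P p)" if "t \<in> T" for t
  proof -
    from bspec[OF copies that] obtain p g where g: "is_isometry g" "t = support P (p, g)"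
      by (elim exE conjE)
    have "vertices t = g ` vertices (P p)"
      using similarity_vertices[OF similarity_isometry[OF g(1)], of "P p"] by (simp add: g(2) support_def)
    then show ?thesis using similarity_isometry[OF g(1)] by blast
  qed
  show "finite (vertices t)" if "t \<in> T" for t using vert[OF that] finite_prototile_vertices by auto
  show "dist x y \<in> vertex_distances" if txy: "t \<in> T" "x \<in> vertices t" "y \<in> vertices t" "x \<noteq> y" for t x y
  proof -
    obtain p g where g: "similarity 1 g" "vertices t = g ` vertices (P p)" using vert[OF txy(1)] by blast
    obtain x' y' where xy: "x' \<in> vertices (P p)" "y' \<in> vertices (P p)" "x = g x'" "y = g y'"
      using txy(2,3) unfolding g(2) by blast
    then have "dist x y = dist x' y'" "x' \<noteq> y'"
      using txy(4) similarity_dist[OF g(1), of x' y'] by auto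
    then show ?thesis unfolding vertex_distances_def using xy(1,2) by blast
  qed
qed

lemma supertile_edge_lengths:
  assumes st: "is_substitution_tiling \<eta> P D T" and per: "(\<lambda>t. (+) v ` t) ` T = T" and v: "v \<noteq> 0"
  obtains \<Omega> k0 where "finite \<Omega>" "\<forall>k\<ge>k0. \<exists>l\<in>vertex_distances. \<exists>\<omega>\<in>\<Omega>. \<exists>\<delta>\<in>\<Omega>. \<exists>N::nat.
    \<omega> > 0 \<and> norm \<eta> ^ k * l = real N * \<omega> + \<delta>"
proof -
  interpret polygonal_tiling T vertex_distances by (rule copies_polygonal_tiling[OF st])
  define V where "V = (\<Union>p. vertices (P p))"
  have finV: "finite V" unfolding V_def using finite_prototile_vertices by simp
  \<comment> \<open>By Cramer's rule \<open>\<bar>\<beta>\<bar>\<close> is at most an edge length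
    times \<open>norm v\<close>, divided by an area. Lengths grow like \<open>s\<close> and areas
    like \<open>s\<^sup>2\<close>, so \<open>\<kappa>\<close> at prototile vertices bounds
    \<open>s * \<bar>\<beta>\<bar>\<close>. Degenerate triples give 0; the sums \<open>K\<close> and
    \<open>M\<close> serve as crude maxima.\<close>
  define \<kappa> where "\<kappa> = (\<lambda>(a, x, y). dist a x * norm v / \<bar>cross (x - a) (y - a)\<bar>)"
  define K where "K = sum \<kappa> (V \<times> V \<times> V)"
  define M where "M = (\<Sum>(a, x)\<in>V \<times> V. dist a x)"
  have K: "\<kappa> (a, x, y) \<le> K" if "a \<in> V" "x \<in> V" "y \<in> V" for a x y
    unfolding K_def using that finV by (intro member_le_sum) (auto simp: \<kappa>_def)
  have M: "dist a x \<le> M" if "a \<in> V" "x \<in> V" for a x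
    using member_le_sum[of "(a, x)" "V \<times> V" "\<lambda>(a, x). dist a x"] that finV by (auto simp: M_def)
  have K0: "K \<ge> 0" unfolding K_def by (intro sum_nonneg) (auto simp: \<kappa>_def)
  define \<Omega> where "\<Omega> = {x \<in> list_sums vertex_distances. x \<le> K * M}"
  have fin: "finite \<Omega>"
    unfolding \<Omega>_def by (rule finite_bounded_list_sums[OF finite_vertex_distances vertex_distances_pos])
  \<comment> \<open>From this level on \<open>2 * \<bar>\<beta>\<bar> < 1\<close>, so at least two
    cutting points lie inside the edge.\<close>
  obtain k0 where k0: "2 * K < norm \<eta> ^ k0" using real_arch_pow[OF eta(1)] by blast
  show thesis
  proof (rule that[OF fin], intro allI impI)
    fix k assume k: "k \<ge> k0"
    define s where "s = norm \<eta> ^ k"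
    have "norm \<eta> ^ k0 \<le> norm \<eta> ^ k" using eta(1) by (intro power_increasing k) auto
    then have s: "s > 0" "2 * K < s" using eta(2) k0 by (auto simp: s_def)
    obtain F p f where F: "finite F" "F \<subseteq> T" and f: "similarity s f" and FP: "\<Union>F = f ` P p"
      unfolding s_def by (rule supertile_in_tiling[OF st, of k])
    define S where "S = \<Union>F"
    have S: "compact S" "closure (interior S) = S" using union_regular[OF F] by (auto simp: S_def)
    have vS: "vertices S = f ` vertices (P p)" unfolding S_def FP by (rule similarity_vertices[OF f])
    have nS: "S \<noteq> {}" unfolding S_def FP using prototile_closed(4) by simp
    have fS: "finite (vertices S)" unfolding vS using finite_prototile_vertices by simp
    obtain A x y \<alpha> \<beta> where e: "(A, x) \<in> edges S" "(A, y) \<in> edges S" and cross0: "cross (x - A) (y - A) \<noteq> 0"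
      and veq: "v = \<alpha> *\<^sub>R (x - A) + \<beta> *\<^sub>R (y - A)" and ab: "\<alpha> * \<beta> \<le> 0" "\<bar>\<alpha>\<bar> \<le> \<bar>\<beta>\<bar>" "\<beta> \<noteq> 0"
      and vert: "\<alpha> = 0 \<longrightarrow> (\<forall>z\<in>S. cross v (z - A) \<ge> 0) \<and> cross v (x - A) > 0"
      by (rule corner[OF S(1) nS S(2) fS v])
    have "A \<in> vertices S" "x \<in> vertices S" "y \<in> vertices S" "A \<noteq> y" using e by (auto simp: edges_def)
    then obtain A' x' y' where A': "A' \<in> vertices (P p)" "x' \<in> vertices (P p)" "y' \<in> vertices (P p)"
      and im: "A = f A'" "x = f x'" "y = f y'" and ne: "A' \<noteq> y'" unfolding vS by blast
    have inV: "A' \<in> V" "x' \<in> V" "y' \<in> V" using A' by (auto simp: V_def)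
    have cross_eq: "\<bar>cross (x - A) (y - A)\<bar> = s\<^sup>2 * \<bar>cross (x' - A') (y' - A')\<bar>"
      unfolding im by (rule similarity_cross[OF f])
    have cross0': "\<bar>cross (x' - A') (y' - A')\<bar> > 0" using cross0 cross_eq by auto
    have dists: "dist A x = s * dist A' x'" "dist A y = s * dist A' y'"
      unfolding im by (simp_all add: similarity_dist[OF f])
    have "\<bar>\<beta>\<bar> * \<bar>cross (x - A) (y - A)\<bar> = \<bar>cross (x - A) v\<bar>" by (simp add: veq cross_add abs_mult)
    also have "\<dots> \<le> norm (x - A) * norm v" by (rule cross_le_norm)
    also have "\<dots> = s * dist A' x' * norm v" using dists(1) by (simp add: dist_norm norm_minus_commute)
    finally have "s * (s * \<bar>\<beta>\<bar> * \<bar>cross (x' - A') (y' - A')\<bar>) \<le> s * (dist A' x' * norm v)"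
      by (simp add: cross_eq power2_eq_square mult_ac)
    then have "s * \<bar>\<beta>\<bar> * \<bar>cross (x' - A') (y' - A')\<bar> \<le> dist A' x' * norm v" using s(1) by simp
    then have "s * \<bar>\<beta>\<bar> \<le> \<kappa> (A', x', y')" using cross0' by (simp add: \<kappa>_def pos_le_divide_eq)
    then have sb: "s * \<bar>\<beta>\<bar> \<le> K" using K[OF inV] by linarith
    moreover have "s * (2 * \<bar>\<beta>\<bar>) = 2 * (s * \<bar>\<beta>\<bar>)" by simp
    ultimately have "s * (2 * \<bar>\<beta>\<bar>) < s * 1" using s(2) by linarith
    then have small: "2 * \<bar>\<beta>\<bar> < 1" using s(1) by (simp only: mult_less_cancel_left_pos)
    obtain N :: nat and \<omega> \<delta> where \<omega>: "\<omega> = \<bar>\<beta>\<bar> * dist A y" "\<omega> > 0"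
      "\<omega> \<in> list_sums vertex_distances" "\<delta> \<in> list_sums vertex_distances" "\<delta> \<le> \<omega>"
      and dec: "dist A y = real N * \<omega> + \<delta>"
      by (rule edge_length_decomposition[OF per F S_def e cross0 veq ab mp[OF vert] small])
    have "\<omega> = s * \<bar>\<beta>\<bar> * dist A' y'" using \<omega>(1) dists(2) by simp
    also have "\<dots> \<le> K * M" using sb M[OF inV(1,3)] K0 by (intro mult_mono) auto
    finally have "\<omega> \<in> \<Omega>" "\<delta> \<in> \<Omega>" using \<omega> by (auto simp: \<Omega>_def)
    moreover have "dist A' y' \<in> vertex_distances" using A' ne by (auto simp: vertex_distances_def)
    moreover have "norm \<eta> ^ k * dist A' y' = real N * \<omega> + \<delta>" using dec dists(2) by (simp add: s_def)
    ultimately show "\<exists>l\<in>vertex_distances. \<exists>\<omega>\<in>\<Omega>. \<exists>\<delta>\<in>\<Omega>. \<exists>N::nat.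
        \<omega> > 0 \<and> norm \<eta> ^ k * l = real N * \<omega> + \<delta>"
      using \<omega>(2) by blast
  qed
qed

end

lemma (in substitution) aperiodic_if_eigenvector_irrational:
  assumes tiling: "is_substitution_tiling \<eta> P D T"
    and prim: "primitive_matrix d A"
    and eig: "\<And>i. i \<in> {1..d} \<Longrightarrow> (\<Sum>j=1..d. real (A i j) * s j) = (norm \<eta>)\<^sup>2 * s i"
    and s: "\<And>i. i \<in> {1..d} \<Longrightarrow> s i > 0" "s 1 = 1" and i0: "i0 \<in> {1..d}" "s i0 \<notin> \<rat>"
  shows "aperiodic T"
  unfolding aperiodic_def
proof (intro allI impI notI)
  fix v :: complex assume v: "v \<noteq> 0" and per: "(\<lambda>t. (+) v ` t) ` T = T"
  obtain \<Omega> k0 where \<Omega>: "finite \<Omega>" and dec: "\<forall>k\<ge>k0.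
      \<exists>l\<in>vertex_distances. \<exists>\<omega>\<in>\<Omega>. \<exists>\<delta>\<in>\<Omega>. \<exists>N::nat. \<omega> > 0 \<and> norm \<eta> ^ k * l = real N * \<omega> + \<delta>"
    by (rule supertile_edge_lengths[OF tiling per v])
  \<comment> \<open>Edge lengths scale by \<open>norm \<eta>\<close>, the matrix eigenvalue is its
    square; even exponents turn the length relation into one for powers of the eigenvalue.\<close>
  define Q where "Q m = (\<lambda>(l, \<omega>, \<delta>). \<omega> > 0 \<and> (\<exists>N::nat. norm \<eta> ^ (2 * m) * l = real N * \<omega> + \<delta>))" for m
  have "\<forall>m\<in>{k0..}. \<exists>c. c \<in> vertex_distances \<times> \<Omega> \<times> \<Omega> \<and> Q m c"
  proof
    fix m assume "m \<in> {k0..}"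
    then have "2 * m \<ge> k0" by simp
    with dec obtain l \<omega> \<delta> where "l \<in> vertex_distances" "\<omega> \<in> \<Omega>" "\<delta> \<in> \<Omega>" "Q m (l, \<omega>, \<delta>)"
      unfolding Q_def by auto
    then show "\<exists>c. c \<in> vertex_distances \<times> \<Omega> \<times> \<Omega> \<and> Q m c" by blast
  qed
  from bchoice[OF this]
  obtain c where c: "\<And>m. m \<in> {k0..} \<Longrightarrow> c m \<in> vertex_distances \<times> \<Omega> \<times> \<Omega> \<and> Q m (c m)" by blast
  have "finite (c ` {k0..})"
  proof (rule finite_subset)
    show "c ` {k0..} \<subseteq> vertex_distances \<times> \<Omega> \<times> \<Omega>" using c by blast
  qed (use finite_vertex_distances \<Omega> in auto)
  then obtain m0 where m0: "m0 \<in> {k0..}" "infinite {m \<in> {k0..}. c m = c m0}"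
    using pigeonhole_infinite[OF infinite_Ici, of c k0] by blast
  obtain l \<omega> \<delta> where c0: "c m0 = (l, \<omega>, \<delta>)" by (cases "c m0") auto
  define I where "I = {m \<in> {k0..}. c m = c m0}"
  have l: "l > 0" and \<omega>: "\<omega> > 0" using c[OF m0(1)] vertex_distances_pos by (auto simp: c0 Q_def)
  have "\<forall>m\<in>I. \<exists>N::nat. norm \<eta> ^ (2 * m) * l = real N * \<omega> + \<delta>"
    using c by (force simp: I_def c0 Q_def)
  then obtain N :: "nat \<Rightarrow> nat" where N: "\<And>m. m \<in> I \<Longrightarrow> norm \<eta> ^ (2 * m) * l = real (N m) * \<omega> + \<delta>" by metis
  have "((norm \<eta>)\<^sup>2) ^ m = real (N m) * (\<omega> / l) + \<delta> / l" if "m \<in> I" for m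
  proof -
    have "((norm \<eta>)\<^sup>2) ^ m * l = real (N m) * \<omega> + \<delta>" using N[OF that] by (simp only: power_mult)
    then show ?thesis using l by (simp add: field_simps)
  qed
  moreover have "(norm \<eta>)\<^sup>2 > 1" using eta(1) by simp
  moreover have "\<omega> / l > 0" using \<omega> l by simp
  ultimately show False
    using eigenvalue_powers_not_arithmetic[OF prim eig s i0, where I = I and N = N and a = "\<omega> / l" and b = "\<delta> / l"]
      m0(2) unfolding I_def by blast
qed

theorem theorem2p2:
  fixes n :: nat and \<eta> :: complex and R lam :: real and c :: "nat \<Rightarrow> nat"
    and P :: "'p::finite \<Rightarrow> complex set" and D :: "'p \<Rightarrow> 'p tile_copy set"
    and T :: "complex set set"
  assumes "n \<ge> 4"
    and "is_substitution \<eta> P D"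
    and "is_substitution_tiling \<eta> P D T"
    and "is_cyclotomic n T"
    and "\<eta> \<in> cyclotomic_ring (2 * n)"
    and "R > 0"
    and areas: "\<forall>p. \<exists>k. 0 < k \<and> k < n \<and> area (P p) = R * sin (real k * pi / real n)"
    and "lam = norm (\<eta>\<^sup>2)"
    and "lam = (\<Sum>k=1..n div 2. real (c k) * mu n k)"
    and "Max (c ` {1..n div 2}) > 0"
    and "lam \<notin> \<nat>"
    and "even n \<and> n > 4 \<longrightarrow>
           min (Max (c ` {k \<in> {1..n div 2}. odd k})) (Max (c ` {k \<in> {1..n div 2}. even k})) \<ge> 1"
    and "is_class_substitution_matrix n R P D (M_combination n c)"
    and "primitive_matrix (n div 2) (M_combination n c)"
    and rotated_pair: "\<exists>p q g h k. (q, g) \<in> D p \<and> (q, h) \<in> D p \<and> 0 < k \<and> k < n \<and>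
           orientations_differ_by (real k * pi / real n) g h"
  shows "aperiodic T"
proof -
  interpret substitution \<eta> P D by unfold_locales (rule assms(2))
  have n2: "n \<ge> 2" and "2 \<in> {1..n div 2}" using assms(1) by auto
  show ?thesis
    by (rule aperiodic_if_eigenvector_irrational[OF assms(3) assms(14)
        class_areas_eigenvector[OF n2 assms(6) areas assms(13,14)] mu_pos mu_1[OF n2]
        \<open>2 \<in> {1..n div 2}\<close> mu_2_irrational[OF assms(1)]])
qed

end
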